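(* Let $d\ge2$, $\kappa,\rho>0$ and $\gamma\in[-\infty,0)$. Let $u$ be the solution with homogeneous initial condition $u_0\equiv1$ and let $m_x(t)=\langle u(t,x)\rangle$. Then for all $x\in\mathbb{Z}^d$, $$\lim_{t\to\infty}m_x(t)=1.$$
   Context: Parabolic Anderson model with a moving trap: $u\colon[0,\infty)\times\mathbb{Z}^d\to[0,\infty)$ solves $\frac{\partial}{\partial t}u(t,x)=\kappa\Delta u(t,x)+\xi(t,x)u(t,x)$, $u(0,x)=u_0(x)$, where $\Delta f(x)=\sum_{y\in\mathbb{Z}^d:|x-y|=1}[f(y)-f(x)]$ is the discrete Laplacian and $\xi(t,x)=\gamma\,\delta_{Y_t}(x)$ (equal to $\gamma$ if $x=Y_t$ and $0$ otherwise), with $Y$ a continuous-time simple symmetric random walk on $\mathbb{Z}^d$ with generator $\rho\Delta$ started at the origin. $\langle\cdot\rangle$ denotes expectation with respect to $Y$. The solution is given by the Feynman-Kac formula $u(t,x)=\mathbb{E}^X_x\big[\exp\{\gamma\int_0^t\delta_{Y_{t-s}}(X_s)\,ds\}\,u_0(X_t)\big]$, where $X$ is a random walk with generator $\kappa\Delta$ started at $x$, independent of $Y$ (for $\gamma=-\infty$ the exponential is $1$ if the integral is $0$ and $0$ otherwise). *)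

theory Defs
  imports "HOL-Probability.Probability"
begin

definition lattice_norm :: "int ^ 'd \<Rightarrow> int" where
  "lattice_norm x = (\<Sum>i\<in>UNIV. \<bar>x $ i\<bar>)"

definition laplacian :: "(int ^ 'd \<Rightarrow> real) \<Rightarrow> int ^ 'd \<Rightarrow> real" where
  "laplacian f x = (\<Sum>y | lattice_norm (x - y) = 1. f y - f x)"

lemma finite_neighbours: "finite {y :: int ^ 'd. lattice_norm (x - y) = 1}"
proof -
  have "{y :: int ^ 'd. lattice_norm (x - y) = 1}
      \<subseteq> vec_lambda ` (\<Pi>\<^sub>E i\<in>UNIV. {x $ i - 1..x $ i + 1})"
  proof
    fix y :: "int ^ 'd"
    assume "y \<in> {y. lattice_norm (x - y) = 1}"
    then have "\<bar>x $ i - y $ i\<bar> \<le> 1" for i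
      using member_le_sum[of i UNIV "\<lambda>i. \<bar>(x - y) $ i\<bar>"] by (simp add: lattice_norm_def)
    then have "y $ i \<in> {x $ i - 1..x $ i + 1}" for i
      by (simp add: abs_le_iff algebra_simps)
    then have "vec_nth y \<in> (\<Pi>\<^sub>E i\<in>UNIV. {x $ i - 1..x $ i + 1})"
      by (simp add: PiE_iff)
    then show "y \<in> vec_lambda ` (\<Pi>\<^sub>E i\<in>UNIV. {x $ i - 1..x $ i + 1})"
      by (metis image_eqI vec_nth_inverse)
  qed
  then show ?thesis
    by (rule finite_subset) (intro finite_imageI finite_PiE; simp)
qed

text \<open>The semigroup \<open>exp (t L)\<close>, as a power series. It is only applied to \<open>L = \<kappa> \<Delta>\<close> and
  bounded \<open>f\<close>; since \<open>\<kappa> \<Delta>\<close> is a bounded operator for the supremum norm, the series converges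
  absolutely.\<close>

definition semigroup_of ::
    "((int ^ 'd \<Rightarrow> real) \<Rightarrow> int ^ 'd \<Rightarrow> real) \<Rightarrow> real \<Rightarrow> (int ^ 'd \<Rightarrow> real) \<Rightarrow> int ^ 'd \<Rightarrow> real" where
  "semigroup_of L t f x = (\<Sum>n. t ^ n / fact n * (L ^^ n) f x)"

text \<open>A random walk with generator \<open>\<kappa> \<Delta>\<close> started at \<open>x\<close>: right-continuous paths, and the
  finite-dimensional distributions of the Markov process with semigroup \<open>exp (t \<kappa> \<Delta>)\<close>.
  The case \<open>n = 0\<close> of the last clause says that the walk starts at \<open>x\<close> almost surely.
  The space of lattice points is discrete, so right-continuity at \<open>t\<close> means being constant on
  some interval \<open>[t, t + \<epsilon>)\<close>.\<close>

definition random_walk ::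
    "'a measure \<Rightarrow> real \<Rightarrow> int ^ 'd \<Rightarrow> (real \<Rightarrow> 'a \<Rightarrow> int ^ 'd) \<Rightarrow> bool" where
  "random_walk M \<kappa> x X \<longleftrightarrow>
     prob_space M \<and>
     (\<forall>t\<ge>0. X t \<in> M \<rightarrow>\<^sub>M count_space UNIV) \<and>
     (\<forall>\<omega>\<in>space M. \<forall>t\<ge>0. \<forall>\<^sub>F s in at_right t. X s \<omega> = X t \<omega>) \<and>
     (\<forall>n \<tau> z. \<tau> 0 = 0 \<and> (\<forall>i<n. \<tau> i \<le> \<tau> (Suc i)) \<and> z 0 = x \<longrightarrow>
        measure M {\<omega> \<in> space M. \<forall>i\<le>n. X (\<tau> i) \<omega> = z i} =
        (\<Prod>i<n. semigroup_of (\<lambda>f y. \<kappa> * laplacian f y) (\<tau> (Suc i) - \<tau> i)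
                  (indicat_real {z (Suc i)}) (z i)))"

text \<open>Nonnegative solutions of \<open>\<partial>u/\<partial>t = \<kappa> \<Delta> u + \<xi> u\<close>, \<open>u(0, \<cdot>) = u\<^sub>0\<close>. The potential of a
  moving trap jumps in time, and at a jump of \<open>\<xi>(\<cdot>, x)\<close> the function \<open>u(\<cdot>, x)\<close> is continuous
  but in general not differentiable; the equation is required at all other times.\<close>

definition pam_solution ::
    "real \<Rightarrow> (real \<Rightarrow> int ^ 'd \<Rightarrow> real) \<Rightarrow> (int ^ 'd \<Rightarrow> real) \<Rightarrow> (real \<Rightarrow> int ^ 'd \<Rightarrow> real) \<Rightarrow> bool" where
  "pam_solution \<kappa> \<xi> u0 u \<longleftrightarrow>
     (\<forall>t\<ge>0. \<forall>x. 0 \<le> u t x) \<and>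
     (\<forall>x. u 0 x = u0 x) \<and>
     (\<forall>x. continuous_on {0..} (\<lambda>t. u t x)) \<and>
     (\<forall>x. \<forall>t>0. (\<forall>\<^sub>F s in at t. \<xi> s x = \<xi> t x) \<longrightarrow>
        ((\<lambda>s. u s x) has_real_derivative \<kappa> * laplacian (u t) x + \<xi> t x * u t x) (at t))"

text \<open>The Feynman-Kac formula for a trap of infinite strength moving along the path \<open>y\<close>;
  \<open>P x\<close> is the law under which the walk \<open>X\<close> starts at \<open>x\<close>.\<close>

definition hard_trap_feynman_kac ::
    "(int ^ 'd \<Rightarrow> 'a measure) \<Rightarrow> (real \<Rightarrow> 'a \<Rightarrow> int ^ 'd) \<Rightarrow> (real \<Rightarrow> int ^ 'd) \<Rightarrow>
     (int ^ 'd \<Rightarrow> real) \<Rightarrow> real \<Rightarrow> int ^ 'd \<Rightarrow> real" where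
  "hard_trap_feynman_kac P X y u0 t x =
     (LINT \<omega>|P x.
        (if (LINT s:{0..t}|lborel. (if X s \<omega> = y (t - s) then 1 else 0 :: real)) = 0 then 1 else 0)
        * u0 (X t \<omega>))"

text \<open>For \<open>\<gamma> = -\<infinity>\<close> the differential equation has no meaning, and the solution is by definition
  given by the Feynman-Kac formula.\<close>

definition trap_solution ::
    "(int ^ 'd \<Rightarrow> 'a measure) \<Rightarrow> (real \<Rightarrow> 'a \<Rightarrow> int ^ 'd) \<Rightarrow> real \<Rightarrow> ereal \<Rightarrow> (real \<Rightarrow> int ^ 'd) \<Rightarrow>
     (int ^ 'd \<Rightarrow> real) \<Rightarrow> (real \<Rightarrow> int ^ 'd \<Rightarrow> real) \<Rightarrow> bool" where
  "trap_solution P X \<kappa> \<gamma> y u0 u \<longleftrightarrow>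
     (if \<gamma> = -\<infinity> then \<forall>t\<ge>0. \<forall>x. u t x = hard_trap_feynman_kac P X y u0 t x
      else pam_solution \<kappa> (\<lambda>t x. if x = y t then real_of_ereal \<gamma> else 0) u0 u)"

end

theory Submission
  imports Defs
begin

text \<open>Both for finite \<open>\<gamma>\<close> and for \<open>\<gamma> = -\<infinity>\<close>, \<open>1 - u(t, x)\<close> is at most the limit
  inferior, as \<open>N\<close> tends to infinity, of the probability that \<open>X\<close>, started at \<open>x\<close>, meets the path
  \<open>s \<mapsto> Y (t - s)\<close> at a point of the time grid of mesh \<open>h = t / N\<close>.
  So it suffices to bound, uniformly in small \<open>h\<close>, the \<open>Y\<close>-average of the meeting probability on a grid.

  Decompose at the last meeting in the time of \<open>X\<close>, say at \<open>Y\<close>-time \<open>k h\<close>. If \<open>q k\<close> denotes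
  the probability that the difference walk (rate \<open>\<kappa> + \<rho>\<close>) does not return to 0 within \<open>k\<close> steps,
  the \<open>k\<close>-th term is at most \<open>sup p\<close> at \<open>X\<close>-time \<open>(N - k) h\<close>, times \<open>q k\<close>, where \<open>p\<close> is the heat
  kernel. It is also at most a constant times \<open>h\<close> times \<open>sup p\<close> at a time of order \<open>t\<close>, because the
  walks can only meet after one of them has jumped.

  If the Green function \<open>\<integral> p s 0 ds\<close> is finite, then \<open>s * p s 0\<close> tends to 0 and the second bound
  suffices. Otherwise \<open>sup p s \<le> 1 / s\<close> (as \<open>d \<ge> 2\<close>); the second bound makes the meetings at
  \<open>X\<close>-times below \<open>\<epsilon> t\<close> contribute \<open>O(\<epsilon>)\<close>, and the renewal identity \<open>\<Sum>i\<le>n. p (i h) 0 * q (n - i) = 1\<close>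
  for the difference walk bounds \<open>\<Sum>k. q k\<close> by \<open>O(t)\<close> over the diverging Green function, so that by
  the first bound the remaining meetings contribute \<open>o(1)\<close>.\<close>

section \<open>The heat kernel of the lattice Laplacian\<close>

text \<open>The hypotheses on \<open>X\<close> and \<open>Y\<close> speak only of finite-dimensional
  distributions and right-constant paths, so neither jump times nor a strong Markov property are at
  hand. Hence the time grid: there every probability is a finite iteration of one-step laws, and
  mesh 0 is reached only at the end, by Fatou's lemma, which asks for a one-sided comparison and not
  for convergence of meeting probabilities. The last meeting is chosen, rather than the first,
  because the part of \<open>X\<close> before it enters only through a heat kernel, which is at most
  its value at 0 wherever \<open>Y\<close> stands. The average of the remaining factor obeys a
  renewal equation. The split by the Green function spares kernel asymptotics in each dimension: a
  convergent integral of a decreasing function gives \<open>o(1 / s)\<close>, and if the integral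
  diverges, \<open>1 / s\<close> suffices. The kernel is defined by its Fourier integral, because
  monotonicity in time and the maximum at 0 can be read off there. Its positivity, total mass and
  semigroup property, invisible in that form, are read off the walk.\<close>

definition kern1 :: "real \<Rightarrow> int \<Rightarrow> real" where
  "kern1 t n = integral {0..pi} (\<lambda>\<theta>. exp (- 2 * t * (1 - cos \<theta>)) * cos (of_int n * \<theta>)) / pi"

lemma kern1_integrable:
  "(\<lambda>\<theta>. exp (- 2 * t * (1 - cos \<theta>)) * cos (of_int n * \<theta>)) integrable_on {0..pi}"
  by (intro integrable_continuous_interval continuous_intros)

lemma kern1_uminus [simp]: "kern1 t (- n) = kern1 t n"
  by (simp add: kern1_def)

lemma kern1_0: "kern1 0 n = (if n = 0 then 1 else 0)"
proof (cases "n = 0")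
  case False
  have "((\<lambda>\<theta>. cos (of_int n * \<theta>)) has_integral
      sin (of_int n * pi) / of_int n - sin (of_int n * 0) / of_int n) {0..pi}"
    using False
    by (intro fundamental_theorem_of_calculus)
       (auto intro!: derivative_eq_intros simp flip: has_real_derivative_iff_has_vector_derivative)
  then have "((\<lambda>\<theta>. cos (of_int n * \<theta>)) has_integral 0) {0..pi}"
    by (simp add: sin_zero_iff_int2 mult.commute)
  with False show ?thesis
    by (simp add: kern1_def integral_unique)
qed (simp add: kern1_def)

text \<open>\<open>cos (n * \<theta>)\<close> is an eigenfunction of the one-dimensional Laplacian
  with eigenvalue \<open>- 2 * (1 - cos \<theta>)\<close>, the factor that differentiation in
  \<open>t\<close> brings down from the exponential; so \<open>kern1\<close> solves the heat
  equation on the integers.\<close>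

lemma has_derivative_kern1:
  "((\<lambda>t. kern1 t n) has_real_derivative kern1 t (n + 1) + kern1 t (n - 1) - 2 * kern1 t n) (at t)"
proof -
  let ?f = "\<lambda>t \<theta>. exp (- 2 * t * (1 - cos \<theta>)) * cos (of_int n * \<theta>)"
  let ?f' = "\<lambda>t \<theta>. - 2 * (1 - cos \<theta>) * exp (- 2 * t * (1 - cos \<theta>)) * cos (of_int n * \<theta>)"
  have "((\<lambda>t. integral (cbox 0 pi) (?f t)) has_field_derivative integral (cbox 0 pi) (?f' t)) (at t within UNIV)"
  proof (rule leibniz_rule_field_derivative)
    show "(\<lambda>\<theta>. ?f t \<theta>) integrable_on cbox 0 pi" for t
      using kern1_integrable by simp
    show "continuous_on (UNIV \<times> cbox 0 pi) (\<lambda>(t, \<theta>). ?f' t \<theta>)"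
      unfolding case_prod_beta by (intro continuous_intros)
  qed (auto intro!: derivative_eq_intros)
  moreover have "integral {0..pi} (?f' t) / pi = kern1 t (n + 1) + kern1 t (n - 1) - 2 * kern1 t n"
  proof -
    let ?g = "\<lambda>m \<theta>. exp (- 2 * t * (1 - cos \<theta>)) * cos (of_int m * \<theta>)"
    have "?f' t \<theta> = ?g (n + 1) \<theta> + ?g (n - 1) \<theta> - 2 * ?g n \<theta>" for \<theta>
    proof -
      have "cos (of_int (n + 1) * \<theta>) + cos (of_int (n - 1) * \<theta>) = 2 * cos \<theta> * cos (of_int n * \<theta>)"
        by (simp add: algebra_simps cos_add cos_diff)
      then have "exp (- 2 * t * (1 - cos \<theta>)) * (cos (of_int (n + 1) * \<theta>) + cos (of_int (n - 1) * \<theta>)) = exp (- 2 * t * (1 - cos \<theta>)) * (2 * cos \<theta> * cos (of_int n * \<theta>))"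
        by (rule arg_cong)
      then show ?thesis by (simp only: distrib_left) (simp add: algebra_simps)
    qed
    then have "integral {0..pi} (?f' t) = integral {0..pi} (\<lambda>\<theta>. ?g (n + 1) \<theta> + ?g (n - 1) \<theta> - 2 * ?g n \<theta>)"
      by (intro integral_cong) simp
    also have "\<dots> = integral {0..pi} (?g (n + 1)) + integral {0..pi} (?g (n - 1)) - 2 * integral {0..pi} (?g n)"
    proof -
      have "((\<lambda>\<theta>. ?g (n + 1) \<theta> + ?g (n - 1) \<theta> - 2 * ?g n \<theta>) has_integral
         integral {0..pi} (?g (n + 1)) + integral {0..pi} (?g (n - 1)) - 2 * integral {0..pi} (?g n)) {0..pi}"
        by (intro has_integral_diff has_integral_add has_integral_mult_right integrable_integral kern1_integrable)
      then show ?thesis by (rule integral_unique)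
    qed
    finally show ?thesis
      by (simp add: kern1_def diff_divide_distrib add_divide_distrib)
  qed
  ultimately show ?thesis
    unfolding kern1_def by (auto dest: DERIV_cdivide[where c = pi] simp: kern1_def)
qed

lemma abs_kern1_le: "\<bar>kern1 t n\<bar> \<le> kern1 t 0"
proof -
  have "norm (integral {0..pi} (\<lambda>\<theta>. exp (- 2 * t * (1 - cos \<theta>)) * cos (of_int n * \<theta>)))
      \<le> integral {0..pi} (\<lambda>\<theta>. exp (- 2 * t * (1 - cos \<theta>)) * cos (of_int 0 * \<theta>))"
    by (intro integral_norm_bound_integral kern1_integrable) (auto simp: abs_mult)
  then show ?thesis by (simp add: kern1_def divide_right_mono)
qed

lemma kern1_antimono: "s \<le> t \<Longrightarrow> kern1 t 0 \<le> kern1 s 0"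
  unfolding kern1_def
  by (intro divide_right_mono integral_le kern1_integrable) (auto intro!: mult_right_mono)

lemma kern1_0_nonneg: "0 \<le> kern1 t 0"
  using abs_kern1_le[of t 0] by linarith

lemma kern1_0_le_1: "0 \<le> t \<Longrightarrow> kern1 t 0 \<le> 1"
  using kern1_antimono[of 0 t] by (simp add: kern1_0)

text \<open>Concavity of the sine gives \<open>sin (x / 2) >= x / pi\<close>, and
  \<open>1 - cos x\<close> is twice the square of the left side.\<close>

lemma one_minus_cos_ge:
  fixes x :: real
  assumes "0 \<le> x" "x \<le> pi"
  shows "2 * (x / pi)\<^sup>2 \<le> 1 - cos x"
proof -
  have conc: "convex_on {0..pi} (\<lambda>x. - sin x)"
    by (rule f''_ge0_imp_convex[where f' = "\<lambda>x. - cos x" and f'' = sin])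
       (auto intro!: derivative_eq_intros sin_ge_zero)
  have c: "convex_on {0..pi/2} (\<lambda>x. - sin x)"
    by (rule convex_on_subset[OF conc]) auto
  have "- sin ((1 - x / pi) *\<^sub>R 0 + (x / pi) *\<^sub>R (pi / 2)) \<le> (1 - x / pi) * (- sin 0) + (x / pi) * (- sin (pi / 2))"
    by (rule convex_onD[OF c]) (use assms in auto)
  then have "x / pi \<le> sin (x / 2)" by simp
  then have "(x / pi)\<^sup>2 \<le> (sin (x / 2))\<^sup>2"
    using assms by (intro power_mono) auto
  moreover have "cos x = 1 - 2 * (sin (x / 2))\<^sup>2"
    using cos_double_sin[of "x / 2"] by simp
  ultimately show ?thesis by simp
qed

text \<open>The inequality \<open>exp (- a) <= 1 / (1 + a)\<close> replaces the Gaussian integral by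
  one of arctangent type. The constant obtained is \<open>pi / 4\<close>, rounded up to 1.\<close>

lemma kern1_le_inverse_sqrt:
  assumes "0 < t"
  shows "kern1 t 0 \<le> 1 / sqrt t"
proof -
  \<comment> \<open>Chosen so that \<open>(c * \<theta>)\<^sup>2\<close> is the lower bound of
    \<open>2 * t * (1 - cos \<theta>)\<close> given by \<open>one_minus_cos_ge\<close>.\<close>
  define c where "c = 2 * sqrt t / pi"
  have c: "c > 0" "c\<^sup>2 = 4 * t / pi\<^sup>2"
    using assms by (auto simp: c_def power_divide power_mult_distrib)
  have int: "((\<lambda>\<theta>. 1 / (1 + (c * \<theta>)\<^sup>2)) has_integral arctan (c * pi) / c - arctan (c * 0) / c) {0..pi}"
    using c(1)
    by (intro fundamental_theorem_of_calculus)
       (auto intro!: derivative_eq_intros simp flip: has_real_derivative_iff_has_vector_derivative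
         simp: inverse_eq_divide)
  have "integral {0..pi} (\<lambda>\<theta>. exp (- 2 * t * (1 - cos \<theta>)) * cos (of_int 0 * \<theta>)) \<le> integral {0..pi} (\<lambda>\<theta>. 1 / (1 + (c * \<theta>)\<^sup>2))"
  proof (rule integral_le[OF kern1_integrable])
    show "(\<lambda>\<theta>. 1 / (1 + (c * \<theta>)\<^sup>2)) integrable_on {0..pi}"
      using int by blast
    fix \<theta> assume th: "\<theta> \<in> {0..pi}"
    have "(c * \<theta>)\<^sup>2 = 2 * t * (2 * (\<theta> / pi)\<^sup>2)"
      by (simp add: power_mult_distrib c(2) power_divide)
    also have "\<dots> \<le> 2 * t * (1 - cos \<theta>)"
      using th assms by (intro mult_left_mono one_minus_cos_ge) auto
    finally have "1 + (c * \<theta>)\<^sup>2 \<le> exp (2 * t * (1 - cos \<theta>))"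
      using exp_ge_add_one_self[of "2 * t * (1 - cos \<theta>)"] by linarith
    then have "inverse (exp (2 * t * (1 - cos \<theta>))) \<le> inverse (1 + (c * \<theta>)\<^sup>2)"
      by (intro le_imp_inverse_le) (auto intro: add_pos_nonneg)
    moreover have "exp (- 2 * t * (1 - cos \<theta>)) = inverse (exp (2 * t * (1 - cos \<theta>)))"
      by (simp flip: exp_minus)
    ultimately show "exp (- 2 * t * (1 - cos \<theta>)) * cos (of_int 0 * \<theta>) \<le> 1 / (1 + (c * \<theta>)\<^sup>2)"
      by (simp only: of_int_0 mult_zero_left cos_zero mult_1_right inverse_eq_divide)
  qed
  also have "\<dots> = arctan (c * pi) / c"
    using int by (simp add: integral_unique)
  also have "\<dots> \<le> (pi / 2) / c"
    using c(1) arctan_ubound[of "c * pi"] by (intro divide_right_mono) auto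
  also have "\<dots> = pi * (pi / 4) / sqrt t"
    by (simp add: c_def)
  also have "\<dots> \<le> pi * 1 / sqrt t"
    using assms pi_less_4 by (intro divide_right_mono mult_left_mono) auto
  finally show ?thesis
    unfolding kern1_def by (simp add: pos_divide_le_eq)
qed

section \<open>The lattice kernel as a product over coordinates\<close>

abbreviation unitv :: "'d \<Rightarrow> int ^ 'd" where "unitv i \<equiv> axis i 1"

lemma lattice_norm_eq_1_iff:
  fixes x :: "int ^ 'd"
  shows "lattice_norm x = 1 \<longleftrightarrow> (\<exists>i. x = unitv i \<or> x = - unitv i)"
proof
  assume "lattice_norm x = 1"
  then have s: "(\<Sum>i\<in>UNIV. \<bar>x $ i\<bar>) = 1" by (simp add: lattice_norm_def)
  then obtain i where i: "x $ i \<noteq> 0"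
    by (metis (no_types, lifting) abs_zero sum.neutral zero_neq_one)
  have "(\<Sum>j\<in>UNIV. \<bar>x $ j\<bar>) = \<bar>x $ i\<bar> + (\<Sum>j\<in>UNIV - {i}. \<bar>x $ j\<bar>)"
    by (subst sum.remove[of _ i]) auto
  moreover have "(\<Sum>j\<in>UNIV - {i}. \<bar>x $ j\<bar>) \<ge> 0" by (intro sum_nonneg) auto
  moreover have "\<bar>x $ i\<bar> \<ge> 1" using i by linarith
  ultimately have 1: "\<bar>x $ i\<bar> = 1" and 2: "(\<Sum>j\<in>UNIV - {i}. \<bar>x $ j\<bar>) = 0"
    using s by linarith+
  from 2 have "x $ j = 0" if "j \<noteq> i" for j
    using that by (subst (asm) sum_nonneg_eq_0_iff) auto
  then have "x = axis i (x $ i)" by (auto simp: vec_eq_iff axis_def)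
  moreover from 1 have "x $ i = 1 \<or> x $ i = - 1" by linarith
  moreover have "axis i (- 1) = - unitv i" by (simp add: vec_eq_iff axis_def)
  ultimately show "\<exists>i. x = unitv i \<or> x = - unitv i" by metis
next
  assume "\<exists>i. x = unitv i \<or> x = - unitv i"
  then obtain i where "x = unitv i \<or> x = - unitv i" by blast
  then have "(\<Sum>j\<in>UNIV. \<bar>x $ j\<bar>) = (\<Sum>j\<in>UNIV. if j = i then 1 else 0)"
    by (intro sum.cong) (auto simp: axis_def)
  then show "lattice_norm x = 1" by (simp add: lattice_norm_def)
qed

lemma laplacian_eq:
  "laplacian f x = (\<Sum>i\<in>UNIV. f (x + unitv i) + f (x - unitv i) - 2 * f x)"
proof -
  let ?A = "(\<lambda>i. x + unitv i) ` UNIV" and ?B = "(\<lambda>i. x - unitv i) ` UNIV"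
  have set: "{y. lattice_norm (x - y) = 1} = ?A \<union> ?B"
  proof (intro set_eqI iffI)
    fix y assume "y \<in> {y. lattice_norm (x - y) = 1}"
    then obtain i where "x - y = unitv i \<or> x - y = - unitv i"
      by (auto simp: lattice_norm_eq_1_iff)
    then have "y = x - unitv i \<or> y = x + unitv i" by (auto simp: algebra_simps)
    then show "y \<in> ?A \<union> ?B" by auto
  next
    fix y assume "y \<in> ?A \<union> ?B"
    then show "y \<in> {y. lattice_norm (x - y) = 1}"
      by (auto simp: lattice_norm_eq_1_iff)
  qed
  have disj: "?A \<inter> ?B = {}"
  proof -
    have "x + unitv i \<noteq> x - unitv j" for i j
    proof
      assume "x + unitv i = x - unitv j"
      then have "(x + unitv i) $ i = (x - unitv j) $ i" by simp
      then show False by (simp add: axis_def split: if_splits)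
    qed
    then show ?thesis by blast
  qed
  have inj: "inj (\<lambda>i. x + unitv i)" "inj (\<lambda>i. x - unitv i)"
    by (auto simp: inj_def axis_eq_axis)
  have "laplacian f x = (\<Sum>y\<in>?A. f y - f x) + (\<Sum>y\<in>?B. f y - f x)"
    unfolding laplacian_def set by (rule sum.union_disjoint) (auto simp: disj)
  also have "\<dots> = (\<Sum>i\<in>UNIV. f (x + unitv i) - f x) + (\<Sum>i\<in>UNIV. f (x - unitv i) - f x)"
    using inj by (simp add: sum.reindex)
  finally show ?thesis
    by (simp add: sum.distrib[symmetric] algebra_simps)
qed

text \<open>The Laplacian is a sum of one-dimensional ones, so its heat kernel is a product over the
  coordinates. This is the kernel at rate 1; a rate \<kappa> is handled by scaling time.\<close>

definition kern :: "real \<Rightarrow> int ^ 'd \<Rightarrow> real" where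
  "kern t x = (\<Prod>i\<in>UNIV. kern1 t (x $ i))"

lemma kern_uminus [simp]: "kern t (- x) = kern t x"
  by (simp add: kern_def)

lemma kern_0: "kern 0 x = (if x = 0 then 1 else 0)"
  by (auto simp: kern_def kern1_0 vec_eq_iff)

lemma abs_kern_le:
  fixes x :: "int ^ 'd"
  shows "\<bar>kern t x\<bar> \<le> kern t (0 :: int ^ 'd)"
  unfolding kern_def abs_prod by (intro prod_mono conjI) (auto simp: abs_kern1_le)

lemma kern_antimono: "s \<le> t \<Longrightarrow> kern t (0 :: int ^ 'd) \<le> kern s (0 :: int ^ 'd)"
  unfolding kern_def by (intro prod_mono conjI) (auto simp: kern1_antimono kern1_0_nonneg)

lemma kern_0_nonneg: "0 \<le> kern t (0 :: int ^ 'd)"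
  using abs_kern_le[of t "0 :: int ^ 'd"] by linarith

lemma kern_0_le_1: "0 \<le> t \<Longrightarrow> kern t (0 :: int ^ 'd) \<le> 1"
  using kern_antimono[of 0 t, where 'd = 'd] by (simp add: kern_0)

text \<open>Two coordinates contribute \<open>1 / sqrt t\<close> each, the others at most 1. The
  hypothesis that the dimension is at least 2 enters the whole proof through this bound
  alone.\<close>

lemma kern_0_le_inverse:
  assumes "0 < t" and "CARD('d) \<ge> 2"
  shows "kern t (0 :: int ^ 'd) \<le> 1 / t"
proof -
  obtain i j :: 'd where ij: "i \<noteq> j"
    using assms(2) by (metis UNIV_I card_le_Suc0_iff_eq finite not_numeral_le_zero numeral_2_eq_2 not_less_eq_eq)
  have "kern t (0 :: int ^ 'd) = (\<Prod>k\<in>{i, j}. kern1 t 0) * (\<Prod>k\<in>UNIV - {i, j}. kern1 t 0)"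
    unfolding kern_def by (subst prod.subset_diff[of "{i, j}"]) auto
  also have "\<dots> \<le> (\<Prod>k\<in>{i, j}. kern1 t 0) * 1"
    using assms by (intro mult_left_mono prod_le_1 prod_nonneg) (auto simp: kern1_0_nonneg kern1_0_le_1)
  also have "\<dots> = kern1 t 0 * kern1 t 0"
    using ij by simp
  also have "\<dots> \<le> (1 / sqrt t) * (1 / sqrt t)"
    using assms by (intro mult_mono kern1_le_inverse_sqrt kern1_0_nonneg) auto
  also have "\<dots> = 1 / t"
    using assms by simp
  finally show ?thesis .
qed

lemma has_derivative_kern:
  "((\<lambda>t. kern t x) has_real_derivative laplacian (kern t) x) (at t)"
proof -
  have deriv: "((\<lambda>t. kern t x) has_real_derivative
     (\<Sum>i\<in>UNIV. (kern1 t (x $ i + 1) + kern1 t (x $ i - 1) - 2 * kern1 t (x $ i)) *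
        (\<Prod>j\<in>UNIV - {i}. kern1 t (x $ j)))) (at t)"
    unfolding kern_def by (rule has_field_derivative_prod) (rule has_derivative_kern1)
  have ax: "kern t (x + axis i a) = kern1 t (x $ i + a) * (\<Prod>j\<in>UNIV - {i}. kern1 t (x $ j))" for i a
  proof -
    have ax: "kern t (x + axis i a) = kern1 t ((x + axis i a) $ i) * (\<Prod>j\<in>UNIV - {i}. kern1 t ((x + axis i a) $ j))"
      unfolding kern_def by (rule prod.remove) auto
    also have "(\<Prod>j\<in>UNIV - {i}. kern1 t ((x + axis i a) $ j)) = (\<Prod>j\<in>UNIV - {i}. kern1 t (x $ j))"
      by (intro prod.cong) (auto simp: axis_def)
    finally show ?thesis by simp
  qed
  have "x + axis i (- 1) = x - unitv i" "x + axis i 0 = x" for i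
    by (auto simp: vec_eq_iff axis_def)
  with ax[of _ 1] ax[of _ "- 1"] ax[of _ 0]
  have "kern t (x + unitv i) = kern1 t (x $ i + 1) * (\<Prod>j\<in>UNIV - {i}. kern1 t (x $ j))"
    "kern t (x - unitv i) = kern1 t (x $ i - 1) * (\<Prod>j\<in>UNIV - {i}. kern1 t (x $ j))"
    "kern t x = kern1 t (x $ i) * (\<Prod>j\<in>UNIV - {i}. kern1 t (x $ j))" for i
    by simp_all
  then have "laplacian (kern t) x = (\<Sum>i\<in>UNIV. (kern1 t (x $ i + 1) + kern1 t (x $ i - 1) - 2 * kern1 t (x $ i)) *
        (\<Prod>j\<in>UNIV - {i}. kern1 t (x $ j)))"
    unfolding laplacian_eq by (intro sum.cong refl) (simp add: algebra_simps)
  with deriv show ?thesis by simp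
qed

section \<open>Taylor expansion in time and the power series of the semigroup\<close>

lemma has_derivative_laplacian:
  assumes "\<And>x. ((\<lambda>t. f t x) has_real_derivative f' x) (at t)"
  shows "((\<lambda>t. laplacian (f t) x) has_real_derivative laplacian f' x) (at t)"
  unfolding laplacian_eq by (intro DERIV_sum DERIV_add DERIV_diff DERIV_cmult assms)

lemma laplacian_cmult: "laplacian (\<lambda>x. c * f x) x = c * laplacian f x"
  by (simp add: laplacian_eq sum_distrib_left algebra_simps)

lemma laplacian_translate: "laplacian (\<lambda>x. f (x - z)) x = laplacian f (x - z)"
  by (simp add: laplacian_eq algebra_simps)

lemma laplacian_pow_translate: "(laplacian ^^ n) (\<lambda>x. f (x - z)) x = (laplacian ^^ n) f (x - z)"
proof (induction n arbitrary: x)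
  case (Suc n)
  have "(laplacian ^^ n) (\<lambda>x. f (x - z)) = (\<lambda>x. (laplacian ^^ n) f (x - z))"
    using Suc by (intro ext)
  then show ?case
    using laplacian_translate[of "(laplacian ^^ n) f" z x] by simp
qed simp

lemma has_derivative_laplacian_pow_kern:
  "((\<lambda>t. (laplacian ^^ n) (kern t) x) has_real_derivative (laplacian ^^ Suc n) (kern t) x) (at t)"
proof (induction n arbitrary: x)
  case 0
  then show ?case using has_derivative_kern by simp
next
  case (Suc n)
  show ?case
    using has_derivative_laplacian[OF Suc] by simp
qed

lemma abs_laplacian_le:
  fixes f :: "int ^ 'd \<Rightarrow> real" and B :: real
  assumes "\<And>x. \<bar>f x\<bar> \<le> B"
  shows "\<bar>laplacian f x\<bar> \<le> 4 * CARD('d) * B"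
proof -
  have "\<bar>laplacian f x\<bar> \<le> (\<Sum>i\<in>(UNIV :: 'd set). 4 * B)"
    unfolding laplacian_eq
  proof (rule order.trans[OF sum_abs], rule sum_mono)
    fix i :: 'd
    show "\<bar>f (x + unitv i) + f (x - unitv i) - 2 * f x\<bar> \<le> 4 * B"
      using assms[of "x + unitv i"] assms[of "x - unitv i"] assms[of x] by linarith
  qed
  then show ?thesis by simp
qed

lemma abs_laplacian_pow_le:
  fixes f :: "int ^ 'd \<Rightarrow> real" and B :: real
  assumes "\<And>x. \<bar>f x\<bar> \<le> B"
  shows "\<bar>(laplacian ^^ n) f x\<bar> \<le> (4 * CARD('d)) ^ n * B"
proof (induction n arbitrary: x)
  case (Suc n)
  show ?case using abs_laplacian_le[OF Suc] by (simp add: mult.assoc)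
qed (use assms in simp)

text \<open>On bounded functions the Laplacian has norm at most \<open>4 * CARD('d)\<close>, and the
  kernel is at most 1, which bounds the Lagrange remainder. Large \<open>n\<close> yields the power
  series, \<open>n = 1\<close> and \<open>n = 2\<close> the short-time estimates.\<close>

lemma kern_taylor:
  fixes x :: "int ^ 'd" and t :: real
  assumes "0 \<le> t"
  shows "\<bar>kern t x - (\<Sum>m<n. (laplacian ^^ m) (kern 0) x / fact m * t ^ m)\<bar>
     \<le> (4 * CARD('d) * t) ^ n / fact n"
\<comment> \<open>Maclaurin's formula needs \<open>n > 0\<close> and \<open>t > 0\<close>.\<close>
proof (cases "n = 0 \<or> t = 0")
  case True
  have "\<bar>kern t x\<bar> \<le> 1"
    using abs_kern_le[of t x] kern_0_le_1[OF assms, where 'd = 'd] by linarith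
  moreover have "(\<Sum>m<n. (laplacian ^^ m) (kern 0) x / fact m * t ^ m) = kern t x" if "t = 0" "n > 0"
    using that by (subst sum.mono_neutral_cong_right[where S = "{0}" and h = "\<lambda>_. kern 0 x"]) auto
  ultimately show ?thesis using True by (cases "n = 0") auto
next
  case False
  then obtain s where s: "0 < s" "s < t" and
    eq: "kern t x = (\<Sum>m<n. (laplacian ^^ m) (kern 0) x / fact m * t ^ m) + (laplacian ^^ n) (kern s) x / fact n * t ^ n"
    using Maclaurin[of t n "\<lambda>m s. (laplacian ^^ m) (kern s) x" "\<lambda>s. kern s x"]
      has_derivative_laplacian_pow_kern[of _ x] assms by (auto simp del: funpow.simps)
  have "\<bar>kern s z\<bar> \<le> 1" for z :: "int ^ 'd"
    using abs_kern_le[of s z] kern_0_le_1[of s, where 'd = 'd] s by linarith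
  from abs_laplacian_pow_le[of "kern s", OF this]
  have "\<bar>(laplacian ^^ n) (kern s) x\<bar> \<le> (4 * CARD('d)) ^ n" by simp
  then have "\<bar>(laplacian ^^ n) (kern s) x / fact n * t ^ n\<bar> \<le> (4 * CARD('d)) ^ n / fact n * t ^ n"
    using assms by (simp add: abs_mult mult_right_mono divide_right_mono)
  with eq show ?thesis by (simp add: power_mult_distrib)
qed

lemma kern_sums:
  fixes x :: "int ^ 'd" and t :: real
  assumes "0 \<le> t"
  shows "(\<lambda>m. (laplacian ^^ m) (kern 0) x / fact m * t ^ m) sums kern t x"
  unfolding sums_def
proof (rule Lim_transform)
  show "(\<lambda>n. kern t x) \<longlonglongrightarrow> kern t x" by simp
  have "(\<lambda>n. (4 * CARD('d) * t) ^ n / fact n) \<longlonglongrightarrow> 0"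
    using summable_LIMSEQ_zero[OF summable_exp[of "4 * CARD('d) * t"]] by (simp add: field_simps)
  then show "(\<lambda>n. (\<Sum>m<n. (laplacian ^^ m) (kern 0) x / fact m * t ^ m) - kern t x) \<longlonglongrightarrow> 0"
    by (rule Lim_null_comparison[rotated])
       (use kern_taylor[OF assms, of x] in \<open>auto intro!: always_eventually simp: abs_minus_commute\<close>)
qed

text \<open>\<open>indicat_real {z}\<close> is the kernel at time 0 translated by \<open>z\<close>,
  and powers of the Laplacian commute with translations, so the series is the Taylor series of the
  kernel. Through this the definition of a walk becomes a statement on \<open>kern\<close>.\<close>

lemma semigroup_of_laplacian:
  assumes "0 \<le> \<kappa> * t"
  shows "semigroup_of (\<lambda>f y. \<kappa> * laplacian f y) t (indicat_real {z}) x = kern (\<kappa> * t) (x - z)"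
proof -
  have pow: "((\<lambda>f y. \<kappa> * laplacian f y) ^^ n) f x = \<kappa> ^ n * (laplacian ^^ n) f x" for n f x
  proof (induction n arbitrary: x)
    case (Suc n)
    have "laplacian (((\<lambda>f y. \<kappa> * laplacian f y) ^^ n) f) x = \<kappa> ^ n * laplacian ((laplacian ^^ n) f) x"
      unfolding Suc by (rule laplacian_cmult)
    then show ?case by simp
  qed simp
  have ind: "indicat_real {z} = (\<lambda>x. kern 0 (x - z))"
    by (auto simp: kern_0 indicator_def)
  have "(\<lambda>n. t ^ n / fact n * ((\<lambda>f y. \<kappa> * laplacian f y) ^^ n) (indicat_real {z}) x)
      = (\<lambda>m. (laplacian ^^ m) (kern 0) (x - z) / fact m * (\<kappa> * t) ^ m)"
    unfolding ind pow laplacian_pow_translate by (auto simp: power_mult_distrib)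
  then show ?thesis
    unfolding semigroup_of_def using sums_unique[OF kern_sums[OF assms, of "x - z"], symmetric] by simp
qed

text \<open>The Taylor remainder with \<open>n = 1\<close>. This linear order in \<open>t\<close> is
  the source of the factor \<open>h\<close> in the second of the two bounds on a last-meeting
  term.\<close>

lemma one_minus_kern_0_le:
  fixes t :: real
  assumes "0 \<le> t"
  shows "1 - kern t (0 :: int ^ 'd) \<le> 4 * CARD('d) * t"
  using kern_taylor[OF assms, of "0 :: int ^ 'd" 1] by (simp add: kern_0)

lemma kern_taylor2:
  fixes x :: "int ^ 'd" and t :: real
  assumes "0 \<le> t"
  shows "\<bar>kern t x - (kern 0 x + t * laplacian (kern 0) x)\<bar> \<le> 8 * (CARD('d) * t)\<^sup>2"
proof -
  have "{..<2 :: nat} = {0, 1}" by auto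
  then show ?thesis
    using kern_taylor[OF assms, of x 2] by (simp add: power2_eq_square fact_numeral algebra_simps)
qed

section \<open>Random walks and the heat semigroup\<close>

lemma integral_bind_pmf_bounded:
  fixes f :: "'b \<Rightarrow> real"
  assumes "\<And>x. \<bar>f x\<bar> \<le> B"
  shows "measure_pmf.expectation (bind_pmf M N) f =
    measure_pmf.expectation M (\<lambda>x. measure_pmf.expectation (N x) f)"
  unfolding measure_pmf_bind
  by (rule integral_bind[where K = "count_space UNIV" and B = B and B' = 1])
     (use assms in \<open>auto simp: measure_pmf.emeasure_space_1 measure_pmf_in_subprob_algebra\<close>,
      unfold_locales)

lemma integrable_measure_pmf_bounded:
  fixes f :: "'b \<Rightarrow> real"
  assumes "\<And>x. \<bar>f x\<bar> \<le> B"
  shows "integrable (measure_pmf M) f"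
  by (rule measure_pmf.integrable_const_bound[where B = B]) (use assms in auto)

lemma expectation_nonneg:
  fixes f :: "'b \<Rightarrow> real"
  assumes "\<And>x. 0 \<le> f x"
  shows "0 \<le> measure_pmf.expectation p f"
  by (simp add: assms Bochner_Integration.integral_nonneg)

lemma expectation_mono:
  fixes f g :: "'b \<Rightarrow> real"
  assumes "\<And>x. x \<in> set_pmf p \<Longrightarrow> f x \<le> g x" "\<And>x. \<bar>f x\<bar> \<le> B" "\<And>x. \<bar>g x\<bar> \<le> B'"
  shows "measure_pmf.expectation p f \<le> measure_pmf.expectation p g"
  by (rule integral_mono_AE)
     (use assms in \<open>auto intro: integrable_measure_pmf_bounded simp: AE_measure_pmf_iff\<close>)

lemma abs_expectation_le:
  fixes f :: "'b \<Rightarrow> real"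
  assumes "\<And>x. \<bar>f x\<bar> \<le> B"
  shows "\<bar>measure_pmf.expectation p f\<bar> \<le> B"
proof -
  have "\<bar>measure_pmf.expectation p f\<bar> \<le> measure_pmf.expectation p (\<lambda>x. \<bar>f x\<bar>)"
    by (rule integral_abs_bound)
  also have "\<dots> \<le> measure_pmf.expectation p (\<lambda>x. B)"
    using assms by (intro integral_mono integrable_measure_pmf_bounded[where B = "\<bar>B\<bar>"])
      (auto intro: order.trans[OF _ abs_ge_self])
  finally show ?thesis by simp
qed

locale lattice_walk =
  fixes M :: "'a measure" and \<kappa> :: real and x\<^sub>0 :: "int ^ 'd" and X :: "real \<Rightarrow> 'a \<Rightarrow> int ^ 'd"
  assumes walk: "random_walk M \<kappa> x\<^sub>0 X" and rate_pos: "0 < \<kappa>"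
begin

sublocale prob_space M
  using walk by (simp add: random_walk_def)

lemma measurable_walk [measurable]: "0 \<le> t \<Longrightarrow> X t \<in> M \<rightarrow>\<^sub>M count_space UNIV"
  using walk by (simp add: random_walk_def)

lemma measure_fdd:
  assumes "\<tau> 0 = 0" "\<And>i. i < n \<Longrightarrow> \<tau> i \<le> \<tau> (Suc i)" "z 0 = x\<^sub>0"
  shows "prob {\<omega> \<in> space M. \<forall>i\<le>n. X (\<tau> i) \<omega> = z i} =
    (\<Prod>i<n. kern (\<kappa> * (\<tau> (Suc i) - \<tau> i)) (z (Suc i) - z i))"
proof -
  have "prob {\<omega> \<in> space M. \<forall>i\<le>n. X (\<tau> i) \<omega> = z i} =
     (\<Prod>i<n. semigroup_of (\<lambda>f y. \<kappa> * laplacian f y) (\<tau> (Suc i) - \<tau> i) (indicat_real {z (Suc i)}) (z i))"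
    using walk assms unfolding random_walk_def by blast
  also have "\<dots> = (\<Prod>i<n. kern (\<kappa> * (\<tau> (Suc i) - \<tau> i)) (z (Suc i) - z i))"
  proof (rule prod.cong[OF refl])
    fix i assume "i \<in> {..<n}"
    then have "0 \<le> \<kappa> * (\<tau> (Suc i) - \<tau> i)"
      using assms(2) rate_pos by auto
    then show "semigroup_of (\<lambda>f y. \<kappa> * laplacian f y) (\<tau> (Suc i) - \<tau> i) (indicat_real {z (Suc i)}) (z i)
        = kern (\<kappa> * (\<tau> (Suc i) - \<tau> i)) (z (Suc i) - z i)"
      using kern_uminus[of _ "z i - z (Suc i)"] by (simp add: semigroup_of_laplacian)
  qed
  finally show ?thesis .
qed

lemma AE_start: "AE \<omega> in M. X 0 \<omega> = x\<^sub>0"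
proof -
  have "prob {\<omega> \<in> space M. X 0 \<omega> = x\<^sub>0} = 1"
    using measure_fdd[of "\<lambda>_. 0" 0 "\<lambda>_. x\<^sub>0"] by simp
  then show ?thesis
    using prob_Collect_eq_1[of "\<lambda>\<omega>. X 0 \<omega> = x\<^sub>0"] by simp
qed

lemma measure_two_times:
  assumes "0 \<le> s" "s \<le> t"
  shows "prob {\<omega> \<in> space M. X s \<omega> = y \<and> X t \<omega> = z} =
    kern (\<kappa> * s) (y - x\<^sub>0) * kern (\<kappa> * (t - s)) (z - y)"
proof -
  define \<tau> :: "nat \<Rightarrow> real" where "\<tau> i = (if i = 0 then 0 else if i = 1 then s else t)" for i
  define w :: "nat \<Rightarrow> int ^ 'd" where "w i = (if i = 0 then x\<^sub>0 else if i = 1 then y else z)" for i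
  have le2: "(\<forall>i\<le>2. P i) \<longleftrightarrow> P 0 \<and> P 1 \<and> P (2::nat)" for P
    using less_Suc_eq_le by (auto simp: numeral_2_eq_2 le_Suc_eq)
  have t: "0 \<le> t" using assms by simp
  note [measurable] = measurable_walk[OF assms(1)] measurable_walk[OF t] measurable_walk[of 0, simplified]
  have "prob {\<omega> \<in> space M. X s \<omega> = y \<and> X t \<omega> = z} = prob {\<omega> \<in> space M. \<forall>i\<le>2. X (\<tau> i) \<omega> = w i}"
  proof (rule measure_eq_AE)
    show "AE \<omega> in M. (\<omega> \<in> {\<omega> \<in> space M. X s \<omega> = y \<and> X t \<omega> = z}) = (\<omega> \<in> {\<omega> \<in> space M. \<forall>i\<le>2. X (\<tau> i) \<omega> = w i})"
      using AE_start by eventually_elim (auto simp: le2 \<tau>_def w_def)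
  qed (auto simp: le2 \<tau>_def w_def)
  also have "\<dots> = (\<Prod>i<2. kern (\<kappa> * (\<tau> (Suc i) - \<tau> i)) (w (Suc i) - w i))"
    using assms by (intro measure_fdd) (auto simp: \<tau>_def w_def)
  also have "\<dots> = kern (\<kappa> * s) (y - x\<^sub>0) * kern (\<kappa> * (t - s)) (z - y)"
    by (simp add: numeral_2_eq_2 \<tau>_def w_def)
  finally show ?thesis .
qed

lemma measure_one_time:
  assumes "0 \<le> t"
  shows "prob {\<omega> \<in> space M. X t \<omega> = z} = kern (\<kappa> * t) (z - x\<^sub>0)"
proof -
  note [measurable] = measurable_walk[OF assms] measurable_walk[of 0, simplified]
  have "prob {\<omega> \<in> space M. X t \<omega> = z} = prob {\<omega> \<in> space M. X 0 \<omega> = x\<^sub>0 \<and> X t \<omega> = z}"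
    by (rule measure_eq_AE) (use AE_start in auto)
  then show ?thesis
    using measure_two_times[of 0 t x\<^sub>0 z] assms by (simp add: kern_0)
qed

text \<open>Positivity of the Fourier integral is not evident; it is inherited from the walk, whose
  displacement at time \<open>s / \<kappa>\<close> has this law.\<close>

lemma kern_nonneg: "0 \<le> kern s (z :: int ^ 'd)" if "0 \<le> s"
proof -
  have "kern s z = prob {\<omega> \<in> space M. X (s / \<kappa>) \<omega> = x\<^sub>0 + z}"
    using measure_one_time[of "s / \<kappa>" "x\<^sub>0 + z"] that rate_pos by simp
  then show ?thesis by simp
qed

lemma emeasure_split:
  assumes "A \<in> sets M" "f \<in> M \<rightarrow>\<^sub>M count_space (UNIV :: (int ^ 'd) set)"
  shows "emeasure M A = (\<integral>\<^sup>+y. emeasure M {\<omega> \<in> A. f \<omega> = y} \<partial>count_space UNIV)"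
proof -
  have "emeasure M (\<Union>y\<in>UNIV. {\<omega> \<in> A. f \<omega> = y}) = (\<integral>\<^sup>+y. emeasure M {\<omega> \<in> A. f \<omega> = y} \<partial>count_space UNIV)"
  proof (rule emeasure_UN_countable)
    fix y
    have "{\<omega> \<in> A. f \<omega> = y} = A \<inter> {\<omega> \<in> space M. f \<omega> = y}"
      using sets.sets_into_space[OF assms(1)] by auto
    then show "{\<omega> \<in> A. f \<omega> = y} \<in> sets M"
      using assms by simp
  qed (auto simp: disjoint_family_on_def)
  moreover have "(\<Union>y\<in>UNIV. {\<omega> \<in> A. f \<omega> = y}) = A" by auto
  ultimately show ?thesis by simp
qed

lemma kern_sum_1:
  assumes "0 \<le> s"
  shows "(\<integral>\<^sup>+z. ennreal (kern s (z :: int ^ 'd)) \<partial>count_space UNIV) = 1"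
proof -
  have "0 \<le> s / \<kappa>" using assms rate_pos by simp
  note [measurable] = measurable_walk[OF this]
  have "1 = (\<integral>\<^sup>+y. emeasure M {\<omega> \<in> space M. X (s / \<kappa>) \<omega> = y} \<partial>count_space UNIV)"
    by (subst emeasure_space_1[symmetric], rule emeasure_split) auto
  also have "\<dots> = (\<integral>\<^sup>+y. ennreal (kern s (y - x\<^sub>0)) \<partial>count_space UNIV)"
    using assms rate_pos measure_one_time[of "s / \<kappa>"] by (simp add: emeasure_eq_measure)
  also have "\<dots> = (\<integral>\<^sup>+z. ennreal (kern s (z :: int ^ 'd)) \<partial>count_space UNIV)"
    by (rule nn_integral_bij_count_space[where g = "\<lambda>y. y - x\<^sub>0" and f = "\<lambda>y. ennreal (kern s y)"])
       (rule bij_betwI[where g = "\<lambda>z. z + x\<^sub>0"], auto)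
  finally show ?thesis by simp
qed

text \<open>The law of \<open>X\<close> at time \<open>(a + b) / \<kappa>\<close>, split by the
  position at time \<open>a / \<kappa>\<close>.\<close>

lemma chapman_kolmogorov:
  assumes "0 \<le> a" "0 \<le> b"
  shows "(\<integral>\<^sup>+y. ennreal (kern a y * kern b ((z :: int ^ 'd) - y)) \<partial>count_space UNIV) = ennreal (kern (a + b) z)"
proof -
  have nn: "0 \<le> a / \<kappa>" "0 \<le> b / \<kappa>" "0 \<le> (a + b) / \<kappa>" using assms rate_pos by simp_all
  note [measurable] = nn[THEN measurable_walk]
  have "ennreal (kern (a + b) z) = emeasure M {\<omega> \<in> space M. X ((a + b) / \<kappa>) \<omega> = x\<^sub>0 + z}"
    using measure_one_time[OF nn(3), of "x\<^sub>0 + z"] rate_pos by (simp add: emeasure_eq_measure)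
  also have "\<dots> = (\<integral>\<^sup>+y. emeasure M {\<omega> \<in> {\<omega> \<in> space M. X ((a + b) / \<kappa>) \<omega> = x\<^sub>0 + z}. X (a / \<kappa>) \<omega> = y} \<partial>count_space UNIV)"
    by (rule emeasure_split) auto
  also have "\<dots> = (\<integral>\<^sup>+y. ennreal (kern a (y - x\<^sub>0) * kern b (z - (y - x\<^sub>0))) \<partial>count_space UNIV)"
  proof (rule nn_integral_cong)
    fix y
    have "{\<omega> \<in> {\<omega> \<in> space M. X ((a + b) / \<kappa>) \<omega> = x\<^sub>0 + z}. X (a / \<kappa>) \<omega> = y} =
      {\<omega> \<in> space M. X (a / \<kappa>) \<omega> = y \<and> X ((a + b) / \<kappa>) \<omega> = x\<^sub>0 + z}" by auto
    moreover have "prob {\<omega> \<in> space M. X (a / \<kappa>) \<omega> = y \<and> X ((a + b) / \<kappa>) \<omega> = x\<^sub>0 + z} =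
        kern a (y - x\<^sub>0) * kern b (z - (y - x\<^sub>0))"
      using measure_two_times[of "a / \<kappa>" "(a + b) / \<kappa>" y "x\<^sub>0 + z"] nn assms rate_pos
      by (simp add: divide_right_mono add_divide_distrib algebra_simps)
    ultimately show "emeasure M {\<omega> \<in> {\<omega> \<in> space M. X ((a + b) / \<kappa>) \<omega> = x\<^sub>0 + z}. X (a / \<kappa>) \<omega> = y} =
        ennreal (kern a (y - x\<^sub>0) * kern b (z - (y - x\<^sub>0)))"
      by (simp add: emeasure_eq_measure)
  qed
  also have "\<dots> = (\<integral>\<^sup>+y. ennreal (kern a y * kern b (z - y)) \<partial>count_space UNIV)"
    by (rule nn_integral_bij_count_space[where g = "\<lambda>y. y - x\<^sub>0" and f = "\<lambda>y. ennreal (kern a y * kern b (z - y))"])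
       (rule bij_betwI[where g = "\<lambda>z. z + x\<^sub>0"], auto)
  finally show ?thesis by simp
qed

end

text \<open>Used for \<open>s >= 0\<close>; that \<open>kern s\<close> is then a mass function is
  known once a walk is available (\<open>pmf_step\<close>). Time runs at rate 1: over a duration
  \<open>h\<close> a walk of rate \<kappa> makes a \<open>step (\<kappa> * h)\<close>.\<close>

definition step :: "real \<Rightarrow> (int ^ 'd) pmf" where
  "step s = embed_pmf (kern s)"

definition heat :: "real \<Rightarrow> (int ^ 'd \<Rightarrow> real) \<Rightarrow> int ^ 'd \<Rightarrow> real" where
  "heat s f x = measure_pmf.expectation (step s) (\<lambda>y. f (x + y))"

lemma heat_mono:
  assumes "\<And>x. f x \<le> g x" "\<And>x. \<bar>f x\<bar> \<le> B" "\<And>x. \<bar>g x\<bar> \<le> B'"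
  shows "heat s f x \<le> heat s g x"
  unfolding heat_def by (rule expectation_mono) (use assms in auto)

lemma abs_heat_le: "(\<And>x. \<bar>f x\<bar> \<le> B) \<Longrightarrow> \<bar>heat s f x\<bar> \<le> B"
  unfolding heat_def by (rule abs_expectation_le)

lemma heat_nonneg: "(\<And>x. 0 \<le> f x) \<Longrightarrow> 0 \<le> heat s f x"
  unfolding heat_def by (rule expectation_nonneg)

lemma heat_const [simp]: "heat s (\<lambda>_. c) x = c"
  by (simp add: heat_def)

lemma heat_add_fun:
  assumes "\<And>x. \<bar>f x\<bar> \<le> B" "\<And>x. \<bar>g x\<bar> \<le> B'"
  shows "heat s (\<lambda>x. f x + g x) x = heat s f x + heat s g x"
  unfolding heat_def
  by (intro Bochner_Integration.integral_add integrable_measure_pmf_bounded[where B = B]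
      integrable_measure_pmf_bounded[where B = B'] assms)

lemma heat_diff_fun:
  assumes "\<And>x. \<bar>f x\<bar> \<le> B" "\<And>x. \<bar>g x\<bar> \<le> B'"
  shows "heat s (\<lambda>x. f x - g x) x = heat s f x - heat s g x"
  unfolding heat_def
  by (intro Bochner_Integration.integral_diff integrable_measure_pmf_bounded[where B = B]
      integrable_measure_pmf_bounded[where B = B'] assms)

context lattice_walk
begin

lemma pmf_step: "0 \<le> s \<Longrightarrow> pmf (step s) z = kern s (z :: int ^ 'd)"
  unfolding step_def by (rule pmf_embed_pmf) (simp_all add: kern_nonneg kern_sum_1)

lemma step_0: "step 0 = return_pmf (0 :: int ^ 'd)"
  by (rule pmf_eqI) (auto simp: pmf_step kern_0 indicator_def)

lemma pmf_map_add: "pmf (map_pmf ((+) y) p) z = pmf p (z - y :: int ^ 'd)"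
  using pmf_map_inj'[of "(+) y" p "z - y"] by simp

lemma step_add:
  assumes "0 \<le> a" "0 \<le> b"
  shows "bind_pmf (step a) (\<lambda>y :: int ^ 'd. map_pmf ((+) y) (step b)) = step (a + b)"
proof (rule pmf_eqI)
  fix z :: "int ^ 'd"
  have "ennreal (pmf (bind_pmf (step a) (\<lambda>y. map_pmf ((+) y) (step b))) z) =
     (\<integral>\<^sup>+y. ennreal (pmf (step a) y) * ennreal (kern b (z - y)) \<partial>count_space UNIV)"
    using assms by (simp add: ennreal_pmf_bind pmf_map_add pmf_step nn_integral_measure_pmf)
  also have "\<dots> = (\<integral>\<^sup>+y. ennreal (kern a y * kern b (z - y)) \<partial>count_space UNIV)"
    using assms by (simp add: pmf_step ennreal_mult kern_nonneg)
  also have "\<dots> = ennreal (pmf (step (a + b)) z)"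
    using assms by (simp add: chapman_kolmogorov pmf_step)
  finally show "pmf (bind_pmf (step a) (\<lambda>y. map_pmf ((+) y) (step b))) z = pmf (step (a + b)) z"
    by simp
qed

lemma expectation_kern:
  assumes "0 \<le> a" "0 \<le> b"
  shows "measure_pmf.expectation (step a) (\<lambda>y :: int ^ 'd. kern b (z - y)) = kern (a + b) z"
proof -
  have "kern (a + b) z = pmf (bind_pmf (step a) (\<lambda>y :: int ^ 'd. map_pmf ((+) y) (step b))) z"
    using assms by (simp add: step_add pmf_step)
  also have "\<dots> = measure_pmf.expectation (step a) (\<lambda>y. kern b (z - y))"
    using assms by (simp add: pmf_bind pmf_map_add pmf_step)
  finally show ?thesis by simp
qed

lemma heat_0: "heat 0 f x = f (x :: int ^ 'd)"
  by (simp add: heat_def step_0)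

lemma heat_heat:
  assumes "0 \<le> a" "0 \<le> b" and "\<And>x. \<bar>f x\<bar> \<le> B"
  shows "heat a (heat b f) x = heat (a + b) f (x :: int ^ 'd)"
proof -
  have "heat (a + b) f x = measure_pmf.expectation (bind_pmf (step a) (\<lambda>y. map_pmf ((+) y) (step b))) (\<lambda>y. f (x + y))"
    using assms by (simp add: heat_def step_add)
  also have "\<dots> = heat a (heat b f) x"
    by (subst integral_bind_pmf_bounded[where B = B]) (simp_all add: assms heat_def add.assoc)
  finally show ?thesis by simp
qed

lemma heat_indicator:
  assumes "0 \<le> s"
  shows "heat s (\<lambda>x. if x = y then c else 0) x = c * kern s (x - y :: int ^ 'd)"
proof -
  have "heat s (\<lambda>x. if x = y then c else 0) x = measure_pmf.expectation (step s) (\<lambda>z. c * indicator {y - x} z)"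
    unfolding heat_def by (rule Bochner_Integration.integral_cong) (auto simp: indicator_def algebra_simps)
  also have "\<dots> = c * kern s (y - x)"
    using assms by (simp add: measure_pmf_single pmf_step)
  finally show ?thesis using kern_uminus[of s "y - x"] by simp
qed

text \<open>The second-order error of each kernel value cannot be summed over the infinite lattice.
  It is summed over 0 and its neighbours only, where the first-order part \<open>q\<close> has total
  mass 1; the mass elsewhere is then the deficit of \<open>kern s\<close> on this finite
  set.\<close>

lemma heat_laplacian_bound:
  fixes s :: real
  assumes "0 \<le> s" and f: "\<And>x. \<bar>f x\<bar> \<le> 1"
  shows "\<bar>heat s f x - f x - s * laplacian f (x :: int ^ 'd)\<bar> \<le> 32 * (CARD('d) + 1) * (CARD('d) * s)\<^sup>2"
proof -
  define N where "N = {z :: int ^ 'd. lattice_norm (0 - z) = 1}"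
  define A where "A = insert 0 N"
  define q where "q z = kern 0 z + s * laplacian (kern 0) z" for z :: "int ^ 'd"
  define C where "C = 8 * (CARD('d) * s)\<^sup>2"
  have finN: "finite N" unfolding N_def by (rule finite_neighbours)
  have N0: "0 \<notin> N" by (simp add: N_def lattice_norm_def)
  have finA: "finite A" using finN by (simp add: A_def)
  have cardN: "card N \<le> 2 * CARD('d)"
  proof -
    have "N \<subseteq> range (\<lambda>i. unitv i) \<union> range (\<lambda>i. - unitv i)"
    proof
      fix z assume "z \<in> N"
      then obtain i where "- z = unitv i \<or> - z = - unitv i"
        unfolding N_def lattice_norm_eq_1_iff by auto
      then have "z = - unitv i \<or> z = unitv i"
        by (metis minus_minus)
      then show "z \<in> range (\<lambda>i. unitv i) \<union> range (\<lambda>i. - unitv i)" by blast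
    qed
    then have "card N \<le> card (range (\<lambda>i :: 'd. unitv i) \<union> range (\<lambda>i :: 'd. - unitv i))"
      by (rule card_mono[rotated]) auto
    also have "\<dots> \<le> CARD('d) + CARD('d)"
      by (rule order.trans[OF card_Un_le]) (intro add_mono card_image_le, auto)
    finally show ?thesis by simp
  qed
  have lapN: "laplacian g x = (\<Sum>z\<in>N. g (x + z) - g x)" for g :: "int ^ 'd \<Rightarrow> real" and x
    unfolding laplacian_def N_def
    by (rule sum.reindex_bij_witness[where j = "\<lambda>y. y - x" and i = "\<lambda>z. x + z"]) auto
  have q0: "q 0 = 1 - s * card N"
    using N0 by (simp add: q_def lapN kern_0)
      (subst sum.cong[OF refl, where h = "\<lambda>_. - 1"], auto)
  have q1: "q z = s" if "z \<in> N" for z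
  proof -
    have "- z \<in> N" using that by (simp add: N_def lattice_norm_def)
    have nz: "z \<noteq> 0" using that N0 by auto
    have "laplacian (kern 0) z = (\<Sum>w\<in>N. if w = - z then 1 else 0)"
      unfolding lapN using nz by (intro sum.cong refl) (auto simp: kern_0 eq_neg_iff_add_eq_0 add.commute)
    also have "\<dots> = 1" using finN \<open>- z \<in> N\<close> by simp
    finally show ?thesis using nz by (simp add: q_def kern_0)
  qed
  have sumq: "(\<Sum>z\<in>A. q z * g z) = g 0 + s * (\<Sum>z\<in>N. g z - g 0)" for g :: "int ^ 'd \<Rightarrow> real"
    using finN N0 by (simp add: A_def q0 q1 sum_subtractf sum_distrib_left algebra_simps)
  have kq: "\<bar>kern s z - q z\<bar> \<le> C" for z :: "int ^ 'd"
    unfolding q_def C_def by (rule kern_taylor2[OF assms(1)])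
  have prA: "measure_pmf.prob (step s) A = (\<Sum>z\<in>A. kern s z)"
    using finA assms(1) by (simp add: measure_measure_pmf_finite pmf_step)
  have out: "1 - (\<Sum>z\<in>A. kern s z) \<le> card A * C"
  proof -
    have "1 - (\<Sum>z\<in>A. kern s z) = (\<Sum>z\<in>A. q z - kern s z)"
      using sumq[of "\<lambda>_. 1"] by (simp add: sum_subtractf)
    also have "\<dots> \<le> (\<Sum>z\<in>A. C)"
      by (rule sum_mono) (use kq in \<open>auto simp: abs_le_iff\<close>)
    finally show ?thesis by simp
  qed
  have heat_split: "heat s f x = (\<Sum>z\<in>A. kern s z * f (x + z)) +
      measure_pmf.expectation (step s) (\<lambda>z. indicator (- A) z * f (x + z))"
  proof -
    have "heat s f x = measure_pmf.expectation (step s) (\<lambda>z. indicator A z * f (x + z) + indicator (- A) z * f (x + z))"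
      unfolding heat_def by (rule Bochner_Integration.integral_cong) (auto simp: indicator_def)
    also have "\<dots> = measure_pmf.expectation (step s) (\<lambda>z. indicator A z * f (x + z)) +
       measure_pmf.expectation (step s) (\<lambda>z. indicator (- A) z * f (x + z))"
      by (intro Bochner_Integration.integral_add integrable_measure_pmf_bounded[where B = 1])
         (auto simp: indicator_def f)
    also have "measure_pmf.expectation (step s) (\<lambda>z. indicator A z * f (x + z)) = (\<Sum>z\<in>A. kern s z * f (x + z))"
      using finA assms(1) by (subst integral_measure_pmf[of A]) (auto simp: pmf_step indicator_def split: if_splits)
    finally show ?thesis .
  qed
  have "\<bar>measure_pmf.expectation (step s) (\<lambda>z. indicator (- A) z * f (x + z))\<bar>
     \<le> measure_pmf.expectation (step s) (\<lambda>z. indicator (- A) z)"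
    by (rule order.trans[OF integral_abs_bound], rule expectation_mono[where B = 1 and B' = 1])
       (auto simp: indicator_def f)
  also have "\<dots> = 1 - (\<Sum>z\<in>A. kern s z)"
    using measure_pmf.prob_compl[of A "step s"] prA by (simp add: Compl_eq_Diff_UNIV)
  finally have e1: "\<bar>measure_pmf.expectation (step s) (\<lambda>z. indicator (- A) z * f (x + z))\<bar> \<le> card A * C"
    using out by simp
  have "f x + s * laplacian f x = (\<Sum>z\<in>A. q z * f (x + z))"
    using sumq[of "\<lambda>z. f (x + z)"] by (simp add: lapN)
  then have "\<bar>(\<Sum>z\<in>A. kern s z * f (x + z)) - (f x + s * laplacian f x)\<bar> = \<bar>\<Sum>z\<in>A. (kern s z - q z) * f (x + z)\<bar>"
    by (simp add: sum_subtractf left_diff_distrib)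
  also have "\<dots> \<le> (\<Sum>z\<in>A. C)"
  proof (rule order.trans[OF sum_abs], rule sum_mono)
    fix z
    have "\<bar>kern s z - q z\<bar> * \<bar>f (x + z)\<bar> \<le> C * 1"
      using kq f by (intro mult_mono) (auto simp: C_def)
    then show "\<bar>(kern s z - q z) * f (x + z)\<bar> \<le> C" by (simp add: abs_mult)
  qed
  finally have e2: "\<bar>(\<Sum>z\<in>A. kern s z * f (x + z)) - (f x + s * laplacian f x)\<bar> \<le> card A * C" by simp
  have "\<bar>heat s f x - f x - s * laplacian f x\<bar> \<le> 2 * (card A * C)"
    using e1 e2 heat_split by linarith
  \<comment> \<open>The constant 32 is \<open>2 * 2 * 8\<close>: two errors, at most
    \<open>2 * (CARD('d) + 1)\<close> points, and the 8 of \<open>kern_taylor2\<close>.\<close>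
  also have "\<dots> \<le> 2 * ((2 * CARD('d) + 2) * C)"
  proof -
    have "real (card A) \<le> 2 * CARD('d) + 2"
      using cardN N0 finN by (simp add: A_def)
    then show ?thesis by (intro mult_left_mono mult_right_mono) (auto simp: C_def)
  qed
  finally show ?thesis by (simp add: C_def algebra_simps)
qed

end

section \<open>Survival on a time grid\<close>

text \<open>Paths on a grid are lists with the latest position first. For \<open>c = 0\<close>, \<open>surv \<tau> c ys x\<close> is the
  probability that a walk with steps of duration \<open>\<tau>\<close> started at \<open>x\<close> avoids the path \<open>ys\<close> traversed
  backwards; for \<open>c = 1 + \<gamma> h\<close> it is an Euler scheme for the soft trap.\<close>

fun surv :: "real \<Rightarrow> real \<Rightarrow> (int ^ 'd) list \<Rightarrow> int ^ 'd \<Rightarrow> real" where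
  "surv \<tau> c [] x = 1"
| "surv \<tau> c (y # ys) x = (if x = y then c else 1) * heat \<tau> (surv \<tau> c ys) x"

definition esc :: "real \<Rightarrow> (int ^ 'd) list \<Rightarrow> real" where
  "esc \<tau> ys = heat \<tau> (surv \<tau> 0 (tl ys)) (hd ys)"

primrec path_pmf :: "real \<Rightarrow> nat \<Rightarrow> (int ^ 'd) list pmf" where
  "path_pmf r 0 = return_pmf [0]"
| "path_pmf r (Suc n) = bind_pmf (path_pmf r n) (\<lambda>ys. map_pmf (\<lambda>s. (hd ys + s) # ys) (step r))"

lemma surv_bounds:
  assumes "0 \<le> c" "c \<le> 1"
  shows "0 \<le> surv \<tau> c ys x \<and> surv \<tau> c ys x \<le> 1"
proof (induction ys arbitrary: x)
  case (Cons y ys)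
  then have "0 \<le> heat \<tau> (surv \<tau> c ys) x"
    by (intro heat_nonneg) auto
  moreover have "\<bar>heat \<tau> (surv \<tau> c ys) x\<bar> \<le> 1"
    by (rule abs_heat_le) (use Cons in auto)
  ultimately show ?case
    using assms mult_le_one[of c "heat \<tau> (surv \<tau> c ys) x"] by auto
qed simp

lemma abs_surv_le: "0 \<le> c \<Longrightarrow> c \<le> 1 \<Longrightarrow> \<bar>surv \<tau> c ys x\<bar> \<le> 1"
  using surv_bounds[of c \<tau> ys x] by auto

text \<open>With \<open>c = 0\<close> this compares the soft trap with the hard one, so that only
  meeting probabilities have to be estimated.\<close>

lemma surv_mono:
  assumes "0 \<le> c" "c \<le> c'" "c' \<le> 1"
  shows "surv \<tau> c ys x \<le> surv \<tau> c' ys x"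
proof (induction ys arbitrary: x)
  case (Cons y ys)
  have "heat \<tau> (surv \<tau> c ys) x \<le> heat \<tau> (surv \<tau> c' ys) x"
    using assms by (intro heat_mono[where B = 1 and B' = 1] Cons abs_surv_le) auto
  moreover have "0 \<le> heat \<tau> (surv \<tau> c ys) x"
    using assms surv_bounds[of c \<tau> ys] by (intro heat_nonneg) auto
  ultimately show ?case
    using assms by (auto intro!: mult_mono)
qed simp

lemma esc_bounds: "0 \<le> esc \<tau> ys" "esc \<tau> ys \<le> 1"
proof -
  show "0 \<le> esc \<tau> ys"
    unfolding esc_def using surv_bounds[of 0 \<tau>] by (intro heat_nonneg) auto
  show "esc \<tau> ys \<le> 1"
    unfolding esc_def using abs_heat_le[of "surv \<tau> 0 (tl ys)" 1 \<tau> "hd ys", OF abs_surv_le[of 0]] by auto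
qed

lemma abs_esc_le: "\<bar>esc \<tau> ys\<bar> \<le> 1"
  using esc_bounds[of \<tau> ys] by auto

lemma length_path_pmf: "ys \<in> set_pmf (path_pmf r n) \<Longrightarrow> length ys = Suc n"
  by (induction n arbitrary: ys) auto

lemma expectation_swap:
  fixes f :: "'b \<Rightarrow> 'c \<Rightarrow> real"
  assumes "\<And>x y. \<bar>f x y\<bar> \<le> B"
  shows "measure_pmf.expectation p (\<lambda>x. measure_pmf.expectation q (\<lambda>y. f x y)) =
    measure_pmf.expectation q (\<lambda>y. measure_pmf.expectation p (\<lambda>x. f x y))"
proof -
  have "measure_pmf.expectation p (\<lambda>x. measure_pmf.expectation q (\<lambda>y. f x y)) =
     measure_pmf.expectation (bind_pmf p (\<lambda>x. bind_pmf q (\<lambda>y. return_pmf (x, y)))) (case_prod f)"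
    using assms by (simp add: integral_bind_pmf_bounded[where B = B] case_prod_beta)
  also have "bind_pmf p (\<lambda>x. bind_pmf q (\<lambda>y. return_pmf (x, y))) = bind_pmf q (\<lambda>y. bind_pmf p (\<lambda>x. return_pmf (x, y)))"
    by (rule bind_commute_pmf)
  also have "measure_pmf.expectation \<dots> (case_prod f) = measure_pmf.expectation q (\<lambda>y. measure_pmf.expectation p (\<lambda>x. f x y))"
    using assms by (simp add: integral_bind_pmf_bounded[where B = B] case_prod_beta)
  finally show ?thesis .
qed

lemma expectation_pair_pmf_mult:
  fixes f :: "'b \<Rightarrow> real" and g :: "'c \<Rightarrow> real"
  assumes "\<And>x. \<bar>f x\<bar> \<le> 1" "\<And>x. \<bar>g x\<bar> \<le> 1"
  shows "measure_pmf.expectation (pair_pmf p q) (\<lambda>z. f (fst z) * g (snd z)) =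
    measure_pmf.expectation p f * measure_pmf.expectation q g"
proof -
  have "\<bar>f x * g y\<bar> \<le> 1" for x y
    using assms by (simp add: abs_mult mult_le_one)
  then show ?thesis
    unfolding pair_pmf_def by (simp add: integral_bind_pmf_bounded[where B = 1])
qed

section \<open>The decomposition at the last meeting\<close>

context lattice_walk
begin

lemma abs_kern_le_1: "0 \<le> s \<Longrightarrow> \<bar>kern s (x :: int ^ 'd)\<bar> \<le> 1"
  using abs_kern_le[of s x] kern_0_le_1[of s, where 'd = 'd] by linarith

lemma kern_le_kern_0: "kern s (x :: int ^ 'd) \<le> kern s (0 :: int ^ 'd)"
  using abs_kern_le[of s x] by linarith

text \<open>Last-meeting decomposition: \<open>esc\<close> is the probability that, started at the head of the path, the
  walk avoids the rest of the path.\<close>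

lemma heat_surv_duhamel:
  assumes \<tau>: "0 \<le> \<tau>"
  shows "heat (real j * \<tau>) (\<lambda>x. 1 - surv \<tau> 0 ys x) (x :: int ^ 'd) =
    (\<Sum>i<length ys. kern (real (j + i) * \<tau>) (x - ys ! i) * esc \<tau> (drop i ys))"
proof (induction ys arbitrary: j x)
  case (Cons y ys)
  let ?W = "\<lambda>x. 1 - surv \<tau> 0 ys x"
  have W: "\<bar>?W x\<bar> \<le> 1" for x
    using surv_bounds[of 0 \<tau> ys x] by auto
  \<comment> \<open>At \<open>y\<close> the left side is 1 and \<open>esc\<close> is the complement
    of \<open>heat \<tau> ?W\<close>; elsewhere the walk just makes a step.\<close>
  have "1 - surv \<tau> 0 (y # ys) x = heat \<tau> ?W x + (if x = y then esc \<tau> (y # ys) else 0)" for x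
    using heat_diff_fun[of "\<lambda>_. 1" 1 "surv \<tau> 0 ys" 1 \<tau> x, OF _ abs_surv_le[of 0]]
    by (simp add: esc_def)
  then have "heat (real j * \<tau>) (\<lambda>x. 1 - surv \<tau> 0 (y # ys) x) x =
      heat (real j * \<tau>) (\<lambda>x. heat \<tau> ?W x + (if x = y then esc \<tau> (y # ys) else 0)) x" by simp
  also have "\<dots> = heat (real j * \<tau>) (heat \<tau> ?W) x + heat (real j * \<tau>) (\<lambda>x. if x = y then esc \<tau> (y # ys) else 0) x"
    using esc_bounds[of \<tau> "y # ys"]
    by (intro heat_add_fun[where B = 1 and B' = 1] abs_heat_le W) auto
  also have "heat (real j * \<tau>) (heat \<tau> ?W) x = heat (real (Suc j) * \<tau>) ?W x"
    using \<tau> by (subst heat_heat[where B = 1]) (auto simp: W algebra_simps)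
  also have "heat (real j * \<tau>) (\<lambda>x. if x = y then esc \<tau> (y # ys) else 0) x = esc \<tau> (y # ys) * kern (real j * \<tau>) (x - y)"
    using \<tau> by (intro heat_indicator) simp
  also note Cons
  finally show ?case
    by (simp add: sum.lessThan_Suc_shift algebra_simps del: sum.lessThan_Suc)
qed simp

lemma one_minus_surv_eq:
  assumes "0 \<le> \<tau>"
  shows "1 - surv \<tau> 0 ys (x :: int ^ 'd) =
    (\<Sum>i<length ys. kern (real i * \<tau>) (x - ys ! i) * esc \<tau> (drop i ys))"
  using heat_surv_duhamel[OF assms, of 0 ys x] by (simp add: heat_0)

text \<open>Independence of the past of \<open>Y\<close> and its later displacement; as lists start
  with the latest position, dropping \<open>j\<close> entries leaves the past.\<close>

lemma path_pmf_decomp: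
  assumes r: "0 \<le> r"
  shows "map_pmf (\<lambda>ys. (drop j ys, hd ys - hd (drop j ys))) (path_pmf r (k + j)) =
    pair_pmf (path_pmf r k :: (int ^ 'd) list pmf) (step (real j * r))"
proof (induction j)
  case 0
  then show ?case by (simp add: step_0 pair_return_pmf2)
next
  case (Suc j)
  let ?f = "\<lambda>ys :: (int ^ 'd) list. (drop j ys, hd ys - hd (drop j ys))"
  have "map_pmf (\<lambda>ys. (drop (Suc j) ys, hd ys - hd (drop (Suc j) ys))) (path_pmf r (k + Suc j)) =
     bind_pmf (path_pmf r (k + j)) (\<lambda>ys. map_pmf (\<lambda>s. (drop j ys, hd ys + s - hd (drop j ys))) (step r))"
    by (simp add: map_bind_pmf map_pmf_comp)
  also have "\<dots> = bind_pmf (map_pmf ?f (path_pmf r (k + j))) (\<lambda>p. map_pmf (\<lambda>s. (fst p, snd p + s)) (step r))"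
    by (simp add: bind_map_pmf algebra_simps)
  also have "\<dots> = bind_pmf (path_pmf r k) (\<lambda>zs. bind_pmf (bind_pmf (step (real j * r)) (\<lambda>d. map_pmf ((+) d) (step r))) (\<lambda>y. return_pmf (zs, y)))"
    unfolding Suc by (simp add: bind_assoc_pmf bind_return_pmf map_pmf_def pair_pmf_def)
  also have "\<dots> = pair_pmf (path_pmf r k) (step (real (Suc j) * r))"
    using r by (simp add: step_add pair_pmf_def algebra_simps)
  finally show ?case .
qed

lemma map_drop_path_pmf:
  assumes "0 \<le> r"
  shows "map_pmf (drop j) (path_pmf r (k + j)) = (path_pmf r k :: (int ^ 'd) list pmf)"
proof -
  have "map_pmf (drop j) (path_pmf r (k + j)) =
     map_pmf fst (map_pmf (\<lambda>ys. (drop j ys, hd ys - hd (drop j ys))) (path_pmf r (k + j)) )"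
    by (simp add: map_pmf_comp)
  also have "\<dots> = (path_pmf r k :: (int ^ 'd) list pmf)"
    unfolding path_pmf_decomp[OF assms] by (rule map_fst_pair_pmf)
  finally show ?thesis .
qed

lemma map_hd_path_pmf:
  assumes "0 \<le> r"
  shows "map_pmf hd (path_pmf r k) = (step (real k * r) :: (int ^ 'd) pmf)"
proof -
  have "map_pmf hd (path_pmf r k) =
    map_pmf (\<lambda>z. hd (fst z) + snd z) (map_pmf (\<lambda>ys. (drop k ys, hd ys - hd (drop k ys))) (path_pmf r (0 + k) :: (int ^ 'd) list pmf))"
    by (simp add: map_pmf_comp)
  also have "\<dots> = step (real k * r)"
    unfolding path_pmf_decomp[OF assms] by (simp add: pair_return_pmf1 map_pmf_comp)
  finally show ?thesis .
qed

text \<open>The \<open>q k\<close> of the overview: \<open>X\<close> steps forwards while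
  \<open>Y\<close> is read backwards, so that their difference has steps of duration
  \<open>\<tau> + r\<close>.\<close>

definition mean_esc :: "real \<Rightarrow> real \<Rightarrow> nat \<Rightarrow> real" where
  "mean_esc \<tau> r k = measure_pmf.expectation (path_pmf r k :: (int ^ 'd) list pmf) (esc \<tau>)"

text \<open>For \<open>a = i * \<tau>\<close> and \<open>k = n - i\<close>, the probability that
  \<open>X\<close>, started at \<open>x\<close>, has its last meeting with \<open>Y\<close> at its
  step \<open>i\<close>.\<close>

definition flux :: "real \<Rightarrow> real \<Rightarrow> real \<Rightarrow> int ^ 'd \<Rightarrow> nat \<Rightarrow> real" where
  "flux \<tau> r a x k = measure_pmf.expectation (path_pmf r k) (\<lambda>ys. kern a (x - hd ys) * esc \<tau> ys)"

lemma mean_esc_bounds: "0 \<le> mean_esc \<tau> r k" "mean_esc \<tau> r k \<le> 1"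
  unfolding mean_esc_def
  using expectation_nonneg[of "esc \<tau>", OF esc_bounds(1)] abs_expectation_le[of "esc \<tau>" 1, OF abs_esc_le]
  by (auto intro: order.trans[OF abs_ge_self])

lemma abs_kern_esc_le: "0 \<le> a \<Longrightarrow> \<bar>kern a (x :: int ^ 'd) * esc \<tau> ys\<bar> \<le> 1"
  using abs_kern_le_1[of a x] esc_bounds[of \<tau> ys] by (simp add: abs_mult mult_le_one)

lemma flux_le_mean_esc:
  assumes "0 \<le> a"
  shows "flux \<tau> r a x k \<le> kern a (0 :: int ^ 'd) * mean_esc \<tau> r k"
proof -
  have "flux \<tau> r a x k \<le> measure_pmf.expectation (path_pmf r k) (\<lambda>ys :: (int ^ 'd) list. kern a (0 :: int ^ 'd) * esc \<tau> ys)"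
    unfolding flux_def
    by (rule expectation_mono[where B = 1 and B' = 1])
       (auto intro!: mult_right_mono kern_le_kern_0 esc_bounds abs_kern_esc_le assms)
  then show ?thesis by (simp add: mean_esc_def)
qed

text \<open>Of all the meetings to be avoided only the next one is kept: after its first step the
  walk must not be at \<open>hd ys\<close>.\<close>

lemma esc_Cons_le:
  assumes "0 \<le> \<tau>" "ys \<noteq> []"
  shows "esc \<tau> ((hd ys + s) # ys) \<le> 1 - kern \<tau> (s :: int ^ 'd)"
proof -
  have le: "surv \<tau> 0 ys z \<le> 1 - (if z = hd ys then 1 else 0)" for z
    using assms(2) surv_bounds[of 0 \<tau> ys z] by (cases ys) auto
  have "heat \<tau> (surv \<tau> 0 ys) (hd ys + s) \<le> heat \<tau> (\<lambda>z. 1 - (if z = hd ys then 1 else 0)) (hd ys + s)"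
    by (rule heat_mono[where B = 1 and B' = 1]) (use le abs_surv_le[of 0] in auto)
  also have "\<dots> = 1 - kern \<tau> s"
    using assms(1) by (subst heat_diff_fun[where B = 1 and B' = 1]) (auto simp: heat_indicator)
  finally show ?thesis by (simp add: esc_def)
qed

text \<open>Once weakened by \<open>esc_Cons_le\<close>, the factor \<open>esc\<close> involves only
  the latest increment \<open>s\<close> of \<open>Y\<close>. The earlier path is averaged against
  the kernel of \<open>X\<close>, which adds the durations \<open>k * r\<close> and
  \<open>a\<close>; the average over \<open>s\<close> is then the probability that the difference
  walk is not at 0 after one step.\<close>

lemma flux_Suc_le:
  assumes a: "0 \<le> a" and \<tau>: "0 \<le> \<tau>" and r: "0 \<le> r"
  shows "flux \<tau> r a x (Suc k) \<le>
    kern (real k * r + a) (0 :: int ^ 'd) * (1 - kern (r + \<tau>) (0 :: int ^ 'd))"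
proof -
  let ?g = "\<lambda>ys s. kern a (x - (hd ys + s)) * (1 - kern \<tau> s)"
  have k01: "0 \<le> 1 - kern \<tau> s" "1 - kern \<tau> s \<le> 1" for s :: "int ^ 'd"
    using abs_kern_le_1[OF \<tau>, of s] kern_nonneg[OF \<tau>, of s] by auto
  have g1: "\<bar>?g ys s\<bar> \<le> 1" for ys s
    using abs_kern_le_1[OF a] k01[of s] by (simp add: abs_mult mult_le_one)
  have "flux \<tau> r a x (Suc k) = measure_pmf.expectation (path_pmf r k) (\<lambda>ys.
      measure_pmf.expectation (step r) (\<lambda>s. kern a (x - (hd ys + s)) * esc \<tau> ((hd ys + s) # ys)))"
    unfolding flux_def path_pmf.simps
    by (subst integral_bind_pmf_bounded[where B = 1]) (simp_all add: abs_kern_esc_le a)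
  also have "\<dots> \<le> measure_pmf.expectation (path_pmf r k) (\<lambda>ys. measure_pmf.expectation (step r) (?g ys))"
  proof (rule expectation_mono[where B = 1 and B' = 1])
    fix ys :: "(int ^ 'd) list" assume "ys \<in> set_pmf (path_pmf r k)"
    then have "ys \<noteq> []" using length_path_pmf by fastforce
    then show "measure_pmf.expectation (step r) (\<lambda>s. kern a (x - (hd ys + s)) * esc \<tau> ((hd ys + s) # ys))
       \<le> measure_pmf.expectation (step r) (?g ys)"
      by (intro expectation_mono[where B = 1 and B' = 1] mult_left_mono esc_Cons_le abs_kern_esc_le kern_nonneg g1 a \<tau>)
  qed (intro abs_expectation_le abs_kern_esc_le g1 a)+
  also have "\<dots> = measure_pmf.expectation (step r) (\<lambda>s. measure_pmf.expectation (path_pmf r k) (\<lambda>ys. ?g ys s))"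
    by (rule expectation_swap[where B = 1]) (rule g1)
  also have "\<dots> = measure_pmf.expectation (step r) (\<lambda>s. kern (real k * r + a) (x - s) * (1 - kern \<tau> s))"
  proof (rule Bochner_Integration.integral_cong[OF refl])
    fix s
    have "measure_pmf.expectation (path_pmf r k) (\<lambda>ys. kern a (x - (hd ys + s))) =
       measure_pmf.expectation (map_pmf hd (path_pmf r k)) (\<lambda>y. kern a ((x - s) - y))"
      by (simp add: algebra_simps)
    also have "\<dots> = kern (real k * r + a) (x - s)"
      using a r by (simp add: map_hd_path_pmf expectation_kern)
    finally show "measure_pmf.expectation (path_pmf r k) (\<lambda>ys. ?g ys s) = kern (real k * r + a) (x - s) * (1 - kern \<tau> s)"
      by simp
  qed
  also have "\<dots> \<le> measure_pmf.expectation (step r) (\<lambda>s :: int ^ 'd. kern (real k * r + a) (0 :: int ^ 'd) * (1 - kern \<tau> s))"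
  proof -
    have "0 \<le> real k * r + a" using a r by simp
    then have "\<bar>kern (real k * r + a) y * (1 - kern \<tau> s)\<bar> \<le> 1" for y s :: "int ^ 'd"
      using abs_kern_le_1[of "real k * r + a" y] k01[of s] by (simp add: abs_mult mult_le_one)
    then show ?thesis
      by (intro expectation_mono[where B = 1 and B' = 1] mult_right_mono kern_le_kern_0 k01)
  qed
  also have "\<dots> = kern (real k * r + a) (0 :: int ^ 'd) * (1 - kern (r + \<tau>) (0 :: int ^ 'd))"
  proof -
    have "measure_pmf.expectation (step r) (\<lambda>s :: int ^ 'd. kern \<tau> s) = kern (r + \<tau>) (0 :: int ^ 'd)"
      using expectation_kern[OF r \<tau>, of 0] by simp
    moreover have "integrable (step r) (\<lambda>s :: int ^ 'd. kern \<tau> s)"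
      by (rule integrable_measure_pmf_bounded[where B = 1]) (rule abs_kern_le_1[OF \<tau>])
    ultimately show ?thesis by (simp add: Bochner_Integration.integral_diff)
  qed
  finally show ?thesis .
qed

lemma expectation_kern_esc:
  fixes x :: "int ^ 'd"
  assumes "0 \<le> a" "0 \<le> r"
  shows "measure_pmf.expectation (path_pmf r (k + i)) (\<lambda>ys. kern a (x - ys ! i) * esc \<tau> (drop i ys)) = flux \<tau> r a x k"
proof -
  have "measure_pmf.expectation (path_pmf r (k + i)) (\<lambda>ys. kern a (x - ys ! i) * esc \<tau> (drop i ys)) =
     measure_pmf.expectation (path_pmf r (k + i)) (\<lambda>ys. kern a (x - hd (drop i ys)) * esc \<tau> (drop i ys))"
    by (rule integral_cong_AE) (auto simp: AE_measure_pmf_iff dest!: length_path_pmf simp: hd_drop_conv_nth)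
  also have "\<dots> = measure_pmf.expectation (map_pmf (drop i) (path_pmf r (k + i))) (\<lambda>zs. kern a (x - hd zs) * esc \<tau> zs)"
    by simp
  finally show ?thesis
    unfolding map_drop_path_pmf[OF assms(2)] flux_def .
qed

lemma expectation_one_minus_surv:
  fixes x :: "int ^ 'd"
  assumes "0 \<le> \<tau>" "0 \<le> r"
  shows "measure_pmf.expectation (path_pmf r n) (\<lambda>ys. 1 - surv \<tau> 0 ys x) =
    (\<Sum>i\<le>n. flux \<tau> r (real i * \<tau>) x (n - i))"
proof -
  have "measure_pmf.expectation (path_pmf r n) (\<lambda>ys. 1 - surv \<tau> 0 ys x) =
     measure_pmf.expectation (path_pmf r n) (\<lambda>ys. \<Sum>i\<le>n. kern (real i * \<tau>) (x - ys ! i) * esc \<tau> (drop i ys))"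
    using assms by (intro integral_cong_AE)
      (auto simp: AE_measure_pmf_iff one_minus_surv_eq lessThan_Suc_atMost dest!: length_path_pmf)
  also have "\<dots> = (\<Sum>i\<le>n. measure_pmf.expectation (path_pmf r n) (\<lambda>ys. kern (real i * \<tau>) (x - ys ! i) * esc \<tau> (drop i ys)))"
    using assms by (intro Bochner_Integration.integral_sum integrable_measure_pmf_bounded[where B = 1] abs_kern_esc_le) auto
  also have "\<dots> = (\<Sum>i\<le>n. flux \<tau> r (real i * \<tau>) x (n - i))"
  proof (rule sum.cong[OF refl])
    fix i assume "i \<in> {..n}"
    then show "measure_pmf.expectation (path_pmf r n) (\<lambda>ys. kern (real i * \<tau>) (x - ys ! i) * esc \<tau> (drop i ys)) =
        flux \<tau> r (real i * \<tau>) x (n - i)"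
      using expectation_kern_esc[of "real i * \<tau>" r "n - i" i x \<tau>] assms by simp
  qed
  finally show ?thesis .
qed

text \<open>A walk started on the latest position of \<open>Y\<close> meets it at once, so the
  last-meeting probabilities sum to 1. By the independence in \<open>path_pmf_decomp\<close> each of
  them factors into a return probability of the difference walk and a
  \<open>mean_esc\<close>.\<close>

lemma renewal:
  assumes \<tau>: "0 \<le> \<tau>" and r: "0 \<le> r"
  shows "(\<Sum>i\<le>n. kern (real i * (\<tau> + r)) (0 :: int ^ 'd) * mean_esc \<tau> r (n - i)) = 1"
proof -
  let ?p = "path_pmf r n :: (int ^ 'd) list pmf"
  let ?h = "\<lambda>i ys. kern (real i * \<tau>) (hd ys - hd (drop i ys)) * esc \<tau> (drop i ys)"
  have "1 = measure_pmf.expectation ?p (\<lambda>ys. 1 - surv \<tau> 0 ys (hd ys))"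
  proof -
    have "measure_pmf.expectation ?p (\<lambda>ys. 1 - surv \<tau> 0 ys (hd ys)) = measure_pmf.expectation ?p (\<lambda>ys. 1)"
    proof (intro integral_cong_AE)
      have "surv \<tau> 0 ys (hd ys) = 0" if "length ys = Suc n" for ys :: "(int ^ 'd) list"
        using that by (cases ys) auto
      then show "AE ys in ?p. 1 - surv \<tau> 0 ys (hd ys) = 1"
        by (auto simp: AE_measure_pmf_iff dest!: length_path_pmf)
    qed auto
    then show ?thesis by simp
  qed
  also have "\<dots> = measure_pmf.expectation ?p (\<lambda>ys. \<Sum>i\<le>n. ?h i ys)"
    using assms by (intro integral_cong_AE)
      (auto simp: AE_measure_pmf_iff one_minus_surv_eq lessThan_Suc_atMost hd_drop_conv_nth intro!: sum.cong
       dest!: length_path_pmf)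
  also have "\<dots> = (\<Sum>i\<le>n. measure_pmf.expectation ?p (?h i))"
    using assms by (intro Bochner_Integration.integral_sum integrable_measure_pmf_bounded[where B = 1] abs_kern_esc_le) auto
  also have "\<dots> = (\<Sum>i\<le>n. kern (real i * (\<tau> + r)) (0 :: int ^ 'd) * mean_esc \<tau> r (n - i))"
  proof (rule sum.cong[OF refl])
    fix i assume "i \<in> {..n}"
    then have n: "n = (n - i) + i" by simp
    have i\<tau>: "0 \<le> real i * \<tau>" using \<tau> by simp
    have "measure_pmf.expectation ?p (?h i) =
       measure_pmf.expectation (map_pmf (\<lambda>ys. (drop i ys, hd ys - hd (drop i ys))) (path_pmf r ((n - i) + i)))
         (\<lambda>z. esc \<tau> (fst z) * kern (real i * \<tau>) (snd z :: int ^ 'd))"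
      by (subst n) (simp add: mult.commute)
    also have "\<dots> = mean_esc \<tau> r (n - i) * measure_pmf.expectation (step (real i * r)) (\<lambda>d :: int ^ 'd. kern (real i * \<tau>) d)"
      unfolding path_pmf_decomp[OF r] mean_esc_def
      by (rule expectation_pair_pmf_mult) (use abs_esc_le abs_kern_le_1[OF i\<tau>] in auto)
    also have "measure_pmf.expectation (step (real i * r)) (\<lambda>d :: int ^ 'd. kern (real i * \<tau>) d) = kern (real i * (\<tau> + r)) (0 :: int ^ 'd)"
      using expectation_kern[of "real i * r" "real i * \<tau>" 0] r \<tau> by (simp add: algebra_simps)
    finally show "measure_pmf.expectation ?p (?h i) = kern (real i * (\<tau> + r)) (0 :: int ^ 'd) * mean_esc \<tau> r (n - i)"
      by simp
  qed
  finally show ?thesis by simp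
qed

text \<open>The renewal identities for \<open>0, ..., n\<close> are added up: the rectangle of index
  pairs lies in the triangle \<open>i + k <= n\<close>, and all terms are nonnegative.\<close>

lemma sum_mean_esc_le:
  assumes \<tau>: "0 \<le> \<tau>" and r: "0 \<le> r" and "j \<le> n"
  shows "(\<Sum>i\<le>j. kern (real i * (\<tau> + r)) (0 :: int ^ 'd)) * (\<Sum>k\<le>n - j. mean_esc \<tau> r k) \<le> real (Suc n)"
proof -
  let ?f = "\<lambda>i k. kern (real i * (\<tau> + r)) (0 :: int ^ 'd) * mean_esc \<tau> r k"
  have nn: "0 \<le> ?f i k" for i k
    using mean_esc_bounds(1)[of \<tau> r k] by (simp add: kern_0_nonneg)
  have "(\<Sum>i\<le>j. kern (real i * (\<tau> + r)) (0 :: int ^ 'd)) * (\<Sum>k\<le>n - j. mean_esc \<tau> r k) =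
     (\<Sum>(i, k)\<in>{..j} \<times> {..n - j}. ?f i k)"
    by (simp add: sum_product sum.cartesian_product)
  also have "\<dots> \<le> (\<Sum>(i, k)\<in>{(i, k). i + k \<le> n}. ?f i k)"
  proof (rule sum_mono2)
    have "{(i, k). i + k \<le> n} \<subseteq> {..n} \<times> {..n}" by auto
    then show "finite {(i, k). i + k \<le> n}" by (rule finite_subset) auto
  qed (use assms(3) nn in auto)
  also have "\<dots> = (\<Sum>m\<le>n. \<Sum>i\<le>m. ?f i (m - i))"
    by (rule sum.triangle_reindex_eq)
  also have "\<dots> = real (Suc n)"
    using renewal[OF \<tau> r] by simp
  finally show ?thesis .
qed

text \<open>Meetings before step \<open>j\<close> of \<open>X\<close> are treated by
  \<open>flux_Suc_le\<close>, the others by \<open>flux_le_mean_esc\<close>.\<close>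

lemma expectation_one_minus_surv_le:
  fixes x :: "int ^ 'd"
  assumes \<tau>: "0 \<le> \<tau>" and r: "0 \<le> r" and "j \<le> n"
  shows "measure_pmf.expectation (path_pmf r n) (\<lambda>ys. 1 - surv \<tau> 0 ys x) \<le>
    real j * (kern (real (n - 1) * min \<tau> r) (0 :: int ^ 'd) * (1 - kern (r + \<tau>) (0 :: int ^ 'd))) +
    kern (real j * \<tau>) (0 :: int ^ 'd) * (\<Sum>k\<le>n - j. mean_esc \<tau> r k)"
proof -
  let ?t = "\<lambda>i. flux \<tau> r (real i * \<tau>) x (n - i)"
  have "(\<Sum>i\<le>n. ?t i) = (\<Sum>i<j. ?t i) + (\<Sum>i=j..n. ?t i)"
    using assms(3) by (subst sum.union_disjoint[symmetric]) (auto intro!: sum.cong)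
  also have "(\<Sum>i<j. ?t i) \<le> (\<Sum>i<j. kern (real (n - 1) * min \<tau> r) (0 :: int ^ 'd) * (1 - kern (r + \<tau>) (0 :: int ^ 'd)))"
  proof (rule sum_mono)
    fix i assume "i \<in> {..<j}"
    \<comment> \<open>As \<open>i < j <= n\<close>, \<open>Y\<close> has at least one step, which
      \<open>flux_Suc_le\<close> consumes. The other \<open>n - 1\<close> steps of the two walks
      each last at least \<open>min \<tau> r\<close>.\<close>
    then have i: "n - i = Suc (n - 1 - i)" "i \<le> n - 1" using assms(3) by auto
    have "?t i \<le> kern (real (n - 1 - i) * r + real i * \<tau>) (0 :: int ^ 'd) * (1 - kern (r + \<tau>) (0 :: int ^ 'd))"
      unfolding i(1) by (rule flux_Suc_le) (use \<tau> r in auto)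
    also have "\<dots> \<le> kern (real (n - 1) * min \<tau> r) (0 :: int ^ 'd) * (1 - kern (r + \<tau>) (0 :: int ^ 'd))"
    proof (intro mult_right_mono kern_antimono)
      have "real (n - 1) = real (n - 1 - i) + real i"
        using i(2) by (simp add: of_nat_diff)
      then have "real (n - 1) * min \<tau> r = real (n - 1 - i) * min \<tau> r + real i * min \<tau> r"
        by (simp only: distrib_right)
      also have "\<dots> \<le> real (n - 1 - i) * r + real i * \<tau>"
        by (intro add_mono mult_left_mono) auto
      finally show "real (n - 1) * min \<tau> r \<le> real (n - 1 - i) * r + real i * \<tau>" .
    qed (use kern_0_le_1[of "r + \<tau>", where 'd = 'd] \<tau> r in auto)
    finally show "?t i \<le> kern (real (n - 1) * min \<tau> r) (0 :: int ^ 'd) * (1 - kern (r + \<tau>) (0 :: int ^ 'd))" .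
  qed
  also have "(\<Sum>i=j..n. ?t i) \<le> (\<Sum>i=j..n. kern (real j * \<tau>) (0 :: int ^ 'd) * mean_esc \<tau> r (n - i))"
  proof (rule sum_mono)
    fix i assume i: "i \<in> {j..n}"
    have "?t i \<le> kern (real i * \<tau>) (0 :: int ^ 'd) * mean_esc \<tau> r (n - i)"
      by (rule flux_le_mean_esc) (use \<tau> in auto)
    also have "\<dots> \<le> kern (real j * \<tau>) (0 :: int ^ 'd) * mean_esc \<tau> r (n - i)"
      using i \<tau> by (intro mult_right_mono kern_antimono mean_esc_bounds) auto
    finally show "?t i \<le> kern (real j * \<tau>) (0 :: int ^ 'd) * mean_esc \<tau> r (n - i)" .
  qed
  also have "(\<Sum>i=j..n. kern (real j * \<tau>) (0 :: int ^ 'd) * mean_esc \<tau> r (n - i)) =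
      kern (real j * \<tau>) (0 :: int ^ 'd) * (\<Sum>k\<le>n - j. mean_esc \<tau> r k)"
    unfolding sum_distrib_left using assms(3)
    by (intro sum.reindex_bij_witness[where i = "\<lambda>k. n - k" and j = "\<lambda>i. n - i"]) auto
  finally show ?thesis
    using \<tau> r by (simp add: expectation_one_minus_surv)
qed

end

section \<open>The collision probability for large times\<close>

text \<open>The type argument carries the dimension, which occurs neither in the other argument nor
  in the result.\<close>

definition green :: "'d::finite itself \<Rightarrow> real \<Rightarrow> real" where
  "green _ T = integral {0..T} (\<lambda>s. kern s (0 :: int ^ 'd))"

lemma kern_integrable: "(\<lambda>s. kern s (x :: int ^ 'd)) integrable_on {a..b}"
  by (intro integrable_continuous_interval continuous_at_imp_continuous_on ballI DERIV_isCont)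
     (rule has_derivative_kern)

lemma green_combine:
  assumes "0 \<le> a" "a \<le> b"
  shows "green TYPE('d::finite) b = green TYPE('d) a + integral {a..b} (\<lambda>s. kern s (0 :: int ^ 'd))"
  unfolding green_def using assms
  by (intro Henstock_Kurzweil_Integration.integral_combine[symmetric] kern_integrable)

lemma integral_kern_bounds:
  assumes "a \<le> b"
  shows "(b - a) * kern b (0 :: int ^ 'd) \<le> integral {a..b} (\<lambda>s. kern s (0 :: int ^ 'd))"
    and "integral {a..b} (\<lambda>s. kern s (0 :: int ^ 'd)) \<le> (b - a) * kern a (0 :: int ^ 'd)"
proof -
  have "integral {a..b} (\<lambda>s. kern b (0 :: int ^ 'd)) \<le> integral {a..b} (\<lambda>s. kern s (0 :: int ^ 'd))"
    by (intro integral_le kern_integrable) (auto intro: kern_antimono)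
  then show "(b - a) * kern b (0 :: int ^ 'd) \<le> integral {a..b} (\<lambda>s. kern s (0 :: int ^ 'd))"
    using assms by simp
  have "integral {a..b} (\<lambda>s. kern s (0 :: int ^ 'd)) \<le> integral {a..b} (\<lambda>s. kern a (0 :: int ^ 'd))"
    by (intro integral_le kern_integrable) (auto intro: kern_antimono)
  then show "integral {a..b} (\<lambda>s. kern s (0 :: int ^ 'd)) \<le> (b - a) * kern a (0 :: int ^ 'd)"
    using assms by simp
qed

lemma green_mono:
  assumes "0 \<le> a" "a \<le> b"
  shows "green TYPE('d::finite) a \<le> green TYPE('d) b"
proof -
  have "0 \<le> (b - a) * kern b (0 :: int ^ 'd)"
    using assms(2) by (intro mult_nonneg_nonneg kern_0_nonneg) simp
  then show ?thesis
    using green_combine[OF assms, where 'd = 'd] integral_kern_bounds(1)[OF assms(2), where 'd = 'd]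
    by simp
qed

text \<open>Left-endpoint sums overestimate the integral of a decreasing function; this brings the
  Green function into the renewal bound.\<close>

lemma green_le_riemann_sum:
  assumes "0 \<le> \<delta>"
  shows "green TYPE('d::finite) (real m * \<delta>) \<le> \<delta> * (\<Sum>i<m. kern (real i * \<delta>) (0 :: int ^ 'd))"
proof (induction m)
  case (Suc m)
  have "real m * \<delta> \<le> real (Suc m) * \<delta>" using assms by (intro mult_right_mono) auto
  with Suc green_combine[OF _ this, where 'd = 'd] integral_kern_bounds(2)[OF this, where 'd = 'd] assms
  show ?case by (simp add: algebra_simps)
qed (simp add: green_def)

text \<open>By monotonicity \<open>s * kern s 0\<close> is at most twice the integral over
  \<open>{s / 2..s}\<close>, which is part of the tail of a convergent integral.\<close>

lemma kern_decay_if_green_bounded: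
  assumes "\<And>T. 0 \<le> T \<Longrightarrow> green TYPE('d::finite) T \<le> B" and "0 < e"
  shows "\<exists>T>0. \<forall>s\<ge>T. s * kern s (0 :: int ^ 'd) \<le> e"
proof -
  let ?G = "green TYPE('d) ` {0..}"
  have bdd: "bdd_above ?G" using assms(1) by (auto intro!: bdd_aboveI[where M = B])
  have "Sup ?G - e / 2 < Sup ?G" using assms(2) by simp
  then obtain T where T: "0 \<le> T" "Sup ?G - e / 2 < green TYPE('d) T"
    using less_cSup_iff[OF _ bdd, of "Sup ?G - e / 2"] by auto
  have "s * kern s (0 :: int ^ 'd) \<le> e" if s: "s \<ge> 2 * T + 1" for s
  proof -
    have "s * kern s (0 :: int ^ 'd) \<le> 2 * ((s - s / 2) * kern s (0 :: int ^ 'd))" by simp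
    also have "\<dots> \<le> 2 * (green TYPE('d) s - green TYPE('d) (s / 2))"
      using integral_kern_bounds(1)[of "s / 2" s, where 'd = 'd] green_combine[of "s / 2" s, where 'd = 'd] s T(1)
      by simp
    also have "\<dots> \<le> 2 * (Sup ?G - green TYPE('d) T)"
      using s T(1) by (intro mult_left_mono diff_mono cSup_upper bdd green_mono) auto
    also have "\<dots> \<le> e" using T(2) by simp
    finally show ?thesis .
  qed
  with T(1) show ?thesis by (intro exI[of _ "2 * T + 1"]) auto
qed

section \<open>Meeting probabilities on a grid: transient and recurrent case\<close>

context lattice_walk
begin

text \<open>The meeting probability on a grid of \<open>N\<close> steps, averaged over
  \<open>Y\<close>; in the limit of large \<open>N\<close> it bounds the loss
  \<open>1 - m x t\<close>.\<close>

definition hit_bound :: "real \<Rightarrow> real \<Rightarrow> nat \<Rightarrow> int ^ 'd \<Rightarrow> real" where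
  "hit_bound \<rho> t N x = measure_pmf.expectation (path_pmf (\<rho> * (t / N)) N)
     (\<lambda>ys. 1 - surv (\<kappa> * (t / N)) 0 ys x)"

lemma hit_bound_le:
  assumes \<rho>: "0 < \<rho>" and t: "0 < t" and N: "2 \<le> N" and j: "j \<le> N"
  shows "hit_bound \<rho> t N x \<le>
    real j * (t / N) * (4 * CARD('d) * (\<kappa> + \<rho>)) * kern (t * min \<kappa> \<rho> / 2) (0 :: int ^ 'd) +
    kern (real j * (t / N) * \<kappa>) (0 :: int ^ 'd) * (\<Sum>k\<le>N - j. mean_esc (\<kappa> * (t / N)) (\<rho> * (t / N)) k)"
proof -
  let ?h = "t / N"
  have h: "0 < ?h" using t N by simp
  \<comment> \<open>\<open>N >= 2\<close> gives \<open>N - 1 >= N / 2\<close>, so that all early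
    meetings see the kernel at a time of order \<open>t\<close>.\<close>
  have half: "t / 2 \<le> real (N - 1) * ?h"
    using N t by (simp add: field_simps of_nat_diff)
  have "min (a * h) (b * h) = min a b * h" if "0 < h" for a b h :: real
    using that by (simp add: min_def)
  from this[OF h] have "min (\<kappa> * ?h) (\<rho> * ?h) = min \<kappa> \<rho> * ?h" .
  then have "t * min \<kappa> \<rho> / 2 \<le> real (N - 1) * min (\<kappa> * ?h) (\<rho> * ?h)"
    using mult_right_mono[OF half, of "min \<kappa> \<rho>"] rate_pos \<rho> by (simp add: mult_ac)
  then have "kern (real (N - 1) * min (\<kappa> * ?h) (\<rho> * ?h)) (0 :: int ^ 'd) \<le> kern (t * min \<kappa> \<rho> / 2) (0 :: int ^ 'd)"
    by (rule kern_antimono)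
  moreover have "1 - kern (\<rho> * ?h + \<kappa> * ?h) (0 :: int ^ 'd) \<le> 4 * CARD('d) * (\<rho> * ?h + \<kappa> * ?h)"
    using rate_pos \<rho> h by (intro one_minus_kern_0_le add_nonneg_nonneg mult_nonneg_nonneg) (auto intro: less_imp_le)
  moreover have "0 \<le> \<rho> * ?h + \<kappa> * ?h"
    using rate_pos \<rho> h by (intro add_nonneg_nonneg mult_nonneg_nonneg) (auto intro: less_imp_le)
  from kern_0_le_1[OF this, where 'd = 'd] have "0 \<le> 1 - kern (\<rho> * ?h + \<kappa> * ?h) (0 :: int ^ 'd)"
    by simp
  ultimately have "kern (real (N - 1) * min (\<kappa> * ?h) (\<rho> * ?h)) (0 :: int ^ 'd) * (1 - kern (\<rho> * ?h + \<kappa> * ?h) (0 :: int ^ 'd))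
     \<le> kern (t * min \<kappa> \<rho> / 2) (0 :: int ^ 'd) * (4 * CARD('d) * (\<rho> * ?h + \<kappa> * ?h))"
    by (intro mult_mono) (auto simp: kern_0_nonneg)
  then have "real j * (kern (real (N - 1) * min (\<kappa> * ?h) (\<rho> * ?h)) (0 :: int ^ 'd) * (1 - kern (\<rho> * ?h + \<kappa> * ?h) (0 :: int ^ 'd)))
     \<le> real j * (kern (t * min \<kappa> \<rho> / 2) (0 :: int ^ 'd) * (4 * CARD('d) * (\<rho> * ?h + \<kappa> * ?h)))"
    by (rule mult_left_mono) simp
  also have "\<dots> = real j * ?h * (4 * CARD('d) * (\<kappa> + \<rho>)) * kern (t * min \<kappa> \<rho> / 2) (0 :: int ^ 'd)"
    by (simp add: algebra_simps)
  finally have first: "real j * (kern (real (N - 1) * min (\<kappa> * ?h) (\<rho> * ?h)) (0 :: int ^ 'd) * (1 - kern (\<rho> * ?h + \<kappa> * ?h) (0 :: int ^ 'd)))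
    \<le> real j * ?h * (4 * CARD('d) * (\<kappa> + \<rho>)) * kern (t * min \<kappa> \<rho> / 2) (0 :: int ^ 'd)" .
  have nn: "0 \<le> \<kappa> * ?h" "0 \<le> \<rho> * ?h"
    using rate_pos \<rho> h by (intro mult_nonneg_nonneg; linarith)+
  have eq: "real j * (\<kappa> * ?h) = real j * ?h * \<kappa>" by simp
  show ?thesis
    using expectation_one_minus_surv_le[OF nn j, of x] first unfolding hit_bound_def eq by linarith
qed

text \<open>The case \<open>j = N\<close>: only a meeting at the last step of \<open>X\<close> is
  left to the first bound, with \<open>mean_esc\<close> at most 1.\<close>

lemma hit_bound_transient:
  assumes \<rho>: "0 < \<rho>" and t: "0 < t" and N: "2 \<le> N"
  shows "hit_bound \<rho> t N x \<le>
    (4 * CARD('d) * (\<kappa> + \<rho>)) * (t * kern (t * min \<kappa> \<rho> / 2) (0 :: int ^ 'd)) + kern (t * \<kappa>) (0 :: int ^ 'd)"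
proof -
  have "kern (t * \<kappa>) (0 :: int ^ 'd) * mean_esc (\<kappa> * (t / N)) (\<rho> * (t / N)) 0 \<le> kern (t * \<kappa>) (0 :: int ^ 'd)"
    using mean_esc_bounds by (intro mult_right_le_one_le) (auto simp: kern_0_nonneg)
  then show ?thesis
    using hit_bound_le[OF \<rho> t N, of N x] N t by (simp add: mult_ac)
qed

text \<open>The cut is at a time between \<open>\<epsilon> * t\<close> and
  \<open>2 * \<epsilon> * t\<close>. The bound \<open>1 / s\<close> on the kernel cancels
  \<open>t\<close> in both parts: early meetings retain the factor \<epsilon>, late ones the
  reciprocal of the Green function.\<close>

lemma hit_bound_recurrent:
  assumes \<rho>: "0 < \<rho>" and t: "0 < t" and N: "2 \<le> N" and d: "CARD('d) \<ge> 2"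
    and \<epsilon>: "0 < \<epsilon>" "\<epsilon> \<le> 1 / 2" "1 \<le> \<epsilon> * N" and G: "0 < green TYPE('d) (\<epsilon> * (\<kappa> + \<rho>) * t)"
  shows "hit_bound \<rho> t N x \<le> 16 * CARD('d) * (\<kappa> + \<rho>) / min \<kappa> \<rho> * \<epsilon> +
    2 * (\<kappa> + \<rho>) / (\<epsilon> * \<kappa>) / green TYPE('d) (\<epsilon> * (\<kappa> + \<rho>) * t)"
proof -
  let ?h = "t / N" and ?c = "\<kappa> + \<rho>"
  \<comment> \<open>Rounding up at most doubles \<open>\<epsilon> * N\<close>, which is at least
    1.\<close>
  define j where "j = nat \<lceil>\<epsilon> * N\<rceil>"
  have j: "\<epsilon> * N \<le> j" "j \<le> 2 * (\<epsilon> * N)"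
    using \<epsilon>(3) unfolding j_def by linarith+
  have "2 * (\<epsilon> * N) \<le> real N" using mult_right_mono[OF \<epsilon>(2), of "real N"] by simp
  with j have jN: "j \<le> N" by linarith
  have h: "0 < ?h" using t N by simp
  have N0: "0 < real N" using N by simp
  have "real j * ?h \<le> 2 * (\<epsilon> * N) * ?h" using j h by (intro mult_right_mono) auto
  then have jh2: "real j * ?h \<le> 2 * \<epsilon> * t" using N0 by simp
  have "\<epsilon> * N * ?h \<le> real j * ?h" using j h by (intro mult_right_mono) auto
  then have jh1: "\<epsilon> * t \<le> real j * ?h" using N0 by simp
  have \<mu>: "0 < min \<kappa> \<rho>" using rate_pos \<rho> by simp
  have c: "0 < ?c" using rate_pos \<rho> by simp
  have nn: "0 \<le> \<kappa> * ?h" "0 \<le> \<rho> * ?h"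
    using rate_pos \<rho> h by (intro mult_nonneg_nonneg; linarith)+
  let ?S = "\<Sum>i\<le>j. kern (real i * (\<kappa> * ?h + \<rho> * ?h)) (0 :: int ^ 'd)"
  have first: "real j * ?h * (4 * CARD('d) * ?c) * kern (t * min \<kappa> \<rho> / 2) (0 :: int ^ 'd)
     \<le> 16 * CARD('d) * ?c / min \<kappa> \<rho> * \<epsilon>"
  proof -
    have "real j * ?h * (4 * CARD('d) * ?c) * kern (t * min \<kappa> \<rho> / 2) (0 :: int ^ 'd)
      \<le> (2 * \<epsilon> * t) * (4 * CARD('d) * ?c) * (1 / (t * min \<kappa> \<rho> / 2))"
      using c t \<mu> \<epsilon> by (intro mult_mono[OF mult_right_mono[OF jh2]] kern_0_le_inverse d) (auto simp: kern_0_nonneg)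
    also have "(2 * \<epsilon> * t) * (4 * CARD('d) * ?c) * (1 / (t * m / 2)) = 16 * CARD('d) * ?c / m * \<epsilon>" for m
      using t by simp
    finally show ?thesis .
  qed
  have "green TYPE('d) (\<epsilon> * ?c * t) \<le> green TYPE('d) (real (Suc j) * (\<kappa> * ?h + \<rho> * ?h))"
  proof (rule green_mono)
    have "\<epsilon> * ?c * t \<le> ?c * (real j * ?h)"
      using mult_left_mono[OF jh1, of ?c] c by (simp add: mult_ac)
    also have "\<dots> \<le> ?c * (real (Suc j) * ?h)"
      using c h by (intro mult_left_mono mult_right_mono) auto
    finally show "\<epsilon> * ?c * t \<le> real (Suc j) * (\<kappa> * ?h + \<rho> * ?h)"
      by (simp add: algebra_simps add_divide_distrib)
  qed (use \<epsilon> c t in auto)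
  also have "\<dots> \<le> (\<kappa> * ?h + \<rho> * ?h) * ?S"
    using green_le_riemann_sum[of "\<kappa> * ?h + \<rho> * ?h" "Suc j", where 'd = 'd, OF add_nonneg_nonneg[OF nn]]
    by (simp only: lessThan_Suc_atMost)
  also have "(\<kappa> * ?h + \<rho> * ?h) * ?S = ?c * ?h * ?S"
    by (simp only: distrib_right)
  finally have GS: "green TYPE('d) (\<epsilon> * ?c * t) \<le> ?c * ?h * ?S" .
  let ?q = "\<Sum>k\<le>N - j. mean_esc (\<kappa> * ?h) (\<rho> * ?h) k"
  have q0: "0 \<le> ?q" by (intro sum_nonneg mean_esc_bounds)
  have Sq: "?S * ?q \<le> real (Suc N)"
    by (rule sum_mean_esc_le[OF nn jN])
  have ch: "0 \<le> ?c * ?h"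
    using c h by (intro mult_nonneg_nonneg; linarith)
  have "green TYPE('d) (\<epsilon> * ?c * t) * ?q \<le> ?c * ?h * ?S * ?q"
    by (rule mult_right_mono[OF GS q0])
  also have "\<dots> = ?c * ?h * (?S * ?q)" by simp
  also have "\<dots> \<le> ?c * ?h * real (Suc N)"
    by (rule mult_left_mono[OF Sq ch])
  also have "\<dots> \<le> ?c * ?h * (2 * N)"
    by (rule mult_left_mono[OF _ ch]) (use N in simp)
  also have "\<dots> = 2 * ?c * t" using N0 by simp
  finally have qle: "?q \<le> 2 * ?c * t / green TYPE('d) (\<epsilon> * ?c * t)"
    using G by (simp add: pos_le_divide_eq mult.commute)
  have "kern (real j * ?h * \<kappa>) (0 :: int ^ 'd) \<le> kern (\<epsilon> * t * \<kappa>) (0 :: int ^ 'd)"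
    using jh1 rate_pos by (intro kern_antimono mult_right_mono) auto
  also have "\<dots> \<le> 1 / (\<epsilon> * t * \<kappa>)"
    using \<epsilon> t rate_pos by (intro kern_0_le_inverse d) auto
  finally have "kern (real j * ?h * \<kappa>) (0 :: int ^ 'd) * ?q \<le>
     1 / (\<epsilon> * t * \<kappa>) * (2 * ?c * t / green TYPE('d) (\<epsilon> * ?c * t))"
    using qle q0 \<epsilon> t rate_pos by (intro mult_mono) auto
  also have "\<dots> = 2 * ?c / (\<epsilon> * \<kappa>) / green TYPE('d) (\<epsilon> * ?c * t)"
    using t by simp
  finally show ?thesis
    using hit_bound_le[OF \<rho> t N jN, of x] first by linarith
qed

text \<open>The order of the quantifiers reflects that later the mesh tends to 0 at a fixed time
  \<open>t\<close>.\<close>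

lemma hit_bound_small:
  assumes \<rho>: "0 < \<rho>" and d: "CARD('d) \<ge> 2" and \<eta>: "0 < \<eta>"
  shows "\<exists>t0>0. \<forall>t\<ge>t0. \<forall>x. \<forall>\<^sub>F N in sequentially. hit_bound \<rho> t N x \<le> \<eta>"
proof (cases "\<exists>B. \<forall>T\<ge>0. green TYPE('d) T \<le> B")
  case True
  then obtain B where B: "\<And>T. 0 \<le> T \<Longrightarrow> green TYPE('d) T \<le> B" by blast
  define \<mu> where "\<mu> = min \<kappa> \<rho> / 2"
  define A where "A = 4 * CARD('d) * (\<kappa> + \<rho>)"
  have pos: "0 < \<mu>" "0 < A" using rate_pos \<rho> by (auto simp: \<mu>_def A_def)
  obtain T where T: "0 < T" "\<And>s. T \<le> s \<Longrightarrow> s * kern s (0 :: int ^ 'd) \<le> \<eta> * \<mu> / (2 * A)"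
    using kern_decay_if_green_bounded[OF B, of "\<eta> * \<mu> / (2 * A)"] pos \<eta> by auto
  \<comment> \<open>The first entry keeps the early meetings below \<open>\<eta> / 2\<close>, the
    second the meeting at the last step of \<open>X\<close>.\<close>
  define t0 where "t0 = max (T / \<mu>) (2 / (\<kappa> * \<eta>))"
  have t0: "0 < t0" using rate_pos \<eta> by (auto simp: t0_def less_max_iff_disj)
  have "hit_bound \<rho> t N x \<le> \<eta>" if t: "t \<ge> t0" and N: "2 \<le> N" for t x N
  proof -
    have tp: "0 < t" using t t0 by simp
    have "T \<le> t * \<mu>" using t pos by (simp add: t0_def pos_divide_le_eq)
    from T(2)[OF this] have "A * (t * kern (t * \<mu>) (0 :: int ^ 'd)) \<le> \<eta> / 2"
      using pos by (simp add: field_simps)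
    moreover have "kern (t * \<kappa>) (0 :: int ^ 'd) \<le> 1 / (t * \<kappa>)"
      using tp rate_pos by (intro kern_0_le_inverse d) auto
    moreover have "1 / (t * \<kappa>) \<le> \<eta> / 2"
    proof -
      have "2 / (\<kappa> * \<eta>) \<le> t" using t by (simp add: t0_def)
      then show ?thesis using tp rate_pos \<eta> by (simp add: field_simps)
    qed
    ultimately show ?thesis
      using hit_bound_transient[OF \<rho> tp N, of x] by (simp add: A_def \<mu>_def)
  qed
  then show ?thesis
    using t0 by (meson eventually_sequentiallyI)
next
  case False
  define \<mu> where "\<mu> = min \<kappa> \<rho>"
  define A where "A = 16 * CARD('d) * (\<kappa> + \<rho>) / \<mu>"
  have pos: "0 < \<mu>" "0 < A" using rate_pos \<rho> by (auto simp: \<mu>_def A_def)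
  \<comment> \<open>The early meetings contribute \<open>A * \<epsilon>\<close>, which the second
    entry keeps below \<open>\<eta> / 2\<close>; the first is a hypothesis of
    \<open>hit_bound_recurrent\<close>.\<close>
  define \<epsilon> where "\<epsilon> = min (1 / 2) (\<eta> / (2 * A))"
  have \<epsilon>: "0 < \<epsilon>" "\<epsilon> \<le> 1 / 2" using pos \<eta> by (auto simp: \<epsilon>_def)
  have A\<epsilon>: "A * \<epsilon> \<le> \<eta> / 2"
  proof -
    have "A * \<epsilon> \<le> A * (\<eta> / (2 * A))" using pos by (intro mult_left_mono) (auto simp: \<epsilon>_def)
    then show ?thesis using pos by simp
  qed
  \<comment> \<open>The value of the Green function at which the second term of
    \<open>hit_bound_recurrent\<close> equals \<open>\<eta> / 2\<close>.\<close>
  define g where "g = 4 * (\<kappa> + \<rho>) / (\<epsilon> * \<kappa>) / \<eta>"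
  have g: "0 < g" using rate_pos \<rho> \<epsilon> \<eta> by (auto simp: g_def)
  from False obtain T where T: "0 \<le> T" "g < green TYPE('d) T" by (meson not_le)
  define t0 where "t0 = T / (\<epsilon> * (\<kappa> + \<rho>)) + 1"
  have c: "0 < \<epsilon> * (\<kappa> + \<rho>)" using \<epsilon> rate_pos \<rho> by simp
  have t0: "0 < t0" using T c by (auto simp: t0_def intro!: add_nonneg_pos)
  have "\<forall>\<^sub>F N in sequentially. hit_bound \<rho> t N x \<le> \<eta>" if t: "t \<ge> t0" for t x
  proof -
    have tp: "0 < t" using t t0 by simp
    have "T / (\<epsilon> * (\<kappa> + \<rho>)) \<le> t" using t by (simp add: t0_def)
    then have "T \<le> \<epsilon> * (\<kappa> + \<rho>) * t" using c by (simp add: pos_divide_le_eq mult.commute)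
    then have G: "g < green TYPE('d) (\<epsilon> * (\<kappa> + \<rho>) * t)"
      using green_mono[OF T(1), of "\<epsilon> * (\<kappa> + \<rho>) * t", where 'd = 'd] T(2) by linarith
    have "2 * (\<kappa> + \<rho>) / (\<epsilon> * \<kappa>) / green TYPE('d) (\<epsilon> * (\<kappa> + \<rho>) * t) \<le> 2 * (\<kappa> + \<rho>) / (\<epsilon> * \<kappa>) / g"
      using G g rate_pos \<rho> \<epsilon> by (intro divide_left_mono) auto
    also have "\<dots> = \<eta> / 2"
    proof -
      define a where "a = 2 * (\<kappa> + \<rho>) / (\<epsilon> * \<kappa>)"
      have "0 < a" using rate_pos \<rho> \<epsilon> by (simp add: a_def)
      moreover have "g = 2 * a / \<eta>" by (simp add: g_def a_def)
      ultimately have "a / g = \<eta> / 2" using \<eta> by simp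
      then show ?thesis by (simp only: a_def)
    qed
    finally have second: "2 * (\<kappa> + \<rho>) / (\<epsilon> * \<kappa>) / green TYPE('d) (\<epsilon> * (\<kappa> + \<rho>) * t) \<le> \<eta> / 2" .
    have "hit_bound \<rho> t N x \<le> \<eta>" if N: "nat \<lceil>1 / \<epsilon>\<rceil> \<le> N" "2 \<le> N" for N
    proof -
      have "1 / \<epsilon> \<le> N" using N(1) by linarith
      then have "1 \<le> \<epsilon> * N" using \<epsilon> by (simp add: field_simps)
      from hit_bound_recurrent[OF \<rho> tp N(2) d \<epsilon> this, of x] G g
      show ?thesis using A\<epsilon> second unfolding A_def \<mu>_def by linarith
    qed
    then show ?thesis
      by (intro eventually_sequentiallyI[of "max 2 (nat \<lceil>1 / \<epsilon>\<rceil>)"]) auto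
  qed
  then show ?thesis using t0 by blast
qed

end

section \<open>Right-constant paths\<close>

lemma le_if_deriv_nonneg_off_countable:
  fixes f :: "real \<Rightarrow> real"
  assumes ab: "a \<le> b" and cont: "continuous_on {a..b} f" and S: "countable S"
    and deriv: "\<And>x. \<lbrakk>a < x; x < b; x \<notin> S\<rbrakk> \<Longrightarrow> \<exists>D\<ge>0. (f has_real_derivative D) (at x)"
  shows "f a \<le> f b"
proof (rule ccontr)
  assume "\<not> f a \<le> f b"
  then have fab: "f b < f a" and "a < b" using ab by (auto simp: not_le less_le)
  \<comment> \<open>The tilt makes the derivatives strictly positive; with half of the mean slope
    \<open>g b < g a\<close> still holds.\<close>
  define e where "e = (f a - f b) / 2 / (b - a)"
  define g where "g x = f x + e * (x - a)" for x
  have e: "0 < e" using fab \<open>a < b\<close> by (simp add: e_def)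
  have "b - a \<noteq> 0" using \<open>a < b\<close> by simp
  then have "e * (b - a) = (f a - f b) / 2"
    using nonzero_eq_divide_eq[of "b - a" e "(f a - f b) / 2"] e_def by blast
  then have gab: "g b < g a" using fab by (simp add: g_def)
  have contg: "continuous_on {a..b} g"
    unfolding g_def by (intro continuous_intros cont)
  have "uncountable ({g b<..<g a} - g ` S)"
    using gab S by (intro uncountable_minus_countable) (auto simp: uncountable_open_interval)
  then have "{g b<..<g a} - g ` S \<noteq> {}"
    by (rule contrapos_nn) (simp only: countable_empty)
  then obtain v where "v \<in> {g b<..<g a} - g ` S" by blast
  then have v: "g b < v" "v < g a" "v \<notin> g ` S" by auto
  define T where "T = {x \<in> {a..b}. v \<le> g x}"
  have "closed ({a..b} \<inter> g -` {v..})"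
    by (intro continuous_closed_preimage contg) auto
  moreover have "{a..b} \<inter> g -` {v..} = T" by (auto simp: T_def)
  ultimately have "closed T" by simp
  moreover have "bounded T"
    by (rule bounded_subset[of "{a..b}"]) (auto simp: T_def)
  ultimately have "compact T" by (simp add: compact_eq_bounded_closed)
  moreover have "a \<in> T" using v \<open>a < b\<close> by (auto simp: T_def)
  ultimately obtain s where s: "s \<in> T" "\<And>x. x \<in> T \<Longrightarrow> x \<le> s"
    using compact_attains_sup[of T] by blast
  have sb: "s < b" "a \<le> s" "v \<le> g s" using s(1) v(1) by (auto simp: T_def less_le)
  have "g s = v"
  proof -
    obtain x where x: "s \<le> x" "x \<le> b" "g x = v"
      using IVT2'[of g b v s] sb v(1) continuous_on_subset[OF contg, of "{s..b}"] by auto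
    then have "x \<in> T" using sb by (auto simp: T_def)
    then show ?thesis using s(2) x by fastforce
  qed
  then have "s \<notin> S" "s \<noteq> a" using v by auto
  then obtain D where D: "0 \<le> D" "(f has_real_derivative D) (at s)"
    using deriv[of s] sb by auto
  have "(g has_real_derivative D + e) (at s)"
    unfolding g_def by (auto intro!: derivative_eq_intros D(2))
  then obtain d where d: "0 < d" "\<And>h. 0 < h \<Longrightarrow> h < d \<Longrightarrow> g s < g (s + h)"
    using DERIV_pos_inc_right[of g "D + e" s] D(1) e by auto
  define h where "h = min (d / 2) (b - s)"
  have h: "0 < h" "h < d" "s + h \<le> b" using d(1) sb by (auto simp: h_def)
  have "s + h \<in> T" using d(2)[OF h(1,2)] \<open>g s = v\<close> h sb by (auto simp: T_def)
  then show False using s(2) h(1) by fastforce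
qed

definition right_constant :: "(real \<Rightarrow> 'c) \<Rightarrow> bool" where
  "right_constant y \<longleftrightarrow> (\<forall>t\<ge>0. \<forall>\<^sub>F s in at_right t. y s = y t)"

definition jumps :: "(real \<Rightarrow> 'c) \<Rightarrow> real set" where
  "jumps y = {t. 0 < t \<and> \<not> (\<forall>\<^sub>F s in at t. y s = y t)}"

text \<open>Each jump time is followed by an interval of constancy, which contains no further jump;
  these intervals are disjoint, and each contains a rational.\<close>

lemma countable_jumps:
  assumes "right_constant y"
  shows "countable (jumps y)"
proof -
  have "\<exists>b. 0 \<le> t \<longrightarrow> t < b \<and> (\<forall>s. t < s \<and> s < b \<longrightarrow> y s = y t)" for t
    using assms unfolding right_constant_def eventually_at_right_field by blast
  then obtain b where "\<And>t. 0 \<le> t \<longrightarrow> t < b t \<and> (\<forall>s. t < s \<and> s < b t \<longrightarrow> y s = y t)"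
    by metis
  then have b: "\<And>t. 0 \<le> t \<Longrightarrow> t < b t" "\<And>t s. 0 \<le> t \<Longrightarrow> t < s \<Longrightarrow> s < b t \<Longrightarrow> y s = y t"
    by blast+
  have disj: "b s \<le> t" if "s \<in> jumps y" "t \<in> jumps y" "s < t" for s t
  proof (rule ccontr)
    assume "\<not> b s \<le> t"
    then have t: "t \<in> {s<..<b s}" using that by auto
    have "0 \<le> s" using that by (auto simp: jumps_def)
    have "\<forall>\<^sub>F r in at t. r \<in> {s<..<b s}"
      using t by (intro eventually_at_in_open') auto
    then have "\<forall>\<^sub>F r in at t. y r = y t"
    proof eventually_elim
      case (elim r)
      then show ?case using b(2)[of s r] b(2)[of s t] t \<open>0 \<le> s\<close> by simp
    qed
    then show False using that by (auto simp: jumps_def)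
  qed
  have "\<exists>q. q \<in> \<rat> \<and> t < q \<and> q < b t" if "t \<in> jumps y" for t
  proof -
    have "0 \<le> t" using that by (simp add: jumps_def)
    from Rats_dense_in_real[OF b(1)[OF this]] show ?thesis by blast
  qed
  then obtain q where q: "\<And>t. t \<in> jumps y \<Longrightarrow> q t \<in> \<rat> \<and> t < q t \<and> q t < b t"
    by metis
  have "inj_on q (jumps y)"
  proof (rule linorder_inj_onI')
    fix s t assume "s \<in> jumps y" "t \<in> jumps y" "s < t"
    then show "q s \<noteq> q t" using disj[of s t] q[of s] q[of t] by linarith
  qed
  moreover have "countable (q ` jumps y)"
    by (rule countable_subset[OF _ countable_rat]) (use q in auto)
  ultimately show ?thesis by (rule countable_image_inj_on[rotated])
qed

text \<open>\<open>X\<close> is evaluated at the next point of the mesh \<open>1 / (n + 1)\<close>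
  strictly to the right, which for a fixed time and path is eventually exact. Times below 0, where
  nothing is known of \<open>X\<close>, are clamped.\<close>

lemma right_constant_jointly_measurable:
  fixes X :: "real \<Rightarrow> 'a \<Rightarrow> 'c::countable"
  assumes X: "\<And>t. 0 \<le> t \<Longrightarrow> X t \<in> M \<rightarrow>\<^sub>M count_space UNIV"
    and rc: "\<And>\<omega>. \<omega> \<in> space M \<Longrightarrow> right_constant (\<lambda>t. X t \<omega>)"
  shows "(\<lambda>p. X (max 0 (fst p)) (snd p)) \<in> borel \<Otimes>\<^sub>M M \<rightarrow>\<^sub>M count_space UNIV"
proof -
  define k :: "nat \<Rightarrow> real \<Rightarrow> nat" where "k n s = nat \<lfloor>(real n + 1) * max 0 s\<rfloor>" for n s
  define d where "d n s = (real (k n s) + 1) / (real n + 1)" for n s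
  define A where "A n p = X (d n (fst p)) (snd p)" for n p
  have A [measurable]: "A n \<in> borel \<Otimes>\<^sub>M M \<rightarrow>\<^sub>M count_space UNIV" for n
    unfolding A_def d_def
  proof (rule measurable_compose_countable[where g = "\<lambda>p. k n (fst p)" and f = "\<lambda>i p. X ((real i + 1) / (real n + 1)) (snd p)"])
    show "(\<lambda>p. X ((real i + 1) / (real n + 1)) (snd p)) \<in> borel \<Otimes>\<^sub>M M \<rightarrow>\<^sub>M count_space UNIV" for i
      by (rule measurable_compose[OF measurable_snd X]) auto
    show "(\<lambda>p. k n (fst p)) \<in> borel \<Otimes>\<^sub>M M \<rightarrow>\<^sub>M count_space UNIV"
      unfolding k_def by measurable
  qed
  have ev: "\<forall>\<^sub>F n in sequentially. A n p = X (max 0 (fst p)) (snd p)" if "snd p \<in> space M" for p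
  proof -
    define \<sigma> where "\<sigma> = max 0 (fst p)"
    have "\<forall>\<^sub>F r in at_right \<sigma>. X r (snd p) = X \<sigma> (snd p)"
      using rc[OF that] by (simp add: right_constant_def \<sigma>_def)
    then obtain b where b: "\<sigma> < b" "\<And>r. \<sigma> < r \<Longrightarrow> r < b \<Longrightarrow> X r (snd p) = X \<sigma> (snd p)"
      unfolding eventually_at_right_field by blast
    have "(\<lambda>n. 1 / (real n + 1)) \<longlonglongrightarrow> 0" by real_asymp
    then have "\<forall>\<^sub>F n in sequentially. 1 / (real n + 1) < b - \<sigma>"
      using b(1) by (intro order_tendstoD(2)[of _ 0]) auto
    then show ?thesis
    proof eventually_elim
      case (elim n)
      have n: "0 < real n + 1" by simp
      have fl: "real (k n (fst p)) = of_int \<lfloor>(real n + 1) * \<sigma>\<rfloor>"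
        unfolding k_def \<sigma>_def by simp
      have "(real n + 1) * \<sigma> < real (k n (fst p)) + 1" unfolding fl by linarith
      then have 1: "\<sigma> < d n (fst p)" unfolding d_def using n by (simp add: pos_less_divide_eq mult.commute)
      have "real (k n (fst p)) + 1 \<le> (real n + 1) * \<sigma> + 1" unfolding fl by linarith
      then have "d n (fst p) \<le> ((real n + 1) * \<sigma> + 1) / (real n + 1)"
        unfolding d_def using n by (intro divide_right_mono) auto
      also have "\<dots> = \<sigma> + 1 / (real n + 1)" using n by (simp add: add_divide_distrib)
      finally have "d n (fst p) < b" using elim by simp
      then show ?case unfolding A_def using b(2)[OF 1] by (simp add: \<sigma>_def)
    qed
  qed
  show ?thesis
    unfolding measurable_count_space_eq2_countable
  proof (intro conjI ballI)
    fix c :: 'c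
    have "(\<lambda>p. X (max 0 (fst p)) (snd p)) -` {c} \<inter> space (borel \<Otimes>\<^sub>M M) =
       {p \<in> space (borel \<Otimes>\<^sub>M M). \<forall>\<^sub>F n in sequentially. A n p = c}"
    proof (intro set_eqI iffI; clarsimp simp: space_pair_measure)
      fix s \<omega> assume w: "\<omega> \<in> space M"
      show "\<forall>\<^sub>F n in sequentially. A n (s, \<omega>) = X (max 0 s) \<omega>"
        using ev[of "(s, \<omega>)"] w by simp
      assume "\<forall>\<^sub>F n in sequentially. A n (s, \<omega>) = c"
      moreover have "\<forall>\<^sub>F n in sequentially. A n (s, \<omega>) = X (max 0 s) \<omega>"
        using ev[of "(s, \<omega>)"] w by simp
      ultimately have "\<forall>\<^sub>F n in sequentially. X (max 0 s) \<omega> = c"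
        by eventually_elim simp
      then show "X (max 0 s) \<omega> = c" by simp
    qed
    also have "\<dots> \<in> sets (borel \<Otimes>\<^sub>M M)"
    proof (rule sets_Collect_eventually_sequentially)
      fix n
      have "{p \<in> space (borel \<Otimes>\<^sub>M M). A n p = c} = A n -` {c} \<inter> space (borel \<Otimes>\<^sub>M M)" by auto
      then show "{p \<in> space (borel \<Otimes>\<^sub>M M). A n p = c} \<in> sets (borel \<Otimes>\<^sub>M M)"
        using measurable_sets[OF A, of "{c}" n] by simp
    qed
    finally show "(\<lambda>p. X (max 0 (fst p)) (snd p)) -` {c} \<inter> space (borel \<Otimes>\<^sub>M M) \<in> sets (borel \<Otimes>\<^sub>M M)" .
  qed auto
qed

lemma right_constant_measurable:
  fixes y :: "real \<Rightarrow> 'c::countable"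
  assumes "right_constant y"
  shows "(\<lambda>s. y (max 0 s)) \<in> borel \<rightarrow>\<^sub>M count_space UNIV"
proof -
  have "(\<lambda>p. y (max 0 (fst p))) \<in> borel \<Otimes>\<^sub>M count_space (UNIV :: unit set) \<rightarrow>\<^sub>M count_space UNIV"
    by (rule right_constant_jointly_measurable[where X = "\<lambda>t _. y t"]) (use assms in auto)
  from measurable_compose[OF _ this, of "\<lambda>s. (s, ())" borel] show ?thesis by simp
qed

definition off_ind :: "(real \<Rightarrow> 'c) \<Rightarrow> 'c \<Rightarrow> real \<Rightarrow> real" where
  "off_ind y c r = (if y r = c then 0 else 1)"

lemma off_ind_integrable:
  fixes y :: "real \<Rightarrow> 'c::countable"
  assumes "right_constant y" "0 \<le> a"
  shows "off_ind y c integrable_on {a..b}"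
proof -
  note [measurable] = right_constant_measurable[OF assms(1)]
  have "set_integrable lborel {a..b} (\<lambda>r. if y (max 0 r) = c then 0 else 1 :: real)"
    unfolding set_integrable_def
    by (rule integrableI_bounded_set_indicator[where B = 1])
       (auto simp: emeasure_lborel_Icc_eq)
  then have "(\<lambda>r. if y (max 0 r) = c then 0 else 1 :: real) integrable_on {a..b}"
    by (rule set_borel_integral_eq_integral)
  then show ?thesis
    by (rule integrable_eq) (use assms(2) in \<open>auto simp: off_ind_def max_def\<close>)
qed

lemma off_ind_integral_deriv:
  fixes y :: "real \<Rightarrow> 'c::countable"
  assumes "right_constant y" "0 \<le> a" "a < r" "r < b" "r \<notin> jumps y"
  shows "((\<lambda>u. integral {a..u} (off_ind y c)) has_real_derivative off_ind y c r) (at r)"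
proof -
  have "\<forall>\<^sub>F s in at r. off_ind y c s = off_ind y c r"
    using assms by (auto simp: jumps_def off_ind_def elim: eventually_mono)
  then have "isCont (off_ind y c) r"
    unfolding isCont_def by (rule tendsto_eventually)
  then have "continuous (at r within ({a..b} - {})) (off_ind y c)"
    by (rule continuous_at_imp_continuous_at_within)
  moreover have "r \<in> {a..b} - {}" using assms by simp
  ultimately have "((\<lambda>u. integral {a..u} (off_ind y c)) has_vector_derivative off_ind y c r) (at r within ({a..b} - {}))"
    by (intro integral_has_vector_derivative_continuous_at off_ind_integrable assms(1,2) finite.emptyI)
  then have "((\<lambda>u. integral {a..u} (off_ind y c)) has_vector_derivative off_ind y c r) (at r within {a<..<b})"
    by (rule has_vector_derivative_within_subset) auto
  moreover have "at r within {a<..<b} = at r"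
    using assms by (intro at_within_open) auto
  ultimately show ?thesis
    by (simp only: has_real_derivative_iff_has_vector_derivative)
qed

section \<open>The moving soft trap\<close>

lemma has_derivative_power_fact:
  "((\<lambda>r. (a * (r - s)) ^ Suc k / fact (Suc k) * c) has_real_derivative a * ((a * (r - s)) ^ k / fact k * c)) (at r)"
proof -
  have "((\<lambda>r. (a * (r - s)) ^ Suc k) has_real_derivative real (Suc k) * ((a * (r - s)) ^ k * a)) (at r)"
  proof -
    have "((\<lambda>r. a * (r - s)) has_real_derivative a) (at r)"
      by (auto intro!: derivative_eq_intros)
    from DERIV_power_Suc[OF this, of k] show ?thesis by (simp add: mult_ac del: power_Suc)
  qed
  from DERIV_cmult_right[OF DERIV_cdivide[OF this, of "fact (Suc k)"], of c]
  have "((\<lambda>r. (a * (r - s)) ^ Suc k / fact (Suc k) * c) has_real_derivative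
      real (Suc k) * ((a * (r - s)) ^ k * a) / fact (Suc k) * c) (at r)" .
  moreover have "real (Suc k) * ((a * (r - s)) ^ k * a) / fact (Suc k) * c = a * ((a * (r - s)) ^ k / fact k * c)"
    by (simp add: fact_Suc del: of_nat_Suc)
  ultimately show ?thesis by (simp only:)
qed

text \<open>Nonnegative solutions are not assumed to be bounded, so \<open>u \<le> 1\<close> needs a Widder-type argument.\<close>

definition nbr :: "int ^ 'd \<Rightarrow> int ^ 'd \<Rightarrow> bool" where
  "nbr x x' \<longleftrightarrow> (\<exists>i. x' = x + unitv i \<or> x' = x - unitv i)"

text \<open>Endpoints of paths of exactly \<open>n\<close> steps, not a ball: the weight
  \<open>t ^ n / n!\<close> belongs to \<open>n\<close> jumps.\<close>

primrec reach :: "nat \<Rightarrow> int ^ 'd \<Rightarrow> (int ^ 'd) set" where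
  "reach 0 x = {x}"
| "reach (Suc n) x = (\<Union>x'\<in>Collect (nbr x). reach n x')"

lemma laplacian_eq':
  fixes f :: "int ^ 'd \<Rightarrow> real"
  shows "laplacian f x = (\<Sum>i\<in>UNIV. f (x + unitv i) + f (x - unitv i)) - 2 * CARD('d) * f x"
  by (simp add: laplacian_eq sum_subtractf)

section \<open>Solutions for a fixed trap path and their bound by 1\<close>

locale soft_trap =
  fixes \<kappa> \<gamma> :: real and y :: "real \<Rightarrow> int ^ 'd" and u :: "real \<Rightarrow> int ^ 'd \<Rightarrow> real"
  assumes \<kappa>: "0 < \<kappa>" and \<gamma>: "\<gamma> < 0" and y: "right_constant y"
    and sol: "pam_solution \<kappa> (\<lambda>t x. if x = y t then \<gamma> else 0) (\<lambda>_. 1) u"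
begin

definition \<xi> :: "real \<Rightarrow> int ^ 'd \<Rightarrow> real" where "\<xi> t x = (if x = y t then \<gamma> else 0)"

text \<open>Total jump rate of a walk of rate \<kappa>; the factor
  \<open>exp (d\<kappa> * t)\<close> below removes the diagonal part of the generator.\<close>

definition d\<kappa> :: real where "d\<kappa> = 2 * CARD('d) * \<kappa>"

lemma d\<kappa>_pos: "0 < d\<kappa>" using \<kappa> by (simp add: d\<kappa>_def)

lemma \<xi>_bounds: "\<gamma> \<le> \<xi> t x" "\<xi> t x \<le> 0" using \<gamma> by (auto simp: \<xi>_def)

lemma u_nonneg: "0 \<le> t \<Longrightarrow> 0 \<le> u t x"
  using sol by (simp add: pam_solution_def)

lemma u_0: "u 0 x = 1"
  using sol by (simp add: pam_solution_def)

lemma u_cont: "0 \<le> a \<Longrightarrow> continuous_on {a..b} (\<lambda>t. u t x)"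
  using sol unfolding pam_solution_def by (rule_tac continuous_on_subset[of "{0..}"]) auto

lemma u_deriv:
  assumes "0 < t" "t \<notin> jumps y"
  shows "((\<lambda>s. u s x) has_real_derivative \<kappa> * laplacian (u t) x + \<xi> t x * u t x) (at t)"
proof -
  have "\<forall>\<^sub>F s in at t. y s = y t" using assms by (simp add: jumps_def)
  then have "\<forall>\<^sub>F s in at t. (if x = y s then \<gamma> else 0) = (if x = y t then \<gamma> else 0)"
    by eventually_elim simp
  then show ?thesis
    using sol assms(1) unfolding pam_solution_def \<xi>_def by blast
qed

lemma laplacian_ge_nbr:
  assumes "nbr x x'" "0 \<le> t"
  shows "\<kappa> * u t x' \<le> \<kappa> * laplacian (u t) x + d\<kappa> * u t x"
proof -
  obtain i where i: "x' = x + unitv i \<or> x' = x - unitv i" using assms(1) by (auto simp: nbr_def)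
  have "u t x' \<le> u t (x + unitv i) + u t (x - unitv i)"
    using i u_nonneg[OF assms(2)] by auto
  also have "\<dots> \<le> (\<Sum>i\<in>UNIV. u t (x + unitv i) + u t (x - unitv i))"
    by (rule member_le_sum) (auto intro: add_nonneg_nonneg u_nonneg assms(2))
  also have "\<dots> = laplacian (u t) x + 2 * CARD('d) * u t x"
    by (simp add: laplacian_eq')
  finally have "\<kappa> * u t x' \<le> \<kappa> * (laplacian (u t) x + 2 * CARD('d) * u t x)"
    using \<kappa> by (intro mult_left_mono) auto
  then show ?thesis by (simp add: d\<kappa>_def algebra_simps)
qed

text \<open>Besides the diagonal of the generator, the factor absorbs the worst value \<gamma> of
  the potential, so that the derivative at \<open>x\<close> is at least \<kappa> times the value at
  any single neighbour.\<close>

definition grown :: "real \<Rightarrow> int ^ 'd \<Rightarrow> real" where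
  "grown t x = exp ((d\<kappa> - \<gamma>) * t) * u t x"

lemma grown_nonneg: "0 \<le> t \<Longrightarrow> 0 \<le> grown t x"
  by (simp add: grown_def u_nonneg)

lemma grown_cont: "0 \<le> a \<Longrightarrow> continuous_on {a..b} (\<lambda>t. grown t x)"
  unfolding grown_def by (intro continuous_intros u_cont)

lemma grown_deriv:
  assumes "0 < t" "t \<notin> jumps y" "nbr x x'"
  shows "\<exists>D. ((\<lambda>s. grown s x) has_real_derivative D) (at t) \<and> \<kappa> * grown t x' \<le> D"
proof (intro exI conjI)
  let ?e = "exp ((d\<kappa> - \<gamma>) * t)"
  let ?D = "(d\<kappa> - \<gamma>) * ?e * u t x + (\<kappa> * laplacian (u t) x + \<xi> t x * u t x) * ?e"
  have "((\<lambda>s. exp ((d\<kappa> - \<gamma>) * s)) has_real_derivative (d\<kappa> - \<gamma>) * ?e) (at t)"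
    by (auto intro!: derivative_eq_intros)
  from DERIV_mult[OF this u_deriv[OF assms(1,2), of x]]
  show "((\<lambda>s. grown s x) has_real_derivative ?D) (at t)"
    unfolding grown_def .
  have "\<gamma> * u t x \<le> \<xi> t x * u t x"
    using \<xi>_bounds u_nonneg assms(1) by (intro mult_right_mono) auto
  then have "\<kappa> * u t x' \<le> (d\<kappa> - \<gamma>) * u t x + (\<kappa> * laplacian (u t) x + \<xi> t x * u t x)"
    using laplacian_ge_nbr[OF assms(3), of t] assms(1) by (simp add: algebra_simps)
  then have "?e * (\<kappa> * u t x') \<le> ?e * ((d\<kappa> - \<gamma>) * u t x + (\<kappa> * laplacian (u t) x + \<xi> t x * u t x))"
    by (rule mult_left_mono) simp
  then show "\<kappa> * grown t x' \<le> ?D"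
    by (simp add: grown_def algebra_simps)
qed

lemma nbr_exists: "\<exists>x'. nbr x x'"
  unfolding nbr_def by blast

lemma grown_mono:
  assumes "0 \<le> s" "s \<le> t"
  shows "grown s x \<le> grown t x"
proof (rule le_if_deriv_nonneg_off_countable[OF assms(2) grown_cont[OF assms(1)] countable_jumps[OF y]])
  fix r assume r: "s < r" "r \<notin> jumps y"
  obtain x' where x': "nbr x x'" using nbr_exists by blast
  have r0: "0 < r" using r assms by simp
  have "0 \<le> \<kappa> * grown r x'" using \<kappa> r0 by (simp add: grown_nonneg)
  then show "\<exists>D\<ge>0. ((\<lambda>t. grown t x) has_real_derivative D) (at r)"
    using grown_deriv[OF r0 r(2) x'] by (meson order.trans)
qed

text \<open>Induction along one path of \<open>n\<close> steps from \<open>x\<close> to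
  \<open>x'\<close>: each step integrates the bound of \<open>grown_deriv\<close> once.\<close>

lemma grown_ge:
  assumes "x' \<in> reach n x" "0 \<le> s" "s \<le> t"
  shows "(\<kappa> * (t - s)) ^ n / fact n * grown s x' \<le> grown t x"
  using assms(1,3)
proof (induction n arbitrary: x t)
  case 0
  then show ?case using grown_mono[OF assms(2)] by simp
next
  case (Suc n)
  obtain z where z: "nbr x z" "x' \<in> reach n z" using Suc.prems(1) by auto
  let ?c = "grown s x'"
  let ?f = "\<lambda>r. grown r x - (\<kappa> * (r - s)) ^ Suc n / fact (Suc n) * ?c"
  have "?f s \<le> ?f t"
  proof (rule le_if_deriv_nonneg_off_countable[OF Suc.prems(2) _ countable_jumps[OF y]])
    show "continuous_on {s..t} ?f"
      by (intro continuous_on_diff grown_cont assms(2)) (intro continuous_intros, simp)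
    fix r assume r: "s < r" "r < t" "r \<notin> jumps y"
    have r0: "0 < r" using r assms(2) by simp
    obtain D where D: "((\<lambda>s. grown s x) has_real_derivative D) (at r)" "\<kappa> * grown r z \<le> D"
      using grown_deriv[OF r0 r(3) z(1)] by blast
    have "(\<kappa> * (r - s)) ^ n / fact n * ?c \<le> grown r z"
      using Suc.IH[OF z(2), of r] r by simp
    then have "\<kappa> * ((\<kappa> * (r - s)) ^ n / fact n * ?c) \<le> \<kappa> * grown r z"
      using \<kappa> by (intro mult_left_mono) auto
    with D(2) have "0 \<le> D - \<kappa> * ((\<kappa> * (r - s)) ^ n / fact n * ?c)" by linarith
    moreover have "(?f has_real_derivative D - \<kappa> * ((\<kappa> * (r - s)) ^ n / fact n * ?c)) (at r)"
      by (rule DERIV_diff[OF D(1) has_derivative_power_fact])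
    ultimately show "\<exists>D\<ge>0. (?f has_real_derivative D) (at r)" by blast
  qed
  moreover have "0 \<le> ?f s" using grown_nonneg[OF assms(2)] by simp
  ultimately show ?case by linarith
qed

definition excess :: "real \<Rightarrow> int ^ 'd \<Rightarrow> real" where
  "excess t x = exp (d\<kappa> * t) * (u t x - 1)"

lemma excess_cont: "0 \<le> a \<Longrightarrow> continuous_on {a..b} (\<lambda>t. excess t x)"
  unfolding excess_def by (intro continuous_intros u_cont)

lemma excess_deriv:
  assumes "0 < t" "t \<notin> jumps y"
  shows "\<exists>D. ((\<lambda>s. excess s x) has_real_derivative D) (at t) \<and>
    D \<le> \<kappa> * (\<Sum>i\<in>UNIV. excess t (x + unitv i) + excess t (x - unitv i))"
proof (intro exI conjI)
  let ?e = "exp (d\<kappa> * t)"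
  let ?w = "\<lambda>x. u t x - 1"
  let ?D = "d\<kappa> * ?e * ?w x + (\<kappa> * laplacian (u t) x + \<xi> t x * u t x) * ?e"
  have "((\<lambda>s. exp (d\<kappa> * s)) has_real_derivative d\<kappa> * ?e) (at t)"
    by (auto intro!: derivative_eq_intros)
  moreover have "((\<lambda>s. u s x - 1) has_real_derivative \<kappa> * laplacian (u t) x + \<xi> t x * u t x) (at t)"
    using DERIV_diff[OF u_deriv[OF assms, of x] DERIV_const, of 1] by simp
  ultimately show "((\<lambda>s. excess s x) has_real_derivative ?D) (at t)"
    unfolding excess_def by (rule DERIV_mult)
  have "laplacian (u t) x = (\<Sum>i\<in>UNIV. ?w (x + unitv i) + ?w (x - unitv i)) - 2 * CARD('d) * ?w x"
    by (simp add: laplacian_eq' sum.distrib sum_subtractf algebra_simps)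
  then have lap: "\<kappa> * laplacian (u t) x = \<kappa> * (\<Sum>i\<in>UNIV. ?w (x + unitv i) + ?w (x - unitv i)) - d\<kappa> * ?w x"
    unfolding d\<kappa>_def by (simp only: right_diff_distrib) (simp add: mult_ac)
  have "\<xi> t x * u t x \<le> 0"
    using \<xi>_bounds(2)[of t x] u_nonneg[of t x] assms(1) by (simp add: mult_nonpos_nonneg)
  with lap have "d\<kappa> * ?w x + (\<kappa> * laplacian (u t) x + \<xi> t x * u t x) \<le>
     \<kappa> * (\<Sum>i\<in>UNIV. ?w (x + unitv i) + ?w (x - unitv i))" by linarith
  then have "?e * (d\<kappa> * ?w x + (\<kappa> * laplacian (u t) x + \<xi> t x * u t x)) \<le>
     ?e * (\<kappa> * (\<Sum>i\<in>UNIV. ?w (x + unitv i) + ?w (x - unitv i)))"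
    by (rule mult_left_mono) simp
  also have "\<dots> = \<kappa> * (\<Sum>i\<in>UNIV. excess t (x + unitv i) + excess t (x - unitv i))"
    by (simp only: excess_def mult.left_commute[of ?e] sum_distrib_left[of ?e] distrib_left[of ?e])
  also have "?e * (d\<kappa> * ?w x + (\<kappa> * laplacian (u t) x + \<xi> t x * u t x)) = ?D"
    by (simp add: algebra_simps)
  finally show "?D \<le> \<kappa> * (\<Sum>i\<in>UNIV. excess t (x + unitv i) + excess t (x - unitv i))" .
qed

text \<open>The initial value is 0, and each of the \<open>n\<close> integrations sums over all
  \<open>2 * CARD('d)\<close> neighbours, whence \<open>d\<kappa>\<close> in place of the \<kappa>
  in \<open>grown_ge\<close>.\<close>

lemma excess_le:
  assumes "\<And>x' r. \<lbrakk>x' \<in> reach n x; 0 \<le> r; r \<le> T\<rbrakk> \<Longrightarrow> excess r x' \<le> S" and "0 \<le> t" "t \<le> T"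
  shows "excess t x \<le> (d\<kappa> * t) ^ n / fact n * S"
  using assms
proof (induction n arbitrary: x t)
  case 0
  then show ?case by simp
next
  case (Suc n)
  have IH: "excess r z \<le> (d\<kappa> * r) ^ n / fact n * S" if "nbr x z" "0 \<le> r" "r \<le> T" for z r
    using that by (intro Suc.IH Suc.prems(1)) auto
  let ?f = "\<lambda>r. (d\<kappa> * (r - 0)) ^ Suc n / fact (Suc n) * S - excess r x"
  have "?f 0 \<le> ?f t"
  proof (rule le_if_deriv_nonneg_off_countable[OF Suc.prems(2) _ countable_jumps[OF y]])
    show "continuous_on {0..t} ?f"
      by (intro continuous_on_diff excess_cont) (intro continuous_intros, simp_all)
    fix r assume r: "0 < r" "r < t" "r \<notin> jumps y"
    obtain D where D: "((\<lambda>s. excess s x) has_real_derivative D) (at r)"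
        "D \<le> \<kappa> * (\<Sum>i\<in>UNIV. excess r (x + unitv i) + excess r (x - unitv i))"
      using excess_deriv[OF r(1,3)] by blast
    let ?b = "(d\<kappa> * r) ^ n / fact n * S"
    have "excess r (x + unitv i) + excess r (x - unitv i) \<le> 2 * ?b" for i
    proof -
      have "nbr x (x + unitv i)" "nbr x (x - unitv i)" by (auto simp: nbr_def)
      note nb = this
      have "0 \<le> r" "r \<le> T" using r Suc.prems(3) by auto
      from add_mono[OF IH[OF nb(1) this] IH[OF nb(2) this]] show ?thesis by (simp only: mult_2)
    qed
    then have "(\<Sum>i\<in>UNIV. excess r (x + unitv i) + excess r (x - unitv i)) \<le> (\<Sum>i\<in>(UNIV :: 'd set). 2 * ?b)"
      by (intro sum_mono)
    then have "\<kappa> * (\<Sum>i\<in>UNIV. excess r (x + unitv i) + excess r (x - unitv i)) \<le> \<kappa> * (\<Sum>i\<in>(UNIV :: 'd set). 2 * ?b)"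
      using \<kappa> by (intro mult_left_mono) auto
    also have "\<dots> = d\<kappa> * ((d\<kappa> * (r - 0)) ^ n / fact n * S)" by (simp add: d\<kappa>_def)
    finally have "0 \<le> d\<kappa> * ((d\<kappa> * (r - 0)) ^ n / fact n * S) - D" using D(2) by linarith
    moreover have "(?f has_real_derivative d\<kappa> * ((d\<kappa> * (r - 0)) ^ n / fact n * S) - D) (at r)"
      by (rule DERIV_diff[OF has_derivative_power_fact D(1)])
    ultimately show "\<exists>D\<ge>0. (?f has_real_derivative D) (at r)" by blast
  qed
  moreover have "?f 0 = 0" by (simp add: excess_def u_0)
  ultimately show ?case by simp
qed

text \<open>A positive solution grows at most like \<open>n!\<close> at distance \<open>n\<close>, while the heat
  equation transports mass from distance \<open>n\<close> with weight \<open>t ^ n / n!\<close>; for a long enough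
  horizon \<open>T\<close> the product tends to 0.\<close>

lemma u_le_1:
  assumes t: "0 \<le> t"
  shows "u t x \<le> 1"
proof -
  let ?d = "real CARD('d)"
  \<comment> \<open>With this horizon \<open>2 * ?d * t / (T - t)\<close>, whose \<open>n\<close>-th
    power remains once the factorials cancel, is at most \<open>1 / 2\<close>; the 1 keeps
    \<open>T > t\<close> when \<open>t = 0\<close>.\<close>
  define T where "T = t + (4 * ?d * t + 1)"
  have T: "0 < T - t" "4 * ?d * t \<le> T - t" "t \<le> T" using t by (auto simp: T_def intro: add_nonneg_pos)
  define B where "B = exp (d\<kappa> * t) * grown T x"
  have B: "0 \<le> B" using t T by (simp add: B_def grown_nonneg)
  have "excess t x \<le> (1 / 2) ^ n * B" for n
  proof -
    have P: "0 < (\<kappa> * (T - t)) ^ n" using \<kappa> T by simp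
    have "excess t x \<le> (d\<kappa> * t) ^ n / fact n * (fact n / (\<kappa> * (T - t)) ^ n * B)"
    proof (rule excess_le[OF _ t order.refl])
      fix z r assume z: "z \<in> reach n x" and r: "0 \<le> r" "r \<le> t"
      have u: "0 \<le> u r z" using r by (simp add: u_nonneg)
      have "(\<kappa> * (T - t)) ^ n / fact n * grown r z \<le> (\<kappa> * (T - r)) ^ n / fact n * grown r z"
        using \<kappa> r T by (intro mult_right_mono divide_right_mono power_mono mult_left_mono grown_nonneg) auto
      also have "\<dots> \<le> grown T x"
        using grown_ge[OF z r(1), of T] r T by simp
      finally have g: "grown r z \<le> fact n / (\<kappa> * (T - t)) ^ n * grown T x"
        using P by (simp add: field_simps)
      have "excess r z \<le> exp (d\<kappa> * r) * u r z" by (simp add: excess_def)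
      also have "\<dots> \<le> exp (d\<kappa> * t) * grown r z"
        unfolding grown_def
      proof (intro mult_mono)
        show "exp (d\<kappa> * r) \<le> exp (d\<kappa> * t)" using r d\<kappa>_pos by simp
        have "1 \<le> exp ((d\<kappa> - \<gamma>) * r)" using r d\<kappa>_pos \<gamma> by simp
        then show "u r z \<le> exp ((d\<kappa> - \<gamma>) * r) * u r z"
          using mult_right_mono[OF _ u, of 1] by simp
      qed (use u in auto)
      also have "\<dots> \<le> exp (d\<kappa> * t) * (fact n / (\<kappa> * (T - t)) ^ n * grown T x)"
        using g by (rule mult_left_mono) simp
      finally show "excess r z \<le> fact n / (\<kappa> * (T - t)) ^ n * B"
        by (simp add: B_def mult_ac)
    qed
    also have "\<dots> = (d\<kappa> * t / (\<kappa> * (T - t))) ^ n * B"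
      by (simp add: power_divide)
    also have "\<dots> \<le> (1 / 2) ^ n * B"
    proof (intro mult_right_mono power_mono B)
      have "d\<kappa> * t / (\<kappa> * (T - t)) = 2 * ?d * t / (T - t)" using \<kappa> by (simp add: d\<kappa>_def)
      also have "\<dots> \<le> 1 / 2" using T by (simp add: pos_divide_le_eq)
      finally show "d\<kappa> * t / (\<kappa> * (T - t)) \<le> 1 / 2" .
      show "0 \<le> d\<kappa> * t / (\<kappa> * (T - t))"
        using t T \<kappa> d\<kappa>_pos by (intro divide_nonneg_nonneg mult_nonneg_nonneg) auto
    qed
    finally show ?thesis .
  qed
  moreover have "(\<lambda>n. (1 / 2) ^ n * B) \<longlonglongrightarrow> 0"
    by (intro tendsto_mult_left_zero LIMSEQ_power_zero) simp
  ultimately have "excess t x \<le> 0"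
    by (intro LIMSEQ_le_const[of "\<lambda>n. (1 / 2) ^ n * B" 0]) auto
  then show ?thesis by (simp add: excess_def mult_le_0_iff not_le)
qed

end

section \<open>Convergence of the Euler scheme to the solution\<close>

lemma increment_bound:
  fixes f :: "real \<Rightarrow> real" and y :: "real \<Rightarrow> 'c::countable"
  assumes y: "right_constant y" and ab: "0 \<le> a" "a \<le> b" and cont: "continuous_on {a..b} f"
    and deriv: "\<And>r. \<lbrakk>a < r; r < b; r \<notin> jumps y\<rbrakk> \<Longrightarrow>
      \<exists>D. (f has_real_derivative D) (at r) \<and> \<bar>D\<bar> \<le> A + B * off_ind y c r"
  shows "\<bar>f b - f a\<bar> \<le> A * (b - a) + B * integral {a..b} (off_ind y c)"
proof -
  \<comment> \<open>The two signs give the two halves of the absolute value, each by the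
    monotonicity criterion off the countable set of jumps.\<close>
  have "s * (f b - f a) \<le> A * (b - a) + B * integral {a..b} (off_ind y c)" if s: "s = 1 \<or> s = -1" for s
  proof -
    let ?h = "\<lambda>r. A * (r - a) + B * integral {a..r} (off_ind y c) - s * (f r - f a)"
    have "?h a \<le> ?h b"
    proof (rule le_if_deriv_nonneg_off_countable[OF ab(2) _ countable_jumps[OF y]])
      show "continuous_on {a..b} ?h"
        by (intro continuous_intros cont indefinite_integral_continuous_1 off_ind_integrable y ab(1))
      fix r assume r: "a < r" "r < b" "r \<notin> jumps y"
      obtain D where D: "(f has_real_derivative D) (at r)" "\<bar>D\<bar> \<le> A + B * off_ind y c r"
        using deriv[OF r] by blast
      have "((\<lambda>r. s * (f r - f a)) has_real_derivative s * D) (at r)"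
        using DERIV_cmult[OF DERIV_diff[OF D(1) DERIV_const], of s] by simp
      moreover have "((\<lambda>r. B * integral {a..r} (off_ind y c)) has_real_derivative B * off_ind y c r) (at r)"
        by (intro DERIV_cmult off_ind_integral_deriv[OF y ab(1) r(1,2,3)])
      moreover have "((\<lambda>r. A * (r - a)) has_real_derivative A) (at r)"
        by (auto intro!: derivative_eq_intros)
      ultimately have "(?h has_real_derivative A + B * off_ind y c r - s * D) (at r)"
        by (intro DERIV_diff DERIV_add)
      moreover have "0 \<le> A + B * off_ind y c r - s * D" using D(2) s by auto
      ultimately show "\<exists>D\<ge>0. (?h has_real_derivative D) (at r)" by blast
    qed
    then show ?thesis by simp
  qed
  from this[of 1] this[of "-1"] show ?thesis by (simp add: abs_le_iff)
qed

primrec grid :: "(real \<Rightarrow> 'c) \<Rightarrow> real \<Rightarrow> nat \<Rightarrow> 'c list" where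
  "grid y h 0 = [y 0]"
| "grid y h (Suc k) = y (real (Suc k) * h) # grid y h k"

text \<open>Total time during which \<open>y\<close> differs from its value at the right end of the
  current mesh cell, the value that the Euler scheme uses throughout the cell.\<close>

definition mesh_defect :: "(real \<Rightarrow> 'c) \<Rightarrow> real \<Rightarrow> nat \<Rightarrow> real" where
  "mesh_defect y h k = (\<Sum>i<k. integral {real i * h..real (Suc i) * h} (off_ind y (y (real (Suc i) * h))))"

lemma mesh_defect_has_integral:
  fixes y :: "real \<Rightarrow> 'c::countable"
  assumes y: "right_constant y" and h: "0 < h"
  shows "((\<lambda>r. off_ind y (y (of_int \<lceil>r / h\<rceil> * h)) r) has_integral mesh_defect y h k) {0..real k * h}"
proof (induction k)
  case 0
  then show ?case by (simp add: mesh_defect_def has_integral_refl)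
next
  case (Suc k)
  let ?a = "real k * h" and ?b = "real (Suc k) * h"
  have "(off_ind y (y ?b) has_integral integral {?a..?b} (off_ind y (y ?b))) (cbox ?a ?b)"
    using off_ind_integrable[OF y, of ?a "y ?b" ?b] h by (simp add: has_integral_integral)
  then have "((\<lambda>r. off_ind y (y (of_int \<lceil>r / h\<rceil> * h)) r) has_integral integral {?a..?b} (off_ind y (y ?b))) (cbox ?a ?b)"
  proof (rule has_integral_spike_interior)
    fix r assume "r \<in> box ?a ?b"
    then have r: "?a < r" "r < ?b" by auto
    then have "real k < r / h" "r / h < real (Suc k)"
      using h by (simp_all only: pos_less_divide_eq pos_divide_less_eq)
    then have "\<lceil>r / h\<rceil> = int (Suc k)" by linarith
    then show "off_ind y (y (of_int \<lceil>r / h\<rceil> * h)) r = off_ind y (y ?b) r"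
      by (simp only: of_int_of_nat_eq)
  qed
  with Suc show ?case
    unfolding mesh_defect_def sum.lessThan_Suc using h
    by (intro has_integral_combine[where c = ?a]) (auto intro: mult_right_mono)
qed

text \<open>The right end of the cell of \<open>r\<close> lies between \<open>r\<close> and
  \<open>r + h\<close>, where \<open>y\<close> is constant for small \<open>h\<close> by
  right-constancy. So the integrand is eventually 0 at every \<open>r\<close>, and dominated
  convergence applies.\<close>

lemma mesh_defect_tendsto_0:
  fixes y :: "real \<Rightarrow> 'c::countable"
  assumes y: "right_constant y" and t: "0 < t"
  shows "(\<lambda>N. mesh_defect y (t / real (Suc N)) (Suc N)) \<longlonglongrightarrow> 0"
proof -
  define h where "h N = t / real (Suc N)" for N
  have h: "0 < h N" for N using t by (simp add: h_def)
  let ?f = "\<lambda>N r. off_ind y (y (of_int \<lceil>r / h N\<rceil> * h N)) r"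
  have hi: "(?f N has_integral mesh_defect y (h N) (Suc N)) {0..t}" for N
    using mesh_defect_has_integral[OF y h[of N], of "Suc N"] by (simp add: h_def)
  have "(\<lambda>N. integral {0..t} (?f N)) \<longlonglongrightarrow> integral {0..t} (\<lambda>_. 0)"
  proof (rule dominated_convergence(2)[where h = "\<lambda>_. 1"])
    show "?f N integrable_on {0..t}" for N using hi by blast
    show "norm (?f N r) \<le> 1" for N r by (simp add: off_ind_def)
    show "(\<lambda>N. ?f N r) \<longlonglongrightarrow> 0" if r: "r \<in> {0..t}" for r
    proof -
      from r have "\<forall>\<^sub>F s in at_right r. y s = y r" using y by (simp add: right_constant_def)
      then obtain b where b: "r < b" "\<And>s. r < s \<Longrightarrow> s < b \<Longrightarrow> y s = y r"
        unfolding eventually_at_right_field by blast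
      have "h \<longlonglongrightarrow> 0" unfolding h_def by real_asymp
      then have "\<forall>\<^sub>F N in sequentially. h N < b - r"
        using b(1) by (intro order_tendstoD(2)[of _ 0]) auto
      then have "\<forall>\<^sub>F N in sequentially. ?f N r = 0"
      proof eventually_elim
        case (elim N)
        let ?s = "of_int \<lceil>r / h N\<rceil> * h N"
        have "r / h N \<le> of_int \<lceil>r / h N\<rceil>" by simp
        then have 1: "r \<le> ?s" using h[of N] by (simp only: pos_divide_le_eq)
        have "of_int \<lceil>r / h N\<rceil> < r / h N + 1" by linarith
        then have "?s < (r / h N + 1) * h N" using h[of N] by (intro mult_strict_right_mono)
        also have "\<dots> = r + h N" using h[of N] by (simp add: algebra_simps)
        finally have "?s < b" using elim by simp
        then have "y ?s = y r" using 1 b(2)[of ?s] by (cases "?s = r") auto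
        then show ?case by (simp add: off_ind_def)
      qed
      then show "(\<lambda>N. ?f N r) \<longlonglongrightarrow> 0" by (rule tendsto_eventually)
    qed
  qed auto
  moreover have "integral {0..t} (?f N) = mesh_defect y (h N) (Suc N)" for N
    using hi by (rule integral_unique)
  ultimately show ?thesis by (simp add: h_def)
qed

text \<open>A walk of the same rate is added because the properties of \<open>heat\<close> are
  derived from one.\<close>

locale soft_trap_walk = soft_trap \<kappa> \<gamma> y u + lattice_walk M \<kappa> x\<^sub>0 X
  for \<kappa> \<gamma> :: real and y :: "real \<Rightarrow> int ^ 'd" and u :: "real \<Rightarrow> int ^ 'd \<Rightarrow> real"
    and M :: "'a measure" and x\<^sub>0 :: "int ^ 'd" and X
begin

lemma abs_u_le_1: "0 \<le> t \<Longrightarrow> \<bar>u t x\<bar> \<le> 1"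
  using u_nonneg[of t x] u_le_1[of t x] by simp

definition lip :: real where "lip = 2 * d\<kappa> + \<bar>\<gamma>\<bar>"

lemma lip_nonneg: "0 \<le> lip" using d\<kappa>_pos by (simp add: lip_def)

lemma abs_rate_laplacian_le:
  assumes "\<And>x. \<bar>f x\<bar> \<le> B"
  shows "\<bar>\<kappa> * laplacian f (x :: int ^ 'd)\<bar> \<le> 2 * d\<kappa> * B"
  using mult_left_mono[OF abs_laplacian_le[of f B x, OF assms], of \<kappa>] \<kappa>
  by (simp add: abs_mult d\<kappa>_def mult_ac)

lemma u_lipschitz:
  assumes "0 \<le> a" "a \<le> b"
  shows "\<bar>u b x - u a x\<bar> \<le> lip * (b - a)"
proof -
  \<comment> \<open>\<open>increment_bound\<close> with coefficient 0, for which the reference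
    position \<open>y 0\<close> is arbitrary.\<close>
  have "\<bar>u b x - u a x\<bar> \<le> lip * (b - a) + 0 * integral {a..b} (off_ind y (y 0))"
  proof (rule increment_bound[OF y assms u_cont[OF assms(1)]])
    fix r assume r: "a < r" "r \<notin> jumps y"
    have r0: "0 < r" using r assms by simp
    have "\<bar>\<kappa> * laplacian (u r) x\<bar> \<le> 2 * d\<kappa> * 1"
      using r0 by (intro abs_rate_laplacian_le abs_u_le_1) simp
    moreover have "\<bar>\<xi> r x * u r x\<bar> \<le> \<bar>\<gamma>\<bar> * 1"
      unfolding abs_mult using \<xi>_bounds[of r x] abs_u_le_1[of r x] r0 by (intro mult_mono) auto
    ultimately have "\<bar>\<kappa> * laplacian (u r) x + \<xi> r x * u r x\<bar> \<le> lip + 0 * off_ind y (y 0) r"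
      unfolding lip_def by linarith
    then show "\<exists>D. ((\<lambda>r. u r x) has_real_derivative D) (at r) \<and> \<bar>D\<bar> \<le> lip + 0 * off_ind y (y 0) r"
      using u_deriv[OF r0 r(2)] by blast
  qed
  then show ?thesis by simp
qed

lemma laplacian_diff: "laplacian (\<lambda>x. f x - g x) x = laplacian f x - laplacian g (x :: int ^ 'd)"
  by (simp add: laplacian_eq sum_subtractf[symmetric] algebra_simps)

text \<open>Collects the errors of one step: \<open>lip\<^sup>2\<close> from freezing the right-hand
  side of the equation, the middle term from \<open>heat_laplacian_bound\<close>, once plain and
  once multiplied by the trap, and the last from the trap acting on the change made by the heat
  step.\<close>

definition step_const :: real where
  "step_const = lip\<^sup>2 + (1 + \<bar>\<gamma>\<bar>) * (32 * (CARD('d) + 1) * (CARD('d) * \<kappa>)\<^sup>2) + \<bar>\<gamma>\<bar> * (2 * d\<kappa>)"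

lemma one_step_error:
  assumes ab: "0 \<le> a" "a \<le> b" "b - a \<le> 1"
  shows "\<bar>u b x - (if x = y b then 1 + \<gamma> * (b - a) else 1) * heat (\<kappa> * (b - a)) (u a) x\<bar>
    \<le> step_const * (b - a)\<^sup>2 + \<bar>\<gamma>\<bar> * integral {a..b} (off_ind y (y b))"
proof -
  define h where "h = b - a"
  define g where "g = (if x = y b then \<gamma> else 0)"
  define F where "F = heat (\<kappa> * h) (u a) x"
  define U where "U = u a x"
  define \<Lambda> where "\<Lambda> = \<kappa> * laplacian (u a) x"
  define K where "K = 32 * (CARD('d) + 1) * (CARD('d) * \<kappa>)\<^sup>2"
  have h: "0 \<le> h" "h \<le> 1" using ab by (auto simp: h_def)
  have K: "0 \<le> K" by (simp add: K_def)
  have gabs: "\<bar>g\<bar> \<le> \<bar>\<gamma>\<bar>" by (simp add: g_def)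
  have b0: "0 \<le> b" using ab by simp
  have ua: "\<bar>u a z\<bar> \<le> 1" for z using ab by (intro abs_u_le_1)
  \<comment> \<open>The derivative is compared with its form frozen at time \<open>a\<close>, but
    with the trap already at its position at time \<open>b\<close>; subtracting a linear function
    turns the comparison into an increment.\<close>
  have "\<bar>(u b x - b * (\<Lambda> + g * U)) - (u a x - a * (\<Lambda> + g * U))\<bar> \<le> (lip * lip * h) * (b - a) + \<bar>\<gamma>\<bar> * integral {a..b} (off_ind y (y b))"
  proof (rule increment_bound[OF y ab(1,2)])
    show "continuous_on {a..b} (\<lambda>r. u r x - r * (\<Lambda> + g * U))"
      by (intro continuous_intros u_cont ab)
    fix r assume r: "a < r" "r < b" "r \<notin> jumps y"
    have r0: "0 < r" using r ab by simp
    let ?D = "\<kappa> * laplacian (u r) x + \<xi> r x * u r x - (\<Lambda> + g * U)"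
    have "((\<lambda>r. r * (\<Lambda> + g * U)) has_real_derivative \<Lambda> + g * U) (at r)"
      by (auto intro!: derivative_eq_intros)
    then have "((\<lambda>r. u r x - r * (\<Lambda> + g * U)) has_real_derivative ?D) (at r)"
      by (rule DERIV_diff[OF u_deriv[OF r0 r(3)]])
    moreover have lip_r: "\<bar>u r z - u a z\<bar> \<le> lip * h" for z
    proof -
      have "\<bar>u r z - u a z\<bar> \<le> lip * (r - a)" using r ab by (intro u_lipschitz) auto
      also have "\<dots> \<le> lip * h" using r lip_nonneg by (intro mult_left_mono) (auto simp: h_def)
      finally show ?thesis .
    qed
    have "\<bar>\<kappa> * laplacian (u r) x - \<Lambda>\<bar> \<le> 2 * d\<kappa> * (lip * h)"
      using abs_rate_laplacian_le[of "\<lambda>z. u r z - u a z" "lip * h" x, OF lip_r]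
      by (simp add: laplacian_diff \<Lambda>_def right_diff_distrib)
    moreover have "\<bar>\<xi> r x * u r x - g * U\<bar> \<le> \<bar>\<gamma>\<bar> * (lip * h) + \<bar>\<gamma>\<bar> * off_ind y (y b) r"
    proof (cases "y r = y b")
      case True
      then have "\<xi> r x * u r x - g * U = g * (u r x - u a x)"
        by (simp add: \<xi>_def g_def U_def right_diff_distrib)
      then have "\<bar>\<xi> r x * u r x - g * U\<bar> = \<bar>g\<bar> * \<bar>u r x - u a x\<bar>" by (simp add: abs_mult)
      also have "\<dots> \<le> \<bar>\<gamma>\<bar> * (lip * h)" by (intro mult_mono gabs lip_r) auto
      finally show ?thesis using True by (simp add: off_ind_def)
    next
      case False
      \<comment> \<open>The trap is not where it is at time \<open>b\<close>; both potential terms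
        lie between \<gamma> and 0, so they differ by at most the absolute value of
        \<gamma>.\<close>
      have bnd: "\<gamma> * 1 \<le> c * w \<and> c * w \<le> 0" if "\<gamma> \<le> c" "c \<le> 0" "0 \<le> w" "w \<le> 1" for c w
      proof
        have "(- c) * w \<le> (- \<gamma>) * 1" using that by (intro mult_mono) auto
        then show "\<gamma> * 1 \<le> c * w" by simp
        show "c * w \<le> 0" using that by (intro mult_nonpos_nonneg)
      qed
      have "\<gamma> * 1 \<le> \<xi> r x * u r x \<and> \<xi> r x * u r x \<le> 0"
        using r0 by (intro bnd \<xi>_bounds u_nonneg u_le_1) auto
      moreover have "\<gamma> * 1 \<le> g * U \<and> g * U \<le> 0"
        unfolding U_def using ab \<gamma> by (intro bnd u_nonneg u_le_1) (auto simp: g_def)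
      ultimately have "\<bar>\<xi> r x * u r x - g * U\<bar> \<le> \<bar>\<gamma>\<bar>" using \<gamma> by linarith
      moreover have "0 \<le> \<bar>\<gamma>\<bar> * (lip * h)" using lip_nonneg h by simp
      ultimately show ?thesis using False by (simp add: off_ind_def)
    qed
    moreover have "lip * lip * h = 2 * d\<kappa> * (lip * h) + \<bar>\<gamma>\<bar> * (lip * h)"
      by (subst lip_def) (simp only: distrib_right mult.assoc)
    ultimately show "\<exists>D. ((\<lambda>r. u r x - r * (\<Lambda> + g * U)) has_real_derivative D) (at r) \<and>
        \<bar>D\<bar> \<le> lip * lip * h + \<bar>\<gamma>\<bar> * off_ind y (y b) r"
      by (intro exI[of _ ?D] conjI) (assumption, linarith)
  qed
  then have 1: "\<bar>u b x - U - h * (\<Lambda> + g * U)\<bar> \<le> lip\<^sup>2 * h\<^sup>2 + \<bar>\<gamma>\<bar> * integral {a..b} (off_ind y (y b))"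
    by (simp add: h_def U_def power2_eq_square algebra_simps)
  have 2: "\<bar>F - U - h * \<Lambda>\<bar> \<le> K * h\<^sup>2"
    using heat_laplacian_bound[of "\<kappa> * h" "u a" x, OF _ ua] \<kappa> h
    by (simp add: F_def U_def \<Lambda>_def K_def power_mult_distrib mult_ac)
  have L: "\<bar>\<Lambda>\<bar> \<le> 2 * d\<kappa>" unfolding \<Lambda>_def using abs_rate_laplacian_le[of "u a" 1 x, OF ua] by simp
  have "h\<^sup>2 \<le> h * 1" unfolding power2_eq_square using h by (intro mult_left_mono) auto
  then have "K * h\<^sup>2 \<le> K * h" using K by (intro mult_left_mono) auto
  moreover have "\<bar>h * \<Lambda>\<bar> \<le> h * (2 * d\<kappa>)" using L h by (simp add: abs_mult mult_left_mono)
  ultimately have FU: "\<bar>F - U\<bar> \<le> (K + 2 * d\<kappa>) * h"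
    using 2 by (simp add: algebra_simps)
  have "\<bar>g * h * (F - U)\<bar> \<le> \<bar>\<gamma>\<bar> * h * ((K + 2 * d\<kappa>) * h)"
    unfolding abs_mult using gabs h FU by (intro mult_mono) auto
  then have 3: "\<bar>g * h * (F - U)\<bar> \<le> \<bar>\<gamma>\<bar> * (K + 2 * d\<kappa>) * h\<^sup>2"
    by (simp add: power2_eq_square mult_ac)
  have "u b x - (1 + g * h) * F = (u b x - U - h * (\<Lambda> + g * U)) - (F - U - h * \<Lambda>) - g * h * (F - U)"
    by (simp add: algebra_simps)
  then have "\<bar>u b x - (1 + g * h) * F\<bar> \<le> lip\<^sup>2 * h\<^sup>2 + \<bar>\<gamma>\<bar> * integral {a..b} (off_ind y (y b)) + K * h\<^sup>2 + \<bar>\<gamma>\<bar> * (K + 2 * d\<kappa>) * h\<^sup>2"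
    using 1 2 3 by linarith
  also have "\<dots> = step_const * h\<^sup>2 + \<bar>\<gamma>\<bar> * integral {a..b} (off_ind y (y b))"
  proof -
    have "step_const = lip\<^sup>2 + (1 + \<bar>\<gamma>\<bar>) * K + \<bar>\<gamma>\<bar> * (2 * d\<kappa>)"
      by (simp only: step_const_def K_def)
    then show ?thesis by (simp add: algebra_simps)
  qed
  also have "1 + g * h = (if x = y b then 1 + \<gamma> * h else 1)" by (simp add: g_def)
  finally show ?thesis by (simp only: F_def h_def)
qed

text \<open>Errors add up without amplification, since \<open>heat\<close> and multiplication by a
  trap factor in \<open>[0, 1]\<close> are contractions. The first term stems from the trap factor
  at time 0, which \<open>grid\<close> includes and the solution does not.\<close>

lemma grid_error:
  assumes h: "0 < h" "h \<le> 1" "0 \<le> 1 + \<gamma> * h"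
  shows "\<bar>u (real k * h) x - surv (\<kappa> * h) (1 + \<gamma> * h) (grid y h k) x\<bar>
    \<le> \<bar>\<gamma>\<bar> * h + real k * (step_const * h\<^sup>2) + \<bar>\<gamma>\<bar> * mesh_defect y h k"
proof (induction k arbitrary: x)
  case 0
  then show ?case using h by (simp add: u_0 mesh_defect_def heat_def abs_mult)
next
  case (Suc k)
  let ?a = "real k * h" and ?b = "real (Suc k) * h" and ?c = "1 + \<gamma> * h"
  let ?s = "surv (\<kappa> * h) ?c (grid y h k)"
  let ?E = "\<bar>\<gamma>\<bar> * h + real k * (step_const * h\<^sup>2) + \<bar>\<gamma>\<bar> * mesh_defect y h k"
  have c: "?c \<le> 1" using \<gamma> h by (simp add: mult_nonpos_nonneg)
  have a0: "0 \<le> ?a" using h by simp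
  have ba: "?b - ?a = h" by (simp add: algebra_simps)
  have 1: "\<bar>u ?b x - (if x = y ?b then ?c else 1) * heat (\<kappa> * h) (u ?a) x\<bar>
     \<le> step_const * h\<^sup>2 + \<bar>\<gamma>\<bar> * integral {?a..?b} (off_ind y (y ?b))"
    using one_step_error[of ?a ?b x] a0 ba h by (simp only: ba) (simp add: algebra_simps)
  have "heat (\<kappa> * h) (u ?a) x - heat (\<kappa> * h) ?s x = heat (\<kappa> * h) (\<lambda>x. u ?a x - ?s x) x"
    by (rule heat_diff_fun[symmetric, where B = 1 and B' = 1])
       (auto intro: abs_u_le_1 a0 abs_surv_le h(3) c)
  also have "\<bar>\<dots>\<bar> \<le> ?E" by (rule abs_heat_le) (rule Suc)
  finally have 2: "\<bar>heat (\<kappa> * h) (u ?a) x - heat (\<kappa> * h) ?s x\<bar> \<le> ?E" .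
  have "\<bar>(if x = y ?b then ?c else 1) * (heat (\<kappa> * h) (u ?a) x - heat (\<kappa> * h) ?s x)\<bar> \<le> 1 * ?E"
    unfolding abs_mult using h(3) c 2 by (intro mult_mono) auto
  then have 3: "\<bar>(if x = y ?b then ?c else 1) * heat (\<kappa> * h) (u ?a) x - (if x = y ?b then ?c else 1) * heat (\<kappa> * h) ?s x\<bar> \<le> ?E"
    by (simp only: right_diff_distrib mult_1)
  have "\<bar>u ?b x - (if x = y ?b then ?c else 1) * heat (\<kappa> * h) ?s x\<bar>
     \<le> (step_const * h\<^sup>2 + \<bar>\<gamma>\<bar> * integral {?a..?b} (off_ind y (y ?b))) + ?E"
    using 1 3 by linarith
  also have "\<dots> = \<bar>\<gamma>\<bar> * h + real (Suc k) * (step_const * h\<^sup>2) + \<bar>\<gamma>\<bar> * mesh_defect y h (Suc k)"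
    by (simp add: mesh_defect_def algebra_simps)
  finally show ?case by simp
qed

text \<open>As many errors of order \<open>h\<^sup>2\<close> as there are steps of length
  \<open>h\<close> in \<open>t\<close> add up to order \<open>h\<close>, and the defect of the mesh
  vanishes too.\<close>

lemma surv_grid_tendsto:
  assumes t: "0 < t"
  shows "(\<lambda>N. surv (\<kappa> * (t / real (Suc N))) (1 + \<gamma> * (t / real (Suc N))) (grid y (t / real (Suc N)) (Suc N)) x)
    \<longlonglongrightarrow> u t x"
proof -
  let ?h = "\<lambda>N. t / real (Suc N)"
  have lim: "?h \<longlonglongrightarrow> 0" by real_asymp
  have ev1: "\<forall>\<^sub>F N in sequentially. ?h N < 1"
    by (rule order_tendstoD(2)[OF lim]) simp
  have ev2: "\<forall>\<^sub>F N in sequentially. ?h N < 1 / \<bar>\<gamma>\<bar>"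
    by (rule order_tendstoD(2)[OF lim]) (use \<gamma> in simp)
  have "\<forall>\<^sub>F N in sequentially. \<bar>surv (\<kappa> * ?h N) (1 + \<gamma> * ?h N) (grid y (?h N) (Suc N)) x - u t x\<bar>
     \<le> \<bar>\<gamma>\<bar> * ?h N + t * step_const * ?h N + \<bar>\<gamma>\<bar> * mesh_defect y (?h N) (Suc N)"
    using ev1 ev2
  proof eventually_elim
    case (elim N)
    have "0 \<le> 1 + \<gamma> * ?h N" using elim(2) \<gamma> by (simp add: field_simps)
    moreover have "0 < ?h N" using t by simp
    moreover have "real (Suc N) * ?h N = t" by simp
    moreover have "real (Suc N) * (step_const * (?h N)\<^sup>2) = t * step_const * ?h N"
      by (simp add: power2_eq_square del: of_nat_Suc)
    ultimately show ?case
      using grid_error[of "?h N" "Suc N" x] elim(1) by (simp only: abs_minus_commute)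
  qed
  moreover have "(\<lambda>N. \<bar>\<gamma>\<bar> * ?h N + t * step_const * ?h N + \<bar>\<gamma>\<bar> * mesh_defect y (?h N) (Suc N)) \<longlonglongrightarrow> 0"
    using tendsto_add[OF tendsto_add[OF tendsto_mult_right_zero[OF lim, of "\<bar>\<gamma>\<bar>"] tendsto_mult_right_zero[OF lim, of "t * step_const"]]
      tendsto_mult_right_zero[OF mesh_defect_tendsto_0[OF y t], of "\<bar>\<gamma>\<bar>"]] by simp
  ultimately have "(\<lambda>N. surv (\<kappa> * ?h N) (1 + \<gamma> * ?h N) (grid y (?h N) (Suc N)) x - u t x) \<longlonglongrightarrow> 0"
    unfolding real_norm_def[symmetric] by (rule Lim_null_comparison)
  then show ?thesis by (rule LIM_zero_cancel)
qed

end

section \<open>Laws of grid paths\<close>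

lemma length_grid [simp]: "length (grid y h n) = Suc n"
  by (induction n) auto

lemma nth_grid: "i \<le> n \<Longrightarrow> grid y h n ! i = y (real (n - i) * h)"
proof (induction n arbitrary: i)
  case (Suc n)
  then show ?case by (cases i) (auto simp del: of_nat_Suc)
qed simp

lemma grid_eq_iff:
  "grid y h n = zs \<longleftrightarrow> length zs = Suc n \<and> (\<forall>i\<le>n. y (real i * h) = zs ! (n - i))"
proof
  assume "grid y h n = zs"
  then show "length zs = Suc n \<and> (\<forall>i\<le>n. y (real i * h) = zs ! (n - i))"
    by (auto simp: nth_grid)
next
  assume zs: "length zs = Suc n \<and> (\<forall>i\<le>n. y (real i * h) = zs ! (n - i))"
  show "grid y h n = zs"
  proof (rule nth_equalityI)
    fix i assume "i < length (grid y h n)"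
    then have i: "i \<le> n" by simp
    then have "y (real (n - i) * h) = zs ! (n - (n - i))" using zs by (meson diff_le_self)
    then show "grid y h n ! i = zs ! i" using i by (simp add: nth_grid)
  qed (use zs in simp)
qed

text \<open>Paths of \<open>X\<close> in chronological order, in contrast to
  \<open>path_pmf\<close>: \<open>X\<close> runs forwards while \<open>Y\<close> is read backwards,
  so the two lists are compared index by index.\<close>

primrec fpath_pmf :: "real \<Rightarrow> nat \<Rightarrow> int ^ 'd \<Rightarrow> (int ^ 'd) list pmf" where
  "fpath_pmf \<tau> 0 x = return_pmf [x]"
| "fpath_pmf \<tau> (Suc n) x = bind_pmf (step \<tau>) (\<lambda>s. map_pmf ((#) x) (fpath_pmf \<tau> n (x + s)))"

lemma prob_fpath_pmf_avoid:
  assumes "length ys = Suc n"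
  shows "measure_pmf.prob (fpath_pmf \<tau> n x) {l. \<forall>j\<le>n. l ! j \<noteq> ys ! j} = surv \<tau> 0 ys x"
  using assms
proof (induction n arbitrary: ys x)
  case 0
  then obtain y where "ys = [y]" by (cases ys) auto
  then show ?case by (simp add: heat_def)
next
  case (Suc n)
  then obtain y ys' where ys: "ys = y # ys'" "length ys' = Suc n" by (cases ys) auto
  have all: "(\<forall>j\<le>Suc n. P j) \<longleftrightarrow> P 0 \<and> (\<forall>j\<le>n. P (Suc j))" for P
    by (metis Suc_le_mono le0 not0_implies_Suc)
  have "measure_pmf.prob (fpath_pmf \<tau> (Suc n) x) {l. \<forall>j\<le>Suc n. l ! j \<noteq> ys ! j} =
     measure_pmf.expectation (fpath_pmf \<tau> (Suc n) x) (indicat_real {l. \<forall>j\<le>Suc n. l ! j \<noteq> ys ! j})"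
    by simp
  also have "\<dots> = measure_pmf.expectation (step \<tau>) (\<lambda>s. measure_pmf.expectation (map_pmf ((#) x) (fpath_pmf \<tau> n (x + s)))
      (indicat_real {l. \<forall>j\<le>Suc n. l ! j \<noteq> ys ! j}))"
    unfolding fpath_pmf.simps by (rule integral_bind_pmf_bounded[where B = 1]) (simp add: indicator_def)
  also have "\<dots> = measure_pmf.expectation (step \<tau>) (\<lambda>s. (if x = y then 0 else 1) * surv \<tau> 0 ys' (x + s))"
  proof (rule Bochner_Integration.integral_cong[OF refl])
    fix s
    have "measure_pmf.expectation (map_pmf ((#) x) (fpath_pmf \<tau> n (x + s))) (indicat_real {l. \<forall>j\<le>Suc n. l ! j \<noteq> ys ! j})
       = measure_pmf.expectation (fpath_pmf \<tau> n (x + s)) (\<lambda>l. (if x = y then 0 else 1) * indicat_real {l. \<forall>j\<le>n. l ! j \<noteq> ys' ! j} l)"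
      unfolding integral_map_pmf
      by (rule Bochner_Integration.integral_cong[OF refl]) (simp add: indicator_def all ys)
    also have "\<dots> = (if x = y then 0 else 1) * surv \<tau> 0 ys' (x + s)"
      by (simp add: Suc.IH[OF ys(2)])
    finally show "measure_pmf.expectation (map_pmf ((#) x) (fpath_pmf \<tau> n (x + s))) (indicat_real {l. \<forall>j\<le>Suc n. l ! j \<noteq> ys ! j})
       = (if x = y then 0 else 1) * surv \<tau> 0 ys' (x + s)" .
  qed
  also have "\<dots> = surv \<tau> 0 ys x" by (simp add: ys heat_def)
  finally show ?case .
qed

context lattice_walk
begin

lemma pmf_path_pmf_Cons:
  assumes "0 \<le> r"
  shows "pmf (path_pmf r (Suc n)) (z # zs) = pmf (path_pmf r n) zs * kern r (z - hd zs :: int ^ 'd)"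
proof -
  have "pmf (map_pmf (\<lambda>s. (hd ys + s) # ys) (step r)) (z # zs) = kern r (z - hd zs) * indicator {zs} ys" for ys
  proof (cases "ys = zs")
    case True
    have "inj (\<lambda>s. (hd ys + s) # ys)" by (auto simp: inj_def)
    from pmf_map_inj'[OF this, of "step r" "z - hd ys"] True assms
    show ?thesis by (simp add: pmf_step)
  next
    case False
    then have "z # zs \<notin> (\<lambda>s. (hd ys + s) # ys) ` set_pmf (step r)" by auto
    with False show ?thesis by (simp add: pmf_map_outside)
  qed
  then show ?thesis
    by (simp add: pmf_bind measure_pmf_single)
qed

lemma pmf_path_pmf:
  assumes "0 \<le> r"
  shows "pmf (path_pmf r n) zs = (if length zs = Suc n \<and> zs ! n = (0 :: int ^ 'd)
    then \<Prod>i<n. kern r (zs ! (n - Suc i) - zs ! (n - i)) else 0)"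
proof (induction n arbitrary: zs)
  case 0
  show ?case by (cases zs) (auto simp: indicator_def)
next
  case (Suc n)
  show ?case
  proof (cases zs)
    case Nil
    have "[] \<notin> set_pmf (path_pmf r (Suc n) :: (int ^ 'd) list pmf)" by auto
    then have "pmf (path_pmf r (Suc n) :: (int ^ 'd) list pmf) [] = 0"
      by (rule pmf_eq_0_set_pmf[THEN iffD2])
    then show ?thesis using Nil by (simp del: path_pmf.simps)
  next
    case (Cons z zs')
    have "(\<Prod>i<n. kern r (zs ! (Suc n - Suc i) - zs ! (Suc n - i))) = (\<Prod>i<n. kern r (zs' ! (n - Suc i) - zs' ! (n - i)))"
      by (rule prod.cong) (auto simp: Cons Suc_diff_le Suc_diff_Suc nth_Cons' )
    moreover have "length zs' = Suc n \<Longrightarrow> zs' ! 0 = hd zs'" by (cases zs') auto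
    ultimately show ?thesis
      unfolding Cons pmf_path_pmf_Cons[OF assms] Suc.IH by (auto simp: Cons)
  qed
qed

lemma pmf_fpath_pmf:
  assumes "0 \<le> \<tau>"
  shows "pmf (fpath_pmf \<tau> n x) zs = (if length zs = Suc n \<and> zs ! 0 = (x :: int ^ 'd)
    then \<Prod>i<n. kern \<tau> (zs ! Suc i - zs ! i) else 0)"
proof (induction n arbitrary: x zs)
  case 0
  show ?case by (cases zs) (auto simp: indicator_def)
next
  case (Suc n)
  show ?case
  proof (cases zs)
    case Nil
    have "[] \<notin> set_pmf (fpath_pmf \<tau> (Suc n) x)" by auto
    then have "pmf (fpath_pmf \<tau> (Suc n) x) [] = 0"
      by (rule pmf_eq_0_set_pmf[THEN iffD2])
    then show ?thesis using Nil by (simp del: fpath_pmf.simps)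
  next
    case (Cons z zs')
    let ?c = "if z = x \<and> length zs' = Suc n then \<Prod>i<n. kern \<tau> (zs' ! Suc i - zs' ! i) else 0"
    have "pmf (map_pmf ((#) x) (fpath_pmf \<tau> n (x + s))) (z # zs') = ?c * indicator {zs' ! 0 - x} s" for s
    proof (cases "z = x")
      case True
      have "inj ((#) x)" by (auto simp: inj_def)
      from pmf_map_inj'[OF this, of "fpath_pmf \<tau> n (x + s)" zs'] True
      show ?thesis by (auto simp: Suc.IH indicator_def)
    next
      case False
      then have "z # zs' \<notin> (#) x ` set_pmf (fpath_pmf \<tau> n (x + s))" by auto
      with False show ?thesis by (simp add: pmf_map_outside)
    qed
    then have "pmf (fpath_pmf \<tau> (Suc n) x) zs = ?c * kern \<tau> (zs' ! 0 - x)"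
      using assms by (simp add: Cons pmf_bind measure_pmf_single pmf_step)
    then show ?thesis by (auto simp: Cons prod.lessThan_Suc_shift simp del: prod.lessThan_Suc)
  qed
qed

lemma measure_uniform_grid:
  assumes h: "0 \<le> h"
  shows "prob {\<omega> \<in> space M. \<forall>i\<le>n. X (real i * h) \<omega> = z i} =
    (if z 0 = x\<^sub>0 then \<Prod>i<n. kern (\<kappa> * h) (z (Suc i) - z i) else 0)"
proof (cases "z 0 = x\<^sub>0")
  case True
  have "prob {\<omega> \<in> space M. \<forall>i\<le>n. X (real i * h) \<omega> = z i} =
     (\<Prod>i<n. kern (\<kappa> * (real (Suc i) * h - real i * h)) (z (Suc i) - z i))"
    by (rule measure_fdd) (use h True in \<open>auto intro: mult_right_mono\<close>)
  then show ?thesis using True by (simp add: algebra_simps)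
next
  case False
  have "prob {\<omega> \<in> space M. \<forall>i\<le>n. X (real i * h) \<omega> = z i} = prob {}"
  proof (rule measure_eq_AE)
    show "AE \<omega> in M. (\<omega> \<in> {\<omega> \<in> space M. \<forall>i\<le>n. X (real i * h) \<omega> = z i}) = (\<omega> \<in> {})"
      using AE_start
    proof eventually_elim
      case (elim \<omega>)
      then show ?case using False by (auto dest: spec[of _ 0])
    qed
    have [measurable]: "X (real i * h) \<in> M \<rightarrow>\<^sub>M count_space UNIV" for i
      using h by (intro measurable_walk) simp
    show "{\<omega> \<in> space M. \<forall>i\<le>n. X (real i * h) \<omega> = z i} \<in> events"
      by measurable
  qed auto
  then show ?thesis using False by simp
qed

lemma distr_grid:
  assumes h: "0 \<le> h" and x\<^sub>0: "x\<^sub>0 = 0"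
  shows "(\<lambda>\<omega>. grid (\<lambda>t. X t \<omega>) h n) \<in> M \<rightarrow>\<^sub>M count_space UNIV"
    and "distr M (count_space UNIV) (\<lambda>\<omega>. grid (\<lambda>t. X t \<omega>) h n) = measure_pmf (path_pmf (\<kappa> * h) n)"
proof -
  have [measurable]: "X (real i * h) \<in> M \<rightarrow>\<^sub>M count_space UNIV" for i
    using h by (intro measurable_walk) simp
  have sets: "{\<omega> \<in> space M. grid (\<lambda>t. X t \<omega>) h n = zs} \<in> events" for zs
    unfolding grid_eq_iff by measurable
  show meas: "(\<lambda>\<omega>. grid (\<lambda>t. X t \<omega>) h n) \<in> M \<rightarrow>\<^sub>M count_space UNIV"
    unfolding measurable_count_space_eq2_countable
    using sets by (simp add: vimage_def Int_def conj_commute)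
  show "distr M (count_space UNIV) (\<lambda>\<omega>. grid (\<lambda>t. X t \<omega>) h n) = measure_pmf (path_pmf (\<kappa> * h) n)"
  proof (rule measure_eqI_countable[where A = UNIV])
    fix zs :: "(int ^ 'd) list"
    have "emeasure (distr M (count_space UNIV) (\<lambda>\<omega>. grid (\<lambda>t. X t \<omega>) h n)) {zs}
        = prob {\<omega> \<in> space M. grid (\<lambda>t. X t \<omega>) h n = zs}"
      using meas by (simp add: emeasure_distr emeasure_eq_measure vimage_def Int_def conj_commute)
    also have "prob {\<omega> \<in> space M. grid (\<lambda>t. X t \<omega>) h n = zs} = pmf (path_pmf (\<kappa> * h) n) zs"
    proof (cases "length zs = Suc n")
      case True
      have "prob {\<omega> \<in> space M. grid (\<lambda>t. X t \<omega>) h n = zs} =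
        prob {\<omega> \<in> space M. \<forall>i\<le>n. X (real i * h) \<omega> = zs ! (n - i)}"
        using True by (simp add: grid_eq_iff)
      also have "\<dots> = pmf (path_pmf (\<kappa> * h) n) zs"
        using True h rate_pos x\<^sub>0 by (subst measure_uniform_grid[OF h]) (simp add: pmf_path_pmf)
      finally show ?thesis .
    next
      case False
      then show ?thesis using h rate_pos by (simp add: grid_eq_iff pmf_path_pmf)
    qed
    finally show "emeasure (distr M (count_space UNIV) (\<lambda>\<omega>. grid (\<lambda>t. X t \<omega>) h n)) {zs}
        = emeasure (measure_pmf (path_pmf (\<kappa> * h) n)) {zs}"
      by (simp add: emeasure_pmf_single)
  qed auto
qed

text \<open>The positions of \<open>X\<close> on the grid have law \<open>fpath_pmf\<close>, as the
  masses of single lists agree. This ties \<open>surv\<close>, for a fixed path of the trap, to the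
  walk in the Feynman-Kac formula.\<close>

lemma prob_avoid:
  assumes h: "0 \<le> h" and ys: "length ys = Suc n"
  shows "{\<omega> \<in> space M. \<forall>j\<le>n. X (real j * h) \<omega> \<noteq> ys ! j} \<in> events"
    and "prob {\<omega> \<in> space M. \<forall>j\<le>n. X (real j * h) \<omega> \<noteq> ys ! j} = surv (\<kappa> * h) 0 ys x\<^sub>0"
proof -
  let ?W = "\<lambda>\<omega>. map (\<lambda>i. X (real i * h) \<omega>) [0..<Suc n]"
  have [measurable]: "X (real i * h) \<in> M \<rightarrow>\<^sub>M count_space UNIV" for i
    using h by (intro measurable_walk) simp
  show "{\<omega> \<in> space M. \<forall>j\<le>n. X (real j * h) \<omega> \<noteq> ys ! j} \<in> events" by measurable
  have W_iff: "?W \<omega> = zs \<longleftrightarrow> length zs = Suc n \<and> (\<forall>i\<le>n. X (real i * h) \<omega> = zs ! i)" for \<omega> zs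
    unfolding list_eq_iff_nth_eq by (auto simp: less_Suc_eq_le simp del: upt_Suc)
  have sets: "{\<omega> \<in> space M. ?W \<omega> = zs} \<in> events" for zs
    unfolding W_iff by measurable
  have meas: "?W \<in> M \<rightarrow>\<^sub>M count_space UNIV"
    unfolding measurable_count_space_eq2_countable
    using sets by (simp add: vimage_def Int_def conj_commute del: upt_Suc)
  have eq: "distr M (count_space UNIV) ?W = measure_pmf (fpath_pmf (\<kappa> * h) n x\<^sub>0)"
  proof (rule measure_eqI_countable[where A = UNIV])
    fix zs :: "(int ^ 'd) list"
    have "emeasure (distr M (count_space UNIV) ?W) {zs} = prob {\<omega> \<in> space M. ?W \<omega> = zs}"
      using meas by (simp add: emeasure_distr emeasure_eq_measure vimage_def Int_def conj_commute del: upt_Suc)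
    also have "prob {\<omega> \<in> space M. ?W \<omega> = zs} = pmf (fpath_pmf (\<kappa> * h) n x\<^sub>0) zs"
    proof (cases "length zs = Suc n")
      case True
      have "prob {\<omega> \<in> space M. ?W \<omega> = zs} = prob {\<omega> \<in> space M. \<forall>i\<le>n. X (real i * h) \<omega> = zs ! i}"
        using True by (simp only: W_iff simp_thms)
      also have "\<dots> = pmf (fpath_pmf (\<kappa> * h) n x\<^sub>0) zs"
        using True h rate_pos by (subst measure_uniform_grid[OF h]) (simp add: pmf_fpath_pmf)
      finally show ?thesis .
    next
      case False
      then have "{\<omega> \<in> space M. ?W \<omega> = zs} = {}" by (simp only: W_iff) simp
      then have "prob {\<omega> \<in> space M. ?W \<omega> = zs} = 0" by (simp only: measure_empty)
      moreover have "pmf (fpath_pmf (\<kappa> * h) n x\<^sub>0) zs = 0"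
        using False h rate_pos by (simp add: pmf_fpath_pmf)
      ultimately show ?thesis by (simp only:)
    qed
    finally show "emeasure (distr M (count_space UNIV) ?W) {zs} = emeasure (measure_pmf (fpath_pmf (\<kappa> * h) n x\<^sub>0)) {zs}"
      by (simp add: emeasure_pmf_single)
  qed auto
  have "surv (\<kappa> * h) 0 ys x\<^sub>0 = measure (distr M (count_space UNIV) ?W) {l. \<forall>j\<le>n. l ! j \<noteq> ys ! j}"
    unfolding eq by (rule prob_fpath_pmf_avoid[OF ys, symmetric])
  also have "\<dots> = prob (?W -` {l. \<forall>j\<le>n. l ! j \<noteq> ys ! j} \<inter> space M)"
    using meas by (rule measure_distr) simp
  also have "?W -` {l. \<forall>j\<le>n. l ! j \<noteq> ys ! j} \<inter> space M = {\<omega> \<in> space M. \<forall>j\<le>n. X (real j * h) \<omega> \<noteq> ys ! j}"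
    by (auto simp: less_Suc_eq_le simp del: upt_Suc)
  finally show "prob {\<omega> \<in> space M. \<forall>j\<le>n. X (real j * h) \<omega> \<noteq> ys ! j} = surv (\<kappa> * h) 0 ys x\<^sub>0" by simp
qed

end

section \<open>The moving hard trap\<close>

text \<open>The integral in the Feynman-Kac formula, for a single pair of paths.\<close>

definition meeting_time :: "(real \<Rightarrow> 'c) \<Rightarrow> (real \<Rightarrow> 'c) \<Rightarrow> real \<Rightarrow> real" where
  "meeting_time \<zeta> y t = (LINT s:{0..t}|lborel. (if \<zeta> s = y (t - s) then 1 else 0))"

text \<open>If two right-constant paths, one of them run backwards, agree on a set of positive measure,
  then they agree at a time at which both are locally constant, and a fine grid detects this.\<close>

lemma meeting_detected_on_grid:
  assumes \<zeta>: "right_constant \<zeta>" and y: "right_constant y" and t: "0 < t"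
    and meet: "meeting_time \<zeta> y t \<noteq> 0"
  shows "\<forall>\<^sub>F N in sequentially. \<exists>j\<le>Suc N. \<zeta> (real j * (t / real (Suc N))) = y (real (Suc N - j) * (t / real (Suc N)))"
proof -
  have "\<exists>s. 0 < s \<and> s < t \<and> s \<notin> jumps \<zeta> \<and> t - s \<notin> jumps y \<and> \<zeta> s = y (t - s)"
  proof (rule ccontr)
    assume none: "\<not> ?thesis"
    \<comment> \<open>Endpoints and all times at which one of the two paths is not locally constant:
      a countable, hence null, set.\<close>
    define B where "B = {0, t} \<union> jumps \<zeta> \<union> (\<lambda>s. t - s) ` jumps y"
    have "countable B" unfolding B_def by (intro countable_Un countable_image countable_jumps \<zeta> y) auto
    then have "AE s in lborel. s \<notin> B"
      by (intro AE_not_in countable_imp_null_set_lborel)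
    then have "AE s in lborel. indicator {0..t} s *\<^sub>R (if \<zeta> s = y (t - s) then 1 else 0 :: real) = 0"
    proof eventually_elim
      case (elim s)
      have "t - s \<notin> jumps y"
      proof
        assume "t - s \<in> jumps y"
        then have "t - (t - s) \<in> (\<lambda>s. t - s) ` jumps y" by (rule imageI)
        then show False using elim by (simp add: B_def)
      qed
      moreover have "s \<noteq> 0" "s \<noteq> t" "s \<notin> jumps \<zeta>" using elim by (auto simp: B_def)
      ultimately show ?case using none by (auto simp: indicator_def less_le)
    qed
    then have "meeting_time \<zeta> y t = 0"
      unfolding meeting_time_def set_lebesgue_integral_def by (rule integral_eq_zero_AE)
    then show False using meet by simp
  qed
  then obtain s where s: "0 < s" "s < t" "s \<notin> jumps \<zeta>" "t - s \<notin> jumps y" "\<zeta> s = y (t - s)" by blast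
  have "\<forall>\<^sub>F r in at s. \<zeta> r = \<zeta> s" using s by (simp add: jumps_def)
  then obtain d1 where d1: "0 < d1" "\<And>r. r \<noteq> s \<Longrightarrow> dist r s < d1 \<Longrightarrow> \<zeta> r = \<zeta> s"
    unfolding eventually_at by auto
  have "\<forall>\<^sub>F r in at (t - s). y r = y (t - s)" using s by (simp add: jumps_def)
  then obtain d2 where d2: "0 < d2" "\<And>r. r \<noteq> t - s \<Longrightarrow> dist r (t - s) < d2 \<Longrightarrow> y r = y (t - s)"
    unfolding eventually_at by auto
  have "(\<lambda>N. t / real (Suc N)) \<longlonglongrightarrow> 0" by real_asymp
  then have "\<forall>\<^sub>F N in sequentially. t / real (Suc N) < min d1 d2"
    using d1(1) d2(1) by (intro order_tendstoD(2)[of _ 0]) auto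
  then show ?thesis
  proof eventually_elim
    case (elim N)
    define h where "h = t / real (Suc N)"
    have h: "0 < h" using t by (simp add: h_def)
    have ht: "real (Suc N) * h = t" by (simp add: h_def)
    \<comment> \<open>The grid point just below \<open>s\<close>; it and its reversal
      \<open>t - j * h\<close> are within \<open>h\<close> of \<open>s\<close> and of
      \<open>t - s\<close>.\<close>
    define j where "j = nat \<lfloor>s / h\<rfloor>"
    have "0 \<le> s / h" using s h by simp
    then have "real j \<le> s / h" "s / h < real j + 1" unfolding j_def by linarith+
    then have j: "real j * h \<le> s" "s < (real j + 1) * h"
      using h by (simp_all only: pos_le_divide_eq pos_divide_less_eq)
    have "real j * h < real (Suc N) * h" using j(1) s(2) ht by linarith
    then have "real j < real (Suc N)" using h by (simp only: mult_less_cancel_right_pos)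
    then have jN: "j \<le> Suc N" by linarith
    have "real (Suc N - j) * h = real (Suc N) * h - real j * h"
      using jN by (simp only: of_nat_diff left_diff_distrib)
    then have rev_time: "real (Suc N - j) * h = t - real j * h" by (simp only: ht)
    have "s < real j * h + h" using j(2) by (simp add: algebra_simps)
    then have dist: "dist (real j * h) s < h" using j(1) by (simp add: dist_real_def)
    then have "\<zeta> (real j * h) = \<zeta> s"
      using d1(2)[of "real j * h"] elim by (cases "real j * h = s") (auto simp: h_def)
    moreover have "dist (t - real j * h) (t - s) < h" using dist by (simp add: dist_real_def)
    then have "y (t - real j * h) = y (t - s)"
      using d2(2)[of "t - real j * h"] elim by (cases "real j * h = s") (auto simp: h_def)
    ultimately have "\<zeta> (real j * h) = y (real (Suc N - j) * h)" using s(5) by (simp add: rev_time)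
    then show ?case using jN unfolding h_def by blast
  qed
qed

text \<open>Clamping the times at 0 changes nothing for \<open>s\<close> in \<open>{0..t}\<close>
  and provides the joint measurability that integration over \<open>s\<close> requires.\<close>

lemma measurable_meeting_time:
  fixes X :: "real \<Rightarrow> 'a \<Rightarrow> 'c::countable" and Y :: "real \<Rightarrow> 'b \<Rightarrow> 'c"
  assumes X: "\<And>t. 0 \<le> t \<Longrightarrow> X t \<in> P \<rightarrow>\<^sub>M count_space UNIV" "\<And>\<omega>. \<omega> \<in> space P \<Longrightarrow> right_constant (\<lambda>t. X t \<omega>)"
    and Y: "\<And>t. 0 \<le> t \<Longrightarrow> Y t \<in> Q \<rightarrow>\<^sub>M count_space UNIV" "\<And>\<omega>. \<omega> \<in> space Q \<Longrightarrow> right_constant (\<lambda>t. Y t \<omega>)"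
  shows "(\<lambda>p. meeting_time (\<lambda>s. X s (snd p)) (\<lambda>s. Y s (fst p)) t) \<in> borel_measurable (Q \<Otimes>\<^sub>M P)"
proof -
  have mX: "(\<lambda>q. X (max 0 (snd q)) (snd (fst q))) \<in> (Q \<Otimes>\<^sub>M P) \<Otimes>\<^sub>M lborel \<rightarrow>\<^sub>M count_space UNIV"
  proof -
    have "(\<lambda>q. (snd q, snd (fst q))) \<in> (Q \<Otimes>\<^sub>M P) \<Otimes>\<^sub>M lborel \<rightarrow>\<^sub>M borel \<Otimes>\<^sub>M P" by measurable
    from measurable_compose[OF this right_constant_jointly_measurable[OF X]] show ?thesis by simp
  qed
  have mY: "(\<lambda>q. Y (max 0 (t - snd q)) (fst (fst q))) \<in> (Q \<Otimes>\<^sub>M P) \<Otimes>\<^sub>M lborel \<rightarrow>\<^sub>M count_space UNIV"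
  proof -
    have "(\<lambda>q. (t - snd q, fst (fst q))) \<in> (Q \<Otimes>\<^sub>M P) \<Otimes>\<^sub>M lborel \<rightarrow>\<^sub>M borel \<Otimes>\<^sub>M Q" by measurable
    from measurable_compose[OF this right_constant_jointly_measurable[OF Y]] show ?thesis by simp
  qed
  have "(\<lambda>q. if X (max 0 (snd q)) (snd (fst q)) = c then 1 else 0 :: real) \<in> borel_measurable ((Q \<Otimes>\<^sub>M P) \<Otimes>\<^sub>M lborel)" for c
    using measurable_compose[OF mX, of "\<lambda>z. if z = c then 1 else 0" borel] by simp
  from measurable_compose_countable[OF this mY]
  have eq: "(\<lambda>q. if X (max 0 (snd q)) (snd (fst q)) = Y (max 0 (t - snd q)) (fst (fst q)) then 1 else 0 :: real)
    \<in> borel_measurable ((Q \<Otimes>\<^sub>M P) \<Otimes>\<^sub>M lborel)" .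
  have "(\<lambda>q. indicator {0..t} (snd q) * (if X (max 0 (snd q)) (snd (fst q)) = Y (max 0 (t - snd q)) (fst (fst q)) then 1 else 0 :: real))
    \<in> borel_measurable ((Q \<Otimes>\<^sub>M P) \<Otimes>\<^sub>M lborel)"
    by (intro borel_measurable_times eq) measurable
  also have "(\<lambda>q. indicator {0..t} (snd q) * (if X (max 0 (snd q)) (snd (fst q)) = Y (max 0 (t - snd q)) (fst (fst q)) then 1 else 0 :: real))
     = (\<lambda>(p, s). indicator {0..t} s *\<^sub>R (if X s (snd p) = Y (t - s) (fst p) then 1 else 0 :: real))"
    by (auto simp: fun_eq_iff indicator_def max_def)
  finally have "(\<lambda>p. \<integral>s. indicator {0..t} s *\<^sub>R (if X s (snd p) = Y (t - s) (fst p) then 1 else 0 :: real) \<partial>lborel)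
    \<in> borel_measurable (Q \<Otimes>\<^sub>M P)"
    by (rule lborel.borel_measurable_lebesgue_integral)
  then show ?thesis
    unfolding meeting_time_def set_lebesgue_integral_def .
qed

text \<open>Fatou's lemma, stated for a pointwise bound by a lower limit, as this is what both kinds
  of trap provide.\<close>

lemma expectation_le_of_liminf:
  fixes f :: "'b \<Rightarrow> real" and g :: "nat \<Rightarrow> 'b \<Rightarrow> real"
  assumes Q: "prob_space Q" and f: "f \<in> borel_measurable Q" "\<And>\<omega>. \<omega> \<in> space Q \<Longrightarrow> 0 \<le> f \<omega> \<and> f \<omega> \<le> 1"
    and g: "\<And>N. g N \<in> borel_measurable Q" "\<And>N \<omega>. 0 \<le> g N \<omega> \<and> g N \<omega> \<le> 1"
    and le: "\<And>\<omega>. \<omega> \<in> space Q \<Longrightarrow> ennreal (f \<omega>) \<le> liminf (\<lambda>N. ennreal (g N \<omega>))"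
    and ev: "\<forall>\<^sub>F N in sequentially. (\<integral>\<omega>. g N \<omega> \<partial>Q) \<le> \<eta>" and \<eta>: "0 \<le> \<eta>"
  shows "(\<integral>\<omega>. f \<omega> \<partial>Q) \<le> \<eta>"
proof -
  interpret prob_space Q by fact
  have f_int: "integrable Q f"
    using f by (intro integrable_const_bound[where B = 1]) auto
  have g_int: "integrable Q (g N)" for N
    using g by (intro integrable_const_bound[where B = 1]) auto
  have "ennreal (\<integral>\<omega>. f \<omega> \<partial>Q) = (\<integral>\<^sup>+\<omega>. ennreal (f \<omega>) \<partial>Q)"
    by (rule nn_integral_eq_integral[symmetric, OF f_int]) (use f in auto)
  also have "\<dots> \<le> (\<integral>\<^sup>+\<omega>. liminf (\<lambda>N. ennreal (g N \<omega>)) \<partial>Q)"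
    by (rule nn_integral_mono) (rule le)
  also have "\<dots> \<le> liminf (\<lambda>N. \<integral>\<^sup>+\<omega>. ennreal (g N \<omega>) \<partial>Q)"
    using g(1) by (intro nn_integral_liminf) measurable
  also have "(\<lambda>N. \<integral>\<^sup>+\<omega>. ennreal (g N \<omega>) \<partial>Q) = (\<lambda>N. ennreal (\<integral>\<omega>. g N \<omega> \<partial>Q))"
    by (intro ext nn_integral_eq_integral g_int) (use g(2) in auto)
  also have "liminf \<dots> \<le> limsup \<dots>" by (rule Liminf_le_Limsup) simp
  also have "\<dots> \<le> ennreal \<eta>"
    by (rule Limsup_bounded) (use ev in \<open>auto elim!: eventually_mono intro: ennreal_leI\<close>)
  finally show ?thesis using \<eta> by simp
qed

lemma right_constant_walk:
  assumes "random_walk M \<kappa> x X" "\<omega> \<in> space M"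
  shows "right_constant (\<lambda>t. X t \<omega>)"
  using assms by (simp add: random_walk_def right_constant_def)

context lattice_walk
begin

lemma hit_bound_eq_expectation:
  assumes Q: "lattice_walk Q \<rho> (0 :: int ^ 'd) Y" and h: "0 \<le> t"
  shows "hit_bound \<rho> t (Suc N) x =
    (\<integral>\<omega>. 1 - surv (\<kappa> * (t / real (Suc N))) 0 (grid (\<lambda>s. Y s \<omega>) (t / real (Suc N)) (Suc N)) x \<partial>Q)"
proof -
  interpret Q: lattice_walk Q \<rho> "0 :: int ^ 'd" Y by fact
  have h0: "0 \<le> t / real (Suc N)" using h by simp
  show ?thesis
    unfolding hit_bound_def Q.distr_grid(2)[OF h0 refl, symmetric]
    by (rule integral_distr[OF Q.distr_grid(1)[OF h0 refl]]) simp
qed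

text \<open>Common end of both cases: the difference between soft and hard traps is confined to
  \<open>le\<close>, a comparison for each fixed path of \<open>Y\<close>, and to the measurability
  of \<open>v\<close>.\<close>

lemma expected_absorption_le:
  fixes v :: "'b \<Rightarrow> real"
  assumes Q: "lattice_walk Q \<rho> (0 :: int ^ 'd) Y" and t: "0 < t" and \<eta>: "0 \<le> \<eta>"
    and v: "v \<in> borel_measurable Q" "\<And>\<omega>. \<omega> \<in> space Q \<Longrightarrow> 0 \<le> v \<omega> \<and> v \<omega> \<le> 1"
    and le: "\<And>\<omega>. \<omega> \<in> space Q \<Longrightarrow> ennreal (1 - v \<omega>) \<le> liminf (\<lambda>N.
      ennreal (1 - surv (\<kappa> * (t / real (Suc N))) 0 (grid (\<lambda>s. Y s \<omega>) (t / real (Suc N)) (Suc N)) x))"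
    and small: "\<forall>\<^sub>F N in sequentially. hit_bound \<rho> t N x \<le> \<eta>"
  shows "\<bar>(\<integral>\<omega>. v \<omega> \<partial>Q) - 1\<bar> \<le> \<eta>"
proof -
  interpret Q: lattice_walk Q \<rho> "0 :: int ^ 'd" Y by fact
  let ?g = "\<lambda>N \<omega>. 1 - surv (\<kappa> * (t / real (Suc N))) 0 (grid (\<lambda>s. Y s \<omega>) (t / real (Suc N)) (Suc N)) x"
  have "(\<integral>\<omega>. 1 - v \<omega> \<partial>Q) \<le> \<eta>"
  proof (rule expectation_le_of_liminf[where g = ?g])
    show "prob_space Q" by (rule Q.prob_space_axioms)
    show "(\<lambda>\<omega>. 1 - v \<omega>) \<in> borel_measurable Q" using v(1) by measurable
    show "0 \<le> 1 - v \<omega> \<and> 1 - v \<omega> \<le> 1" if "\<omega> \<in> space Q" for \<omega> using v(2)[OF that] by simp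
    show "?g N \<in> borel_measurable Q" for N
      using t by (intro measurable_compose[OF Q.distr_grid(1)]) auto
    have "0 \<le> 1 - surv \<tau> 0 ys x \<and> 1 - surv \<tau> 0 ys x \<le> 1" for \<tau> ys
      using surv_bounds[of 0 \<tau> ys x] by simp
    then show "0 \<le> ?g N \<omega> \<and> ?g N \<omega> \<le> 1" for N \<omega> .
    have "\<forall>\<^sub>F N in sequentially. hit_bound \<rho> t (Suc N) x \<le> \<eta>"
      using small by (rule eventually_sequentially_Suc[THEN iffD2])
    then show "\<forall>\<^sub>F N in sequentially. (\<integral>\<omega>. ?g N \<omega> \<partial>Q) \<le> \<eta>"
      using hit_bound_eq_expectation[OF Q] t by simp
  qed (use le \<eta> in auto)
  moreover have int: "integrable Q v"
    using v by (intro Q.integrable_const_bound[where B = 1]) auto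
  then have "(\<integral>\<omega>. 1 - v \<omega> \<partial>Q) = 1 - (\<integral>\<omega>. v \<omega> \<partial>Q)"
    by (simp add: Q.prob_space)
  moreover have "(\<integral>\<omega>. v \<omega> \<partial>Q) \<le> 1"
    using Q.integral_le_const[OF int, of 1] v(2) by auto
  ultimately show ?thesis by simp
qed

text \<open>The Euler scheme serves twice: as its limit the solution is measurable in the path of
  \<open>Y\<close>, and lowering its trap factor to 0 turns it into the survival probability on the
  grid.\<close>

lemma soft_absorption:
  assumes Q: "lattice_walk Q \<rho> (0 :: int ^ 'd) Y" and t: "0 < t" and \<eta>: "0 \<le> \<eta>" and \<gamma>: "\<gamma> < 0"
    and sol: "\<And>\<omega>. \<omega> \<in> space Q \<Longrightarrow> pam_solution \<kappa> (\<lambda>t x. if x = Y t \<omega> then \<gamma> else 0) (\<lambda>_. 1) (u \<omega>)"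
    and small: "\<forall>\<^sub>F N in sequentially. hit_bound \<rho> t N x \<le> \<eta>"
  shows "\<bar>(\<integral>\<omega>. u \<omega> t x \<partial>Q) - 1\<bar> \<le> \<eta>"
proof -
  interpret Q: lattice_walk Q \<rho> "0 :: int ^ 'd" Y by fact
  let ?h = "\<lambda>N. t / real (Suc N)"
  let ?s = "\<lambda>c N \<omega>. surv (\<kappa> * ?h N) c (grid (\<lambda>s. Y s \<omega>) (?h N) (Suc N)) x"
  have soft: "soft_trap_walk \<kappa> \<gamma> (\<lambda>t. Y t \<omega>) (u \<omega>) M x\<^sub>0 X" if "\<omega> \<in> space Q" for \<omega>
    using that rate_pos \<gamma> sol right_constant_walk[OF Q.walk that]
    by (intro soft_trap_walk.intro soft_trap.intro lattice_walk_axioms) auto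
  have lim: "(\<lambda>N. ?s (1 + \<gamma> * ?h N) N \<omega>) \<longlonglongrightarrow> u \<omega> t x" if "\<omega> \<in> space Q" for \<omega>
    by (rule soft_trap_walk.surv_grid_tendsto[OF soft[OF that] t])
  have meas: "(\<lambda>\<omega>. ?s c N \<omega>) \<in> borel_measurable Q" for c N
    using t by (intro measurable_compose[OF Q.distr_grid(1)]) auto
  have "(\<lambda>\<omega>. u \<omega> t x) \<in> borel_measurable Q"
    by (rule borel_measurable_LIMSEQ_real[OF lim meas])
  moreover have "0 \<le> u \<omega> t x \<and> u \<omega> t x \<le> 1" if "\<omega> \<in> space Q" for \<omega>
  proof -
    interpret soft_trap_walk \<kappa> \<gamma> "\<lambda>t. Y t \<omega>" "u \<omega>" M x\<^sub>0 X by (rule soft[OF that])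
    show ?thesis using u_nonneg u_le_1 t by simp
  qed
  moreover have "ennreal (1 - u \<omega> t x) \<le> liminf (\<lambda>N. ennreal (1 - ?s 0 N \<omega>))" if "\<omega> \<in> space Q" for \<omega>
  proof -
    have "(\<lambda>N. ennreal (1 - ?s (1 + \<gamma> * ?h N) N \<omega>)) \<longlonglongrightarrow> ennreal (1 - u \<omega> t x)"
      by (intro tendsto_ennrealI tendsto_diff tendsto_const lim that)
    then have "ennreal (1 - u \<omega> t x) = liminf (\<lambda>N. ennreal (1 - ?s (1 + \<gamma> * ?h N) N \<omega>))"
      by (intro lim_imp_Liminf[symmetric]) auto
    also have "\<dots> \<le> liminf (\<lambda>N. ennreal (1 - ?s 0 N \<omega>))"
    proof (rule Liminf_mono)
      have "?h \<longlonglongrightarrow> 0" by real_asymp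
      \<comment> \<open>From here on \<open>1 + \<gamma> * ?h N\<close> is nonnegative, as
        \<open>surv_mono\<close> requires.\<close>
      then have "\<forall>\<^sub>F N in sequentially. ?h N < 1 / \<bar>\<gamma>\<bar>"
        by (rule order_tendstoD(2)) (use \<gamma> in simp)
      then show "\<forall>\<^sub>F N in sequentially. ennreal (1 - ?s (1 + \<gamma> * ?h N) N \<omega>) \<le> ennreal (1 - ?s 0 N \<omega>)"
      proof eventually_elim
        case (elim N)
        have "0 \<le> 1 + \<gamma> * ?h N" using elim \<gamma> by (simp add: field_simps)
        moreover have "\<gamma> * ?h N \<le> 0" using \<gamma> t by (intro mult_nonpos_nonneg) auto
        ultimately have "?s 0 N \<omega> \<le> ?s (1 + \<gamma> * ?h N) N \<omega>" by (intro surv_mono) auto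
        then show ?case by (intro ennreal_leI) simp
      qed
    qed
    finally show ?thesis .
  qed
  ultimately show ?thesis
    by (rule expected_absorption_le[OF Q t \<eta> _ _ _ small])
qed

text \<open>Fatou's lemma is used twice, here for \<open>X\<close> with the path of \<open>Y\<close>
  fixed: a meeting of positive duration is eventually seen by the grid, so its probability is at
  most the lower limit of the grid probabilities.\<close>

lemma hard_absorption:
  assumes Q: "lattice_walk Q \<rho> (0 :: int ^ 'd) Y" and t: "0 < t" and \<eta>: "0 \<le> \<eta>"
    and u: "\<And>\<omega>. \<omega> \<in> space Q \<Longrightarrow> u \<omega> = (LINT \<omega>'|M. (if meeting_time (\<lambda>s. X s \<omega>') (\<lambda>s. Y s \<omega>) t = 0 then 1 else 0))"
    and small: "\<forall>\<^sub>F N in sequentially. hit_bound \<rho> t N x\<^sub>0 \<le> \<eta>"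
  shows "\<bar>(\<integral>\<omega>. u \<omega> \<partial>Q) - 1\<bar> \<le> \<eta>"
proof -
  interpret Q: lattice_walk Q \<rho> "0 :: int ^ 'd" Y by fact
  let ?h = "\<lambda>N. t / real (Suc N)"
  let ?s = "\<lambda>N \<omega>. surv (\<kappa> * ?h N) 0 (grid (\<lambda>s. Y s \<omega>) (?h N) (Suc N)) x\<^sub>0"
  let ?A = "\<lambda>\<omega> \<omega>'. meeting_time (\<lambda>s. X s \<omega>') (\<lambda>s. Y s \<omega>) t"
  define F where "F p = (if ?A (fst p) (snd p) = 0 then 1 else 0 :: real)" for p
  have mA: "(\<lambda>p. ?A (fst p) (snd p)) \<in> borel_measurable (Q \<Otimes>\<^sub>M M)"
    by (rule measurable_meeting_time)
       (auto intro: measurable_walk Q.measurable_walk right_constant_walk[OF walk] right_constant_walk[OF Q.walk])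
  have mF: "F \<in> borel_measurable (Q \<Otimes>\<^sub>M M)"
    unfolding F_def using mA by measurable
  have mF1: "(\<lambda>\<omega>'. F (\<omega>, \<omega>')) \<in> borel_measurable M" if "\<omega> \<in> space Q" for \<omega>
    by (rule measurable_Pair2[OF mF that])
  have intF: "integrable M (\<lambda>\<omega>'. F (\<omega>, \<omega>'))" if "\<omega> \<in> space Q" for \<omega>
    using mF1[OF that] by (intro integrable_const_bound[where B = 1]) (auto simp: F_def)
  have uF: "u \<omega> = (\<integral>\<omega>'. F (\<omega>, \<omega>') \<partial>M)" if "\<omega> \<in> space Q" for \<omega>
    using u[OF that] by (simp add: F_def)
  have "(\<lambda>\<omega>. \<integral>\<omega>'. F (\<omega>, \<omega>') \<partial>M) \<in> borel_measurable Q"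
    by (rule borel_measurable_lebesgue_integral) (use mF in \<open>simp add: case_prod_beta\<close>)
  then have "u \<in> borel_measurable Q"
    by (subst measurable_cong[OF uF])
  moreover have "0 \<le> u \<omega> \<and> u \<omega> \<le> 1" if "\<omega> \<in> space Q" for \<omega>
  proof -
    have "0 \<le> F p \<and> F p \<le> 1" for p by (simp add: F_def)
    then show ?thesis
      unfolding uF[OF that]
      using integral_le_const[OF intF[OF that], of 1] by (simp add: Bochner_Integration.integral_nonneg)
  qed
  moreover have "ennreal (1 - u \<omega>) \<le> liminf (\<lambda>N. ennreal (1 - ?s N \<omega>))" if w: "\<omega> \<in> space Q" for \<omega>
  proof -
    let ?C = "\<lambda>N. {\<omega>' \<in> space M. \<forall>j\<le>Suc N. X (real j * ?h N) \<omega>' \<noteq> grid (\<lambda>s. Y s \<omega>) (?h N) (Suc N) ! j}"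
    have h0: "0 \<le> ?h N" for N using t by simp
    have C: "?C N \<in> events" "prob (?C N) = ?s N \<omega>" for N
      by (rule prob_avoid[OF h0 length_grid])+
    have "ennreal (1 - u \<omega>) = ennreal (\<integral>\<omega>'. 1 - F (\<omega>, \<omega>') \<partial>M)"
      using intF[OF w] by (simp add: uF[OF w] prob_space)
    also have "\<dots> = (\<integral>\<^sup>+\<omega>'. ennreal (1 - F (\<omega>, \<omega>')) \<partial>M)"
      using intF[OF w] by (intro nn_integral_eq_integral[symmetric]) (auto simp: F_def)
    also have "\<dots> \<le> (\<integral>\<^sup>+\<omega>'. liminf (\<lambda>N. indicator (space M - ?C N) \<omega>') \<partial>M)"
    proof (rule nn_integral_mono)
      fix \<omega>' assume w': "\<omega>' \<in> space M"
      show "ennreal (1 - F (\<omega>, \<omega>')) \<le> liminf (\<lambda>N. indicator (space M - ?C N) \<omega>')"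
      proof (cases "?A \<omega> \<omega>' = 0")
        case False
        have "\<forall>\<^sub>F N in sequentially. \<exists>j\<le>Suc N. X (real j * ?h N) \<omega>' = Y (real (Suc N - j) * ?h N) \<omega>"
          by (rule meeting_detected_on_grid[OF right_constant_walk[OF walk w'] right_constant_walk[OF Q.walk w] t False])
        then have "\<forall>\<^sub>F N in sequentially. (1 :: ennreal) \<le> indicator (space M - ?C N) \<omega>'"
        proof eventually_elim
          case (elim N)
          then have "\<omega>' \<notin> ?C N" by (auto simp: nth_grid simp del: grid.simps of_nat_Suc)
          with w' have "\<omega>' \<in> space M - ?C N" by blast
          then show ?case by (simp only: indicator_simps order_refl)
        qed
        then have "1 \<le> liminf (\<lambda>N. indicator (space M - ?C N) \<omega>' :: ennreal)"
          by (rule Liminf_bounded)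
        then show ?thesis using False by (simp add: F_def)
      qed (simp add: F_def)
    qed
    also have "\<dots> \<le> liminf (\<lambda>N. \<integral>\<^sup>+\<omega>'. indicator (space M - ?C N) \<omega>' \<partial>M)"
      by (intro nn_integral_liminf borel_measurable_indicator sets.compl_sets C(1))
    also have "(\<lambda>N. \<integral>\<^sup>+\<omega>'. indicator (space M - ?C N) \<omega>' \<partial>M) = (\<lambda>N. ennreal (1 - ?s N \<omega>))"
    proof
      fix N
      have "(\<integral>\<^sup>+\<omega>'. indicator (space M - ?C N) \<omega>' \<partial>M) = emeasure M (space M - ?C N)"
        by (intro nn_integral_indicator sets.compl_sets C(1))
      also have "\<dots> = ennreal (1 - ?s N \<omega>)"
        using prob_compl[OF C(1), of N] by (simp only: emeasure_eq_measure C(2))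
      finally show "(\<integral>\<^sup>+\<omega>'. indicator (space M - ?C N) \<omega>' \<partial>M) = ennreal (1 - ?s N \<omega>)" .
    qed
    finally show ?thesis .
  qed
  ultimately show ?thesis
    by (rule expected_absorption_le[OF Q t \<eta> _ _ _ small])
qed

end

theorem theorem4:
  fixes \<kappa> \<rho> :: real and \<gamma> :: ereal
    and P :: "int ^ 'd \<Rightarrow> 'a measure" and X :: "real \<Rightarrow> 'a \<Rightarrow> int ^ 'd"
    and Q :: "'b measure" and Y :: "real \<Rightarrow> 'b \<Rightarrow> int ^ 'd"
    and u :: "'b \<Rightarrow> real \<Rightarrow> int ^ 'd \<Rightarrow> real"
    and m :: "int ^ 'd \<Rightarrow> real \<Rightarrow> real"
  assumes "CARD('d) \<ge> 2" and "\<kappa> > 0" and "\<rho> > 0" and "\<gamma> < 0"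
    and "\<And>x. random_walk (P x) \<kappa> x X"
    and "random_walk Q \<rho> 0 Y"
    and "\<And>\<omega>. \<omega> \<in> space Q \<Longrightarrow> trap_solution P X \<kappa> \<gamma> (\<lambda>t. Y t \<omega>) (\<lambda>_. 1) (u \<omega>)"
    and "\<And>x t. m x t = (LINT \<omega>|Q. u \<omega> t x)"
  shows "\<forall>x. (m x \<longlongrightarrow> 1) at_top"
proof
  fix x
  \<comment> \<open>Each starting point has its own measure \<open>P x\<close>, so the walk is
    interpreted after \<open>x\<close> is fixed.\<close>
  interpret X: lattice_walk "P x" \<kappa> x X
    using assms(2,5) by unfold_locales
  have Q: "lattice_walk Q \<rho> 0 Y"
    using assms(3,6) by unfold_locales
  show "(m x \<longlongrightarrow> 1) at_top"
    unfolding tendsto_iff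
  proof (intro allI impI)
    fix e :: real assume "0 < e"
    \<comment> \<open>Half of \<open>e\<close>, because the bounds obtained are not strict.\<close>
    then have e: "0 < e / 2" by simp
    obtain t0 where t0: "0 < t0" "\<And>t x. t0 \<le> t \<Longrightarrow> \<forall>\<^sub>F N in sequentially. X.hit_bound \<rho> t N x \<le> e / 2"
      using X.hit_bound_small[OF assms(3) assms(1) e] by blast
    have "\<bar>m x t - 1\<bar> \<le> e / 2" if t: "t0 \<le> t" for t
    proof (cases "\<gamma> = -\<infinity>")
      case True
      show ?thesis
        unfolding assms(8)
      proof (rule X.hard_absorption[OF Q])
        show "u \<omega> t x = (LINT \<omega>'|P x. (if meeting_time (\<lambda>s. X s \<omega>') (\<lambda>s. Y s \<omega>) t = 0 then 1 else 0))"
          if "\<omega> \<in> space Q" for \<omega>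
          using assms(7)[OF that] True t t0(1)
          by (simp add: trap_solution_def hard_trap_feynman_kac_def meeting_time_def)
      qed (use t t0 e in auto)
    next
      case False
      have \<gamma>: "real_of_ereal \<gamma> < 0"
        using False assms(4) by (cases \<gamma>) auto
      show ?thesis
        unfolding assms(8)
      proof (rule X.soft_absorption[OF Q _ _ \<gamma>])
        show "pam_solution \<kappa> (\<lambda>t x. if x = Y t \<omega> then real_of_ereal \<gamma> else 0) (\<lambda>_. 1) (u \<omega>)"
          if "\<omega> \<in> space Q" for \<omega>
          using assms(7)[OF that] False by (simp add: trap_solution_def)
      qed (use t t0 e in auto)
    qed
    then have "dist (m x t) 1 < e" if "t0 \<le> t" for t
      using that \<open>0 < e\<close> by (fastforce simp: dist_real_def)
    then show "\<forall>\<^sub>F t in at_top. dist (m x t) 1 < e"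
      by (rule eventually_at_top_linorderI)
  qed
qed

end
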